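(* Let $u$ be a divergence-free vector field in $W^{1,3/2}(\mathbb{T}^2)$. Then $$\Pi_q[u] = \int_{\mathbb{T}^2} S_q[u] \cdot S_q[ (u \cdot \nabla) u] \,dx\;\longrightarrow\; 0\quad\text{as } q \to \infty.$$
   Context: Here $\mathbb{T}^2$ is the two-dimensional torus of unit period, $\mathbb{T}^2=\mathbb{R}^2/\mathbb{Z}^2$; vector fields are real, $\mathbb{R}^2$-valued. Fourier coefficients: $\widehat{f}(\alpha) = \int_{\mathbb{T}^2} e^{-2 \pi i \alpha \cdot x}f(x)\, dx$ for $\alpha\in\mathbb{Z}^2$, so $f(x) = \sum_{\alpha \in \mathbb{Z}^2} \widehat{f}(\alpha) e^{2 \pi i \alpha \cdot x}$. Set $\lambda_q=2^q$. Fix a nonnegative radial function $\chi\in C_c^\infty(\mathbb{R}^2)$ with support contained in the unit ball $B(0;1)$ and $\chi(\xi)=1$ if $|\xi|\le 1/2$. The $q$-th Littlewood-Paley truncation ($q\ge 0$ an integer) is $$S_q[f]=\sum_{\alpha\in\mathbb{Z}^2}\chi(\lambda_q^{-1}\alpha)\widehat f(\alpha)e^{2\pi i\alpha\cdot x},$$ applied componentwise to vector fields. *)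

theory Defs
  imports "HOL-Analysis.Analysis"
begin

definition lattice_vec :: "int^2 \<Rightarrow> real^2" where
  "lattice_vec \<alpha> = (\<chi> i. of_int (\<alpha> $ i))"

text \<open>Functions on the torus are \<open>\<int>\<^sup>2\<close>-periodic functions on the plane, integrated over one period cell.\<close>

definition torus_periodic :: "(real^2 \<Rightarrow> 'b) \<Rightarrow> bool" where
  "torus_periodic f \<longleftrightarrow> (\<forall>x k. f (x + lattice_vec k) = f x)"

definition torus :: "(real^2) measure" where
  "torus = lebesgue_on {x. \<forall>i. 0 \<le> x $ i \<and> x $ i < 1}"

definition torus_Lp :: "real \<Rightarrow> (real^2 \<Rightarrow> 'b::euclidean_space) \<Rightarrow> bool" where
  "torus_Lp p f \<longleftrightarrow> torus_periodic f \<and> f \<in> borel_measurable torus \<and>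
     integrable torus (\<lambda>x. norm (f x) powr p)"

definition partial :: "2 \<Rightarrow> (real^2 \<Rightarrow> real) \<Rightarrow> real^2 \<Rightarrow> real" where
  "partial j f x = frechet_derivative f (at x) (axis j 1)"

primrec C_k :: "nat \<Rightarrow> (real^2 \<Rightarrow> real) \<Rightarrow> bool" where
  "C_k 0 f \<longleftrightarrow> continuous_on UNIV f"
| "C_k (Suc k) f \<longleftrightarrow> (\<forall>x. f differentiable (at x)) \<and> (\<forall>j. C_k k (partial j f))"

definition smooth :: "(real^2 \<Rightarrow> real) \<Rightarrow> bool" where
  "smooth f \<longleftrightarrow> (\<forall>k. C_k k f)"

definition has_weak_partial :: "2 \<Rightarrow> (real^2 \<Rightarrow> real) \<Rightarrow> (real^2 \<Rightarrow> real) \<Rightarrow> bool" where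
  "has_weak_partial j f g \<longleftrightarrow> torus_Lp 1 f \<and> torus_Lp 1 g \<and>
     (\<forall>\<phi>. smooth \<phi> \<and> torus_periodic \<phi> \<longrightarrow>
        (LINT x|torus. f x * partial j \<phi> x) = - (LINT x|torus. g x * \<phi> x))"

text \<open>Weak derivatives are unique up to null sets; \<open>weak_partial\<close> selects a representative and
  is meaningful only if a weak derivative exists, as it does on \<open>sobolev_W1\<close>.\<close>

definition weak_partial :: "2 \<Rightarrow> (real^2 \<Rightarrow> real) \<Rightarrow> real^2 \<Rightarrow> real" where
  "weak_partial j f = (SOME g. has_weak_partial j f g)"

definition sobolev_W1 :: "real \<Rightarrow> (real^2 \<Rightarrow> real^2) set" where
  "sobolev_W1 p = {u. torus_Lp p u \<and>
     (\<forall>i j. \<exists>g. torus_Lp p g \<and> has_weak_partial j (\<lambda>x. u x $ i) g)}"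

definition divergence_free :: "(real^2 \<Rightarrow> real^2) \<Rightarrow> bool" where
  "divergence_free u \<longleftrightarrow> (AE x in torus. (\<Sum>i\<in>UNIV. weak_partial i (\<lambda>y. u y $ i) x) = 0)"

definition advect :: "(real^2 \<Rightarrow> real^2) \<Rightarrow> real^2 \<Rightarrow> real^2" where
  "advect u x = (\<chi> i. \<Sum>j\<in>UNIV. u x $ j * weak_partial j (\<lambda>y. u y $ i) x)"

definition fourier_coeff :: "(real^2 \<Rightarrow> complex) \<Rightarrow> int^2 \<Rightarrow> complex" where
  "fourier_coeff f \<alpha> =
     (LINT x|torus. exp (- 2 * of_real pi * \<i> * of_real (lattice_vec \<alpha> \<bullet> x)) * f x)"

definition LP_cutoff :: "(real^2 \<Rightarrow> real) \<Rightarrow> bool" where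
  "LP_cutoff \<psi> \<longleftrightarrow> smooth \<psi> \<and> (\<forall>\<xi>. \<psi> \<xi> \<ge> 0) \<and>
     (\<forall>\<xi> \<eta>. norm \<xi> = norm \<eta> \<longrightarrow> \<psi> \<xi> = \<psi> \<eta>) \<and>
     closure {\<xi>. \<psi> \<xi> \<noteq> 0} \<subseteq> ball 0 1 \<and>
     (\<forall>\<xi>. norm \<xi> \<le> 1/2 \<longrightarrow> \<psi> \<xi> = 1)"

definition freq :: "nat \<Rightarrow> real" where
  "freq q = 2 ^ q"

text \<open>The sum has only finitely many nonzero terms when \<open>\<psi>\<close> is a cutoff.\<close>

definition LP_trunc :: "(real^2 \<Rightarrow> real) \<Rightarrow> nat \<Rightarrow> (real^2 \<Rightarrow> complex) \<Rightarrow> real^2 \<Rightarrow> complex" where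
  "LP_trunc \<psi> q f x = (\<Sum>\<^sub>\<infinity>\<alpha>\<in>UNIV.
     of_real (\<psi> (inverse (freq q) *\<^sub>R lattice_vec \<alpha>)) * fourier_coeff f \<alpha> *
     exp (2 * of_real pi * \<i> * of_real (lattice_vec \<alpha> \<bullet> x)))"

definition LP_trunc_vec :: "(real^2 \<Rightarrow> real) \<Rightarrow> nat \<Rightarrow> (real^2 \<Rightarrow> real^2) \<Rightarrow> real^2 \<Rightarrow> complex^2" where
  "LP_trunc_vec \<psi> q v x = (\<chi> i. LP_trunc \<psi> q (\<lambda>y. of_real (v y $ i)) x)"

text \<open>Truncations of real fields are real-valued because a radial \<open>\<psi>\<close> is even, so the bilinear
  product below is the real dot product. The inner product on \<open>complex^2\<close> is not used since it
  would take real parts.\<close>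

definition energy_flux :: "(real^2 \<Rightarrow> real) \<Rightarrow> nat \<Rightarrow> (real^2 \<Rightarrow> real^2) \<Rightarrow> complex" where
  "energy_flux \<psi> q u =
     (LINT x|torus. (\<Sum>i\<in>UNIV. LP_trunc_vec \<psi> q u x $ i * LP_trunc_vec \<psi> q (advect u) x $ i))"

end

theory Submission
  imports Defs
begin

text \<open>By the Sobolev embedding \<open>u\<close> lies in \<open>L\<^sup>6\<close>, so the trilinear form \<open>\<integral> v \<cdot> (u \<cdot> \<nabla>) w\<close> is bounded by the
  \<open>L\<^sup>6\<close> norms of \<open>v\<close> and \<open>u\<close> and the \<open>L\<close>-\<open>3/2\<close> norm of \<open>\<nabla>w\<close>. Truncations are self-adjoint, so the flux equals
  \<open>\<integral> S\<^sub>q S\<^sub>q u \<cdot> (u \<cdot> \<nabla>) u\<close>. Let \<open>P = S\<^sub>m u\<close>, which is close to \<open>u\<close> in the Sobolev norm for large \<open>m\<close> and is fixed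
  by \<open>S\<^sub>q\<close> for \<open>q > m\<close>. Then the flux is \<open>\<integral> S\<^sub>q S\<^sub>q (u - P) \<cdot> (u \<cdot> \<nabla>) u + \<integral> P \<cdot> (u \<cdot> \<nabla>) (u - P)\<close>, because
  \<open>\<integral> P \<cdot> (u \<cdot> \<nabla>) P = \<integral> u \<cdot> \<nabla> \<bar>P\<bar>\<^sup>2 / 2\<close> vanishes for divergence-free \<open>u\<close>, and both terms are small uniformly in \<open>q\<close>.

  Everything rests on a bound of the \<open>L\<^sup>1\<close> norm of the truncation kernels which is uniform in \<open>q\<close>. It
  follows from the Cauchy-Schwarz inequality with a quadratic weight and Parseval, since the second differences
  of \<open>\<psi> (\<cdot> / \<lambda>\<^sub>q)\<close> are of the order of the inverse square of \<open>\<lambda>\<^sub>q\<close>.\<close>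

subsection \<open>Integration over the torus\<close>

text \<open>The exponents are critical in two dimensions: 2/3 - 1/2 = 1/6 in the embedding and 1/6 +
  1/6 + 2/3 = 1 in Hoelder's inequality. Nothing is left over to yield a rate of decay, hence the
  argument by approximation. The approximant has to serve as a test function, to be bounded in
  \<open>L^6\<close> independently of its quality, and to be unaffected by later truncations; a
  truncation of \<open>u\<close> at a lower level is all three, because \<open>\<psi>\<close> equals
  1 on the ball of radius 1/2.

  The embedding is proved for trigonometric polynomials, where classical calculus applies, and
  passes to \<open>u\<close> by Fatou's lemma. Weak derivatives are handled through Fourier
  coefficients: testing with sines and cosines determines the coefficients, and convergence of
  truncations in \<open>L^1\<close> shows that these determine the function. This also settles which
  function \<open>weak_partial\<close> has selected, up to a null set.\<close>

definition cell :: "(real^2) set" where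
  "cell = {x. \<forall>i. 0 \<le> x $ i \<and> x $ i < 1}"

definition vec2 :: "real \<Rightarrow> real \<Rightarrow> real^2" where
  "vec2 a b = (\<chi> i. if i = 1 then a else b)"

lemma vec2_nth [simp]: "vec2 a b $ 1 = a" "vec2 a b $ 2 = b"
  by (simp_all add: vec2_def)

lemma vec2_eta [simp]: "vec2 (x $ 1) (x $ 2) = x"
  by (simp add: vec_eq_iff forall_2)

lemma vec2_in_cell_iff: "vec2 a b \<in> cell \<longleftrightarrow> a \<in> {0..<1} \<and> b \<in> {0..<1}"
  by (auto simp: cell_def forall_2)

lemma continuous_vec2:
  "continuous_on UNIV (\<lambda>p. vec2 (fst p) (snd p))"
  unfolding vec2_def
proof (rule continuous_on_vec_lambda)
  fix i :: 2
  show "continuous_on UNIV (\<lambda>p. if i = 1 then fst p else snd p)"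
    by (cases "i = 1") (auto intro!: continuous_intros)
qed

lemma borel_measurable_vec2 [measurable]:
  "(\<lambda>p. vec2 (fst p) (snd p)) \<in> borel_measurable borel"
  by (rule borel_measurable_continuous_onI[OF continuous_vec2])

lemma borel_measurable_vec2' [measurable (raw)]:
  assumes [measurable]: "f \<in> borel_measurable M" "g \<in> borel_measurable M"
  shows "(\<lambda>p. vec2 (f p) (g p)) \<in> borel_measurable M"
proof -
  have "(\<lambda>p. (f p, g p)) \<in> measurable M borel"
    by measurable
  from measurable_comp[OF this borel_measurable_vec2] show ?thesis
    by (simp add: comp_def)
qed

lemma Basis_real2: "(Basis :: (real^2) set) = {axis 1 1, axis 2 1}"
  by (auto simp: Basis_vec_def axis_eq_axis exhaust_2) (metis exhaust_2)

text \<open>Measures that agree on boxes coincide. This identification lets Fubini and Tonelli on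
  pairs of reals act on integrals over \<open>cell\<close>.\<close>

lemma lborel_vec2: "(lborel :: (real^2) measure) = distr lborel borel (\<lambda>p. vec2 (fst p) (snd p))"
proof (rule lborel_eqI)
  fix l u :: "real^2"
  assume le: "\<And>b. b \<in> Basis \<Longrightarrow> l \<bullet> b \<le> u \<bullet> b"
  have le1: "l $ 1 \<le> u $ 1" "l $ 2 \<le> u $ 2"
    using le[of "axis 1 1"] le[of "axis 2 1"] by (auto simp: Basis_real2 inner_axis)
  have vim: "(\<lambda>p. vec2 (fst p) (snd p)) -` box l u = box (l $ 1, l $ 2) (u $ 1, u $ 2)"
    by (auto simp: mem_box_cart forall_2 mem_box Basis_prod_def)
  have "emeasure (distr lborel borel (\<lambda>p. vec2 (fst p) (snd p))) (box l u) = 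
      emeasure lborel (box (l $ 1, l $ 2) (u $ 1, u $ 2))"
    by (subst emeasure_distr) (auto simp: vim)
  also have "\<dots> = ennreal (\<Prod>b\<in>Basis. ((u $ 1, u $ 2) - (l $ 1, l $ 2)) \<bullet> b)"
    using le1 by (subst emeasure_lborel_box) (auto simp: Basis_prod_def)
  also have "(\<Prod>b\<in>Basis. ((u $ 1, u $ 2) - (l $ 1, l $ 2)) \<bullet> b) = (u $ 1 - l $ 1) * (u $ 2 - l $ 2)"
    by (simp add: Basis_prod_def prod.union_disjoint)
  also have "\<dots> = (\<Prod>b\<in>Basis. (u - l) \<bullet> b)"
    by (simp add: Basis_real2 inner_axis axis_eq_axis)
  finally show "emeasure (distr lborel borel (\<lambda>p. vec2 (fst p) (snd p))) (box l u) =
      ennreal (\<Prod>b\<in>Basis. (u - l) \<bullet> b)" .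
qed simp

lemma cell_borel [measurable]: "cell \<in> sets borel"
proof -
  have eq: "cell = (\<Inter>i\<in>UNIV. {x. 0 \<le> x $ i} \<inter> {x. x $ i < 1})"
    by (auto simp: cell_def)
  show ?thesis
    unfolding eq
    by (intro sets.finite_INT sets.Int borel_closed closed_Collect_le borel_open open_Collect_less
        continuous_intros) auto
qed

lemma torus_eq: "torus = lebesgue_on cell"
  by (simp add: torus_def cell_def)

lemma cell_lebesgue: "cell \<in> sets lebesgue"
  using cell_borel by simp

lemma space_torus [simp]: "space torus = cell"
  by (simp add: torus_eq)

lemma measurable_torus_borel: "f \<in> borel_measurable borel \<Longrightarrow> f \<in> borel_measurable torus"
  unfolding torus_eq by (intro measurable_restrict_space1 measurable_completion) simp

lemma id_measurable_torus: "(\<lambda>x. x) \<in> measurable torus borel"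
  by (rule measurable_torus_borel) simp

lemma nn_integral_torus:
  assumes [measurable]: "f \<in> borel_measurable borel"
  shows "(\<integral>\<^sup>+x. f x \<partial>torus) = (\<integral>\<^sup>+a\<in>{0..<1}. (\<integral>\<^sup>+b\<in>{0..<1}. f (vec2 a b) \<partial>lborel) \<partial>lborel)"
proof -
  have mf: "(\<lambda>p. f (vec2 (fst p) (snd p))) \<in> borel_measurable (lborel \<Otimes>\<^sub>M lborel)"
    by (rule measurable_compose[OF _ assms]) measurable
  have "(\<integral>\<^sup>+x. f x \<partial>torus) = (\<integral>\<^sup>+x. f x * indicator cell x \<partial>(lborel :: (real^2) measure))"
    by (simp add: torus_eq nn_integral_restrict_space nn_integral_completion cell_lebesgue)
  also have "\<dots> = (\<integral>\<^sup>+p. f (vec2 (fst p) (snd p)) * indicator cell (vec2 (fst p) (snd p)) \<partial>lborel)"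
    by (subst lborel_vec2, subst nn_integral_distr) auto
  also have "\<dots> = (\<integral>\<^sup>+p. f (vec2 (fst p) (snd p)) * indicator {0..<1} (fst p) * indicator {0..<1} (snd p) \<partial>(lborel \<Otimes>\<^sub>M lborel))"
    by (subst lborel_prod) (auto intro!: nn_integral_cong simp: indicator_def vec2_in_cell_iff)
  also have "\<dots> = (\<integral>\<^sup>+a. \<integral>\<^sup>+b. f (vec2 a b) * indicator {0..<1} a * indicator {0..<1} b \<partial>lborel \<partial>lborel)"
    by (subst lborel.nn_integral_fst[symmetric]) (auto intro!: borel_measurable_times_ennreal mf
        borel_measurable_indicator' simp: mult.assoc)
  also have "\<dots> = (\<integral>\<^sup>+a\<in>{0..<1}. (\<integral>\<^sup>+b\<in>{0..<1}. f (vec2 a b) \<partial>lborel) \<partial>lborel)"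
    by (intro nn_integral_cong) (auto simp: indicator_def)
  finally show ?thesis .
qed

section \<open>The cell as a space of measure one\<close>

lemma emeasure_torus: "emeasure torus cell = 1"
proof -
  have "emeasure torus cell = (\<integral>\<^sup>+x. 1 \<partial>torus)"
    by (simp add: emeasure_eq_0)
  also have "\<dots> = 1"
    by (subst nn_integral_torus) auto
  finally show ?thesis .
qed

lemma finite_measure_torus: "finite_measure torus"
  by (rule finite_measureI) (simp add: emeasure_torus)

interpretation torus: finite_measure torus
  by (rule finite_measure_torus)

lemma cell_subset_cbox: "cell \<subseteq> cbox 0 (\<chi> i. 1)"
  by (auto simp: cell_def mem_box_cart less_imp_le)

lemma continuous_bounded_cell:
  fixes f :: "real^2 \<Rightarrow> 'b::euclidean_space"
  assumes "continuous_on UNIV f"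
  obtains B where "B > 0" "\<And>x. x \<in> cell \<Longrightarrow> norm (f x) \<le> B"
proof -
  have "bounded (f ` cbox 0 (\<chi> i. 1))"
    by (intro compact_imp_bounded compact_continuous_image continuous_on_subset[OF assms]) auto
  then show ?thesis
    using that cell_subset_cbox unfolding bounded_pos by blast
qed

lemma borel_measurable_torus_continuous:
  fixes f :: "real^2 \<Rightarrow> 'b::euclidean_space"
  assumes "continuous_on UNIV f"
  shows "f \<in> borel_measurable torus"
  by (intro measurable_torus_borel borel_measurable_continuous_onI assms)

lemma integrable_torus_bounded:
  fixes f :: "real^2 \<Rightarrow> 'b::euclidean_space"
  assumes "f \<in> borel_measurable torus" "\<And>x. x \<in> cell \<Longrightarrow> norm (f x) \<le> B"
  shows "integrable torus f"
  by (rule torus.integrable_const_bound[of _ B]) (use assms in auto)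

lemma integrable_torus_continuous:
  fixes f :: "real^2 \<Rightarrow> 'b::euclidean_space"
  assumes "continuous_on UNIV f"
  shows "integrable torus f"
proof -
  obtain B where "\<And>x. x \<in> cell \<Longrightarrow> norm (f x) \<le> B"
    using continuous_bounded_cell[OF assms] by blast
  then show ?thesis
    by (rule integrable_torus_bounded[OF borel_measurable_torus_continuous[OF assms]])
qed

lemma integral_torus_continuous:
  fixes f :: "real^2 \<Rightarrow> 'b::euclidean_space"
  assumes cont: "continuous_on UNIV f"
  shows "(LINT x|torus. f x) =
    (LINT a|lborel. LINT b|lborel. (indicator {0..<1} a * indicator {0..<1} b) *\<^sub>R f (vec2 a b))"
proof -
  have [measurable]: "f \<in> borel_measurable borel"
    by (intro borel_measurable_continuous_onI assms)
  have eq: "indicator cell (vec2 a b) = (indicator {0..<1} a * indicator {0..<1} b :: real)" for a b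
    by (auto simp: indicator_def vec2_in_cell_iff)
  have "integrable lebesgue (\<lambda>x. indicator cell x *\<^sub>R f x)"
    using integrable_torus_continuous[OF cont] unfolding torus_eq
    by (subst (asm) integrable_restrict_space) (auto simp: cell_lebesgue)
  then have "integrable (lborel :: (real^2) measure) (\<lambda>x. indicator cell x *\<^sub>R f x)"
    by (subst (asm) integrable_completion) auto
  then have int: "integrable (lborel \<Otimes>\<^sub>M lborel) (\<lambda>p. (\<lambda>x. indicator cell x *\<^sub>R f x) (vec2 (fst p) (snd p)))"
    by (subst (asm) lborel_vec2, subst (asm) integrable_distr_eq) (auto simp: lborel_prod)
  have "(LINT x|torus. f x) = (LINT x|lebesgue. indicator cell x *\<^sub>R f x)"
    unfolding torus_eq by (subst integral_restrict_space) (auto simp: cell_lebesgue)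
  also have "\<dots> = (LINT x|lborel. indicator cell x *\<^sub>R f x)"
    by (subst integral_completion) auto
  also have "\<dots> = (LINT p|(lborel \<Otimes>\<^sub>M lborel). (\<lambda>x. indicator cell x *\<^sub>R f x) (vec2 (fst p) (snd p)))"
    by (subst lborel_vec2, subst integral_distr) (auto simp: lborel_prod)
  also have "\<dots> = (LINT a|lborel. LINT b|lborel. (\<lambda>x. indicator cell x *\<^sub>R f x) (vec2 a b))"
    using lborel_pair.integral_fst'[OF int] by simp
  finally show ?thesis
    by (simp add: eq)
qed

subsection \<open>Characters of the torus\<close>

lemma lattice_vec_nth [simp]: "lattice_vec \<alpha> $ i = of_int (\<alpha> $ i)"
  by (simp add: lattice_vec_def)

lemma lattice_vec_add: "lattice_vec (\<alpha> + \<beta>) = lattice_vec \<alpha> + lattice_vec \<beta>"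
  by (simp add: vec_eq_iff)

lemma lattice_vec_uminus: "lattice_vec (- \<alpha>) = - lattice_vec \<alpha>"
  by (simp add: vec_eq_iff)

lemma lattice_vec_0 [simp]: "lattice_vec 0 = 0"
  by (simp add: vec_eq_iff)

lemma inner_lattice_vec_Ints: "lattice_vec \<alpha> \<bullet> lattice_vec \<beta> \<in> \<int>"
  by (auto simp: inner_vec_def)

definition char :: "int^2 \<Rightarrow> real^2 \<Rightarrow> complex" where
  "char \<alpha> x = cis (2 * pi * (lattice_vec \<alpha> \<bullet> x))"

lemma char_add: "char (\<alpha> + \<beta>) x = char \<alpha> x * char \<beta> x"
  by (simp add: char_def lattice_vec_add inner_add_left cis_mult algebra_simps)

lemma char_uminus: "char (- \<alpha>) x = cnj (char \<alpha> x)"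
  by (simp add: char_def lattice_vec_uminus cis_cnj)

lemma char_0 [simp]: "char 0 x = 1"
  by (simp add: char_def)

lemma char_diff_arg: "char \<alpha> (x - y) = char \<alpha> x * cnj (char \<alpha> y)"
  by (simp add: char_def inner_diff_right cis_cnj cis_mult algebra_simps)

lemma norm_char [simp]: "norm (char \<alpha> x) = 1"
  by (simp add: char_def)

lemma continuous_char [continuous_intros]:
  "continuous_on S f \<Longrightarrow> continuous_on S (\<lambda>x. char \<alpha> (f x))"
  unfolding char_def by (intro continuous_intros)

lemma char_periodic: "char \<alpha> (x + lattice_vec k) = char \<alpha> x"
proof -
  obtain n where "lattice_vec \<alpha> \<bullet> lattice_vec k = of_int n"
    using inner_lattice_vec_Ints Ints_cases by metis
  then have "cis (2 * pi * (lattice_vec \<alpha> \<bullet> lattice_vec k)) = 1"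
    by (simp add: cis_multiple_2pi)
  then show ?thesis
    by (simp add: char_def inner_add_right distrib_left flip: cis_mult)
qed

lemma exp_eq_char: "exp (2 * of_real pi * \<i> * of_real (lattice_vec \<alpha> \<bullet> x)) = char \<alpha> x"
  by (simp add: char_def cis_conv_exp mult_ac)

lemma exp_eq_cnj_char: "exp (- 2 * of_real pi * \<i> * of_real (lattice_vec \<alpha> \<bullet> x)) = cnj (char \<alpha> x)"
  by (simp add: char_def cis_conv_exp mult_ac exp_cnj)

lemma fourier_coeff_eq: "fourier_coeff f \<alpha> = (LINT x|torus. cnj (char \<alpha> x) * f x)"
  unfolding fourier_coeff_def by (simp only: exp_eq_cnj_char)

lemma integral_cis:
  fixes n :: int
  shows "(LINT b|lborel. indicator {0..<1} b *\<^sub>R cis (2 * pi * of_int n * b)) = (if n = 0 then 1 else 0)"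
proof -
  \<comment> \<open>The fundamental theorem of calculus wants a closed interval, the cell a
    half-open one; they differ by the null point 1.\<close>
  have eq: "(LINT b|lborel. indicator {0..<1} b *\<^sub>R cis (2 * pi * of_int n * b)) =
    (LINT b|lborel. indicator {0..1} b *\<^sub>R cis (2 * pi * of_int n * b))"
  proof (rule integral_cong_AE)
    show "AE x in lborel. indicator {0..<1} x *\<^sub>R cis (2 * pi * of_int n * x) =
       indicator {0..1} x *\<^sub>R cis (2 * pi * of_int n * x)"
      using AE_lborel_singleton[of 1] by eventually_elim (auto simp: indicator_def)
  qed (intro borel_measurable_scaleR borel_measurable_indicator; auto intro!:
      borel_measurable_continuous_onI continuous_intros)+
  show ?thesis
  proof (cases "n = 0")
    case True
    then show ?thesis by simp
  next
    case False
    have "(LINT b|lborel. indicator {0..1} b *\<^sub>R cis (2 * pi * of_int n * b)) =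
      (cis (2 * pi * of_int n * 1) / (2 * pi * of_int n * \<i>)) - (cis (2 * pi * of_int n * 0) / (2 * pi * of_int n * \<i>))"
    proof (rule integral_FTC_atLeastAtMost)
      fix x :: real
      define k where "k = 2 * of_real pi * of_int n * \<i>"
      have "((\<lambda>z. exp (k * z) / k) has_field_derivative exp (k * of_real x)) (at (of_real x))"
        using False by (auto intro!: derivative_eq_intros simp: k_def)
      from has_vector_derivative_real_field[OF this]
      show "((\<lambda>x. cis (2 * pi * of_int n * x) / (2 * pi * of_int n * \<i>)) has_vector_derivative
         cis (2 * pi * of_int n * x)) (at x within {0..1})"
        by (simp add: cis_conv_exp k_def mult_ac)
    qed (auto intro!: continuous_intros)
    also have "cis (2 * pi * of_int n * 1) = 1"
      by (simp add: cis_multiple_2pi)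
    finally show ?thesis
      using False eq by simp
  qed
qed

lemma integral_char: "(LINT x|torus. char \<alpha> x) = (if \<alpha> = 0 then 1 else 0)"
proof -
  let ?c = "\<lambda>i b. indicator {0..<1} b *\<^sub>R cis (2 * pi * of_int (\<alpha> $ i) * b)"
  have "(LINT x|torus. char \<alpha> x) = (LINT a|lborel. LINT b|lborel. ?c 1 a * ?c 2 b)"
    by (subst integral_torus_continuous)
      (auto intro!: continuous_intros simp: char_def inner_vec_def sum_2 cis_mult algebra_simps)
  also have "\<dots> = (LINT a|lborel. ?c 1 a) * (LINT b|lborel. ?c 2 b)"
    by (simp only: integral_mult_right_zero integral_mult_left_zero)
  also have "\<dots> = (if \<alpha> = 0 then 1 else 0)"
    by (simp only: integral_cis) (auto simp: vec_eq_iff forall_2)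
  finally show ?thesis .
qed

lemma integral_char_cnj: "(LINT x|torus. char \<alpha> x * cnj (char \<beta> x)) = (if \<alpha> = \<beta> then 1 else 0)"
  using integral_char[of "\<alpha> + - \<beta>"] by (simp only: char_add char_uminus) (simp add: algebra_simps)

lemma fourier_coeff_trig:
  assumes "finite A"
  shows "fourier_coeff (\<lambda>x. \<Sum>\<alpha>\<in>A. c \<alpha> * char \<alpha> x) \<beta> = (if \<beta> \<in> A then c \<beta> else 0)"
proof -
  have "fourier_coeff (\<lambda>x. \<Sum>\<alpha>\<in>A. c \<alpha> * char \<alpha> x) \<beta> =
     (LINT x|torus. (\<Sum>\<alpha>\<in>A. c \<alpha> * (char \<alpha> x * cnj (char \<beta> x))))"
    by (simp add: fourier_coeff_eq sum_distrib_left mult_ac)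
  also have "\<dots> = (\<Sum>\<alpha>\<in>A. c \<alpha> * (LINT x|torus. char \<alpha> x * cnj (char \<beta> x)))"
    by (subst Bochner_Integration.integral_sum) (auto intro!: integrable_torus_continuous continuous_intros)
  also have "\<dots> = (if \<beta> \<in> A then c \<beta> else 0)"
    using assms by (simp add: integral_char_cnj if_distrib cong: if_cong)
  finally show ?thesis .
qed

text \<open>Expanding only the conjugate factor leaves the Fourier coefficients of the other one,
  which \<open>fourier_coeff_trig\<close> evaluates.\<close>

lemma parseval_trig:
  assumes "finite A"
  shows "(LINT x|torus. (norm (\<Sum>\<alpha>\<in>A. c \<alpha> * char \<alpha> x))\<^sup>2) = (\<Sum>\<alpha>\<in>A. (norm (c \<alpha>))\<^sup>2)"
proof -
  let ?f = "\<lambda>x. \<Sum>\<alpha>\<in>A. c \<alpha> * char \<alpha> x"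
  have "complex_of_real (LINT x|torus. (norm (?f x))\<^sup>2) = (LINT x|torus. ?f x * cnj (?f x))"
    by (subst integral_complex_of_real[symmetric]) (simp only: complex_norm_square)
  also have "\<dots> = (LINT x|torus. (\<Sum>\<beta>\<in>A. cnj (c \<beta>) * (cnj (char \<beta> x) * ?f x)))"
    by (simp add: sum_distrib_left sum_distrib_right mult_ac)
  also have "\<dots> = (\<Sum>\<beta>\<in>A. cnj (c \<beta>) * fourier_coeff ?f \<beta>)"
    unfolding fourier_coeff_eq
    by (subst Bochner_Integration.integral_sum) (auto intro!: integrable_torus_continuous continuous_intros)
  also have "\<dots> = (\<Sum>\<beta>\<in>A. cnj (c \<beta>) * c \<beta>)"
    using assms by (intro sum.cong) (auto simp: fourier_coeff_trig)
  also have "\<dots> = complex_of_real (\<Sum>\<beta>\<in>A. (norm (c \<beta>))\<^sup>2)"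
    by (simp only: of_real_sum complex_norm_square mult.commute)
  finally show ?thesis
    by (simp only: of_real_eq_iff)
qed

section \<open>Frequency boxes and shifts of coefficients\<close>

definition freq_box :: "nat \<Rightarrow> (int^2) set" where
  "freq_box N = {\<alpha>. \<forall>i. \<bar>\<alpha> $ i\<bar> \<le> int N}"

lemma freq_box: "finite (freq_box N)" "real (card (freq_box N)) \<le> (2 * real N + 1)\<^sup>2"
proof -
  let ?g = "\<lambda>p::int\<times>int. (\<chi> i. if i = 1 then fst p else snd p) :: int^2"
  have sub: "freq_box N \<subseteq> ?g ` ({- int N..int N} \<times> {- int N..int N})"
  proof
    fix \<alpha> assume "\<alpha> \<in> freq_box N"
    then have "\<bar>\<alpha> $ 1\<bar> \<le> int N" "\<bar>\<alpha> $ 2\<bar> \<le> int N"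
      by (auto simp: freq_box_def)
    then have "(\<alpha> $ 1, \<alpha> $ 2) \<in> {- int N..int N} \<times> {- int N..int N}"
      by auto
    moreover have "\<alpha> = ?g (\<alpha> $ 1, \<alpha> $ 2)"
      by (simp add: vec_eq_iff forall_2)
    ultimately show "\<alpha> \<in> ?g ` ({- int N..int N} \<times> {- int N..int N})"
      by blast
  qed
  show "finite (freq_box N)"
    by (rule finite_subset[OF sub]) auto
  have n: "nat (int N + 1 + int N) = 2 * N + 1"
    by simp
  have "card (freq_box N) \<le> card ({- int N..int N} \<times> {- int N..int N})"
    by (rule order.trans[OF card_mono[OF _ sub] card_image_le]) auto
  also have "\<dots> = (2 * N + 1)\<^sup>2"
    using n by (simp add: card_cartesian_product power2_eq_square algebra_simps)
  finally have "real (card (freq_box N)) \<le> real ((2 * N + 1)\<^sup>2)"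
    by (simp only: of_nat_le_iff)
  then show "real (card (freq_box N)) \<le> (2 * real N + 1)\<^sup>2"
    by (simp add: add.commute)
qed

lemma freq_box_mono: "N \<le> M \<Longrightarrow> freq_box N \<subseteq> freq_box M"
  unfolding freq_box_def by (auto intro: order_trans)

text \<open>Multiplication by a character translates coefficients. The sum runs over the box
  enlarged by one so that all unit shifts of \<open>c\<close> can be added over one index
  set.\<close>

lemma trig_shift:
  assumes supp: "{\<alpha>. c \<alpha> \<noteq> 0} \<subseteq> freq_box N" and e: "e \<in> freq_box 1"
  shows "(\<Sum>\<alpha>\<in>freq_box (N + 1). c (\<alpha> - e) * char \<alpha> z) = char e z * (\<Sum>\<alpha>\<in>freq_box N. c \<alpha> * char \<alpha> z)"
proof -
  have sub: "(\<lambda>\<alpha>. \<alpha> + e) ` freq_box N \<subseteq> freq_box (N + 1)"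
  proof
    fix \<beta> assume "\<beta> \<in> (\<lambda>\<alpha>. \<alpha> + e) ` freq_box N"
    then obtain \<alpha> where *: "\<beta> = \<alpha> + e" "\<alpha> \<in> freq_box N" by auto
    have "\<bar>\<beta> $ i\<bar> \<le> int (N + 1)" for i
    proof -
      have "\<bar>\<alpha> $ i\<bar> \<le> int N" "\<bar>e $ i\<bar> \<le> 1"
        using * e by (auto simp: freq_box_def)
      then show ?thesis using * by simp
    qed
    then show "\<beta> \<in> freq_box (N + 1)" by (simp add: freq_box_def)
  qed
  have "(\<Sum>\<alpha>\<in>freq_box (N + 1). c (\<alpha> - e) * char \<alpha> z) =
      (\<Sum>\<alpha>\<in>(\<lambda>\<alpha>. \<alpha> + e) ` freq_box N. c (\<alpha> - e) * char \<alpha> z)"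
  proof (rule sum.mono_neutral_right[OF freq_box(1) sub], rule ballI)
    fix i assume "i \<in> freq_box (N + 1) - (\<lambda>\<alpha>. \<alpha> + e) ` freq_box N"
    then have "i - e \<notin> freq_box N" by (metis DiffD2 diff_add_cancel imageI)
    then have "c (i - e) = 0" using supp by auto
    then show "c (i - e) * char i z = 0" by simp
  qed
  also have "\<dots> = (\<Sum>\<alpha>\<in>freq_box N. c \<alpha> * char (\<alpha> + e) z)"
    by (subst sum.reindex) (auto simp: inj_on_def)
  also have "\<dots> = char e z * (\<Sum>\<alpha>\<in>freq_box N. c \<alpha> * char \<alpha> z)"
    by (simp add: char_add sum_distrib_left mult_ac)
  finally show ?thesis .
qed

subsection \<open>Second differences of the cutoff\<close>

lemma partial_line_derivative:
  assumes "\<And>x. f differentiable (at x)"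
  shows "((\<lambda>t. f (x + t *\<^sub>R axis j 1)) has_real_derivative partial j f (x + s *\<^sub>R axis j 1)) (at s within S)"
proof -
  have d: "(f has_derivative frechet_derivative f (at (x + s *\<^sub>R axis j 1))) (at (x + s *\<^sub>R axis j 1))"
    using assms frechet_derivative_works by blast
  have l: "((\<lambda>t. x + t *\<^sub>R axis j 1) has_derivative (\<lambda>t. t *\<^sub>R axis j 1)) (at s within S)"
    by (auto intro!: derivative_eq_intros)
  have "((\<lambda>t. f (x + t *\<^sub>R axis j 1)) has_derivative
      (\<lambda>t. frechet_derivative f (at (x + s *\<^sub>R axis j 1)) (t *\<^sub>R axis j 1))) (at s within S)"
    by (rule has_derivative_compose[OF l d])
  then show ?thesis
    using has_derivative_bounded_linear[OF d]
    by (simp add: has_field_derivative_def partial_def linear_scale bounded_linear.linear mult_commute_abs)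
qed

lemma partial_eq_0:
  assumes "open U" "x \<in> U" "\<And>y. y \<in> U \<Longrightarrow> f y = 0"
  shows "partial j f x = 0"
proof -
  have "(f has_derivative (\<lambda>_. 0)) (at x)"
    by (rule has_derivative_transform_within_open[OF has_derivative_const[of 0] assms(1,2)])
      (use assms in auto)
  then have "frechet_derivative f (at x) = (\<lambda>_. 0)"
    using frechet_derivative_at by metis
  then show ?thesis
    by (simp add: partial_def)
qed

text \<open>The first-order terms cancel by symmetry: the mean value theorem is used for the even
  function \<open>g t + g (- t)\<close> and then for \<open>g'\<close> between \<open>- s\<close>
  and \<open>s\<close>. With \<open>h\<close> the inverse of \<open>freq q\<close>, this is the
  quadratic gain behind all kernel bounds.\<close>

lemma second_difference_bound:
  assumes C2: "C_k (Suc (Suc 0)) f" and supp: "closure {\<xi>. f \<xi> \<noteq> 0} \<subseteq> ball 0 1"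
  shows "\<exists>C\<ge>0. \<forall>x h j. \<bar>f (x + h *\<^sub>R axis j 1) + f (x - h *\<^sub>R axis j 1) - 2 * f x\<bar> \<le> C * h\<^sup>2"
proof -
  define U where "U = - closure {\<xi>. f \<xi> \<noteq> 0}"
  have U: "open U" "\<And>y. y \<in> U \<Longrightarrow> f y = 0"
    using closure_subset[of "{\<xi>. f \<xi> \<noteq> 0}"] by (auto simp: U_def)
  have diff: "\<And>x. f differentiable (at x)" "\<And>j x. partial j f differentiable (at x)"
    and cont: "\<And>j. continuous_on UNIV (partial j (partial j f))"
    using C2 by auto
  \<comment> \<open>Away from the support the second derivatives vanish, and on the closed unit ball
    they are bounded by continuity; together this gives a global bound.\<close>
  have zero: "partial j (partial j f) x = 0" if "x \<notin> cball 0 1" for j x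
  proof -
    have "x \<in> U" using that supp by (auto simp: U_def)
    moreover have "partial j f y = 0" if "y \<in> U" for y
      by (rule partial_eq_0[OF U(1) that U(2)])
    ultimately show ?thesis by (rule partial_eq_0[OF U(1)])
  qed
  have "\<exists>B\<ge>0. \<forall>x. \<bar>partial j (partial j f) x\<bar> \<le> B" for j
  proof -
    have "bounded (partial j (partial j f) ` cball 0 1)"
      by (intro compact_imp_bounded compact_continuous_image continuous_on_subset[OF cont]) auto
    then obtain B where B: "B > 0" "\<And>x. x \<in> cball 0 1 \<Longrightarrow> \<bar>partial j (partial j f) x\<bar> \<le> B"
      unfolding bounded_pos by auto
    then show ?thesis
      using zero by (intro exI[of _ B]) (metis abs_zero less_imp_le)
  qed
  then obtain B where B: "\<And>j. B j \<ge> 0" "\<And>j x. \<bar>partial j (partial j f) x\<bar> \<le> B j"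
    by metis
  \<comment> \<open>The factor 2 stems from the length \<open>2 * s\<close> of the interval in the
    second mean value step, with \<open>s < h\<close>; summing over \<open>j\<close> makes the
    constant independent of the direction.\<close>
  define C where "C = 2 * (\<Sum>j\<in>UNIV. B j)"
  have BC: "2 * B j \<le> C" for j
    unfolding C_def using B(1) by (intro mult_left_mono member_le_sum) auto
  have main: "\<bar>f (x + h *\<^sub>R axis j 1) + f (x - h *\<^sub>R axis j 1) - 2 * f x\<bar> \<le> C * h\<^sup>2" if h: "h > 0" for x h j
  proof -
    define g where "g = (\<lambda>t. f (x + t *\<^sub>R axis j 1))"
    define g' where "g' = (\<lambda>t. partial j f (x + t *\<^sub>R axis j 1))"
    define g'' where "g'' = (\<lambda>t. partial j (partial j f) (x + t *\<^sub>R axis j 1))"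
    have g: "(g has_real_derivative g' t) (at t)" for t
      unfolding g_def g'_def by (rule partial_line_derivative[OF diff(1)])
    have g': "(g' has_real_derivative g'' t) (at t)" for t
      unfolding g'_def g''_def by (rule partial_line_derivative[OF diff(2)])
    have "((\<lambda>t. g t + g (- t)) has_real_derivative g' t - g' (- t)) (at t)" for t
      using DERIV_mirror[of g "g' (- t)" t] g[of "-t"] g[of t]
      by (auto intro!: derivative_eq_intros)
    then obtain s where s: "0 < s" "s < h" "(g h + g (- h)) - (g 0 + g (- 0)) = (h - 0) * (g' s - g' (- s))"
      using MVT2[of 0 h "\<lambda>t. g t + g (- t)" "\<lambda>t. g' t - g' (- t)"] h by blast
    obtain r where r: "g' s - g' (- s) = (s - (- s)) * g'' r"
      using MVT2[of "-s" s g' g''] g' s by auto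
    have "\<bar>g h + g (- h) - 2 * g 0\<bar> = h * (2 * s * \<bar>g'' r\<bar>)"
      using s r h by (simp add: abs_mult)
    also have "\<dots> \<le> h * (2 * h * B j)"
      using s h B[of j] unfolding g''_def by (intro mult_left_mono mult_mono) auto
    also have "\<dots> \<le> C * h\<^sup>2"
      using mult_right_mono[OF BC[of j], of "h\<^sup>2"] by (simp add: power2_eq_square mult_ac)
    finally show ?thesis
      by (simp add: g_def)
  qed
  have all: "\<bar>f (x + h *\<^sub>R axis j 1) + f (x - h *\<^sub>R axis j 1) - 2 * f x\<bar> \<le> C * h\<^sup>2" for x h j
    using main[of h x j] main[of "-h" x j] by (cases h "0::real" rule: linorder_cases) (auto simp: add.commute)
  have "C \<ge> 0"
    using B(1) by (auto simp: C_def intro!: sum_nonneg)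
  then show ?thesis using all by blast
qed

subsection \<open>The periodic distance function\<close>

text \<open>\<open>pdist t\<close> is the squared modulus of \<open>1 - cis (2 * pi * t)\<close>. It is comparable to the squared
  distance from \<open>t\<close> to the integers, but unlike the latter it acts on Fourier coefficients simply, as
  a negative second difference.\<close>

definition pdist :: "real \<Rightarrow> real" where
  "pdist t = 2 - 2 * cos (2 * pi * t)"

lemma pdist_sin: "pdist t = 4 * (sin (pi * t))\<^sup>2"
  using cos_double_sin[of "pi * t"] by (simp add: pdist_def mult.assoc)

lemma pdist_nonneg: "0 \<le> pdist t"
  by (simp add: pdist_sin)

lemma pdist_minus: "pdist (- t) = pdist t"
  by (simp add: pdist_def)

lemma pdist_periodic: "pdist (t - 1) = pdist t" "pdist (t + 1) = pdist t"
  by (simp_all add: pdist_def right_diff_distrib distrib_left cos_diff cos_add)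

text \<open>With \<open>x = pi * t\<close>, the cubic Taylor bound gives
  \<open>sin x \<ge> x - x ^ 3 / 6\<close>, which is at least \<open>x / 2\<close>, and hence at
  least \<open>t\<close>, as long as \<open>x ^ 2 \<le> 3\<close>; the estimate
  \<open>pi / 2 \<le> 8 / 5\<close> ensures that.\<close>

lemma pdist_ge_half:
  assumes "0 \<le> t" "t \<le> 1 / 2"
  shows "t\<^sup>2 \<le> pdist t"
proof -
  define x where "x = pi * t"
  have "x \<le> pi * (1 / 2)"
    unfolding x_def using assms by (intro mult_left_mono) auto
  moreover have "pi \<le> 16 / 5"
    using pi_approx by simp
  moreover have "0 \<le> x"
    using assms by (simp add: x_def)
  ultimately have x: "0 \<le> x" "x \<le> 8 / 5"
    by linarith+
  have "\<bar>sin x - (\<Sum>m<3. sin_coeff m * x ^ m)\<bar> \<le> inverse (fact 3) * \<bar>x\<bar> ^ 3"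
    by (rule Maclaurin_sin_bound)
  moreover have "(\<Sum>m<3. sin_coeff m * x ^ m) = x"
    by (simp add: sin_coeff_def eval_nat_numeral)
  ultimately have "x - x ^ 3 / 6 \<le> sin x"
    using x(1) abs_ge_minus_self[of "sin x - x"] by (simp add: fact_numeral)
  moreover have "x ^ 3 / 6 \<le> x / 2"
  proof -
    have "x\<^sup>2 \<le> (8 / 5)\<^sup>2" using x by (intro power_mono) auto
    then have "x * x\<^sup>2 \<le> x * 3" using x by (intro mult_left_mono) (auto simp: power2_eq_square)
    then show ?thesis by (simp add: power2_eq_square power3_eq_cube)
  qed
  moreover have "t \<le> x / 2"
    using mult_right_mono[of 2 pi t] pi_gt3 assms by (simp add: x_def)
  ultimately have "t \<le> sin x"
    by linarith
  then have "t\<^sup>2 \<le> (sin x)\<^sup>2"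
    using assms by (intro power_mono) auto
  also have "\<dots> \<le> 4 * (sin x)\<^sup>2"
    by simp
  finally show ?thesis
    by (simp add: pdist_sin x_def)
qed

text \<open>Differences of two points of a period lie between -1 and 1, where the nearest integer is
  -1, 0 or 1.\<close>

lemma pdist_ge:
  assumes "\<bar>t\<bar> \<le> 1"
  shows "\<exists>k\<in>{-1, 0, 1}. (t - k)\<^sup>2 \<le> pdist t"
proof -
  have *: "\<exists>k\<in>{0, 1}. (t - k)\<^sup>2 \<le> pdist t" if "0 \<le> t" "t \<le> 1" for t
  proof (cases "t \<le> 1 / 2")
    case True
    then show ?thesis using pdist_ge_half[of t] that by auto
  next
    case False
    have "(1 - t)\<^sup>2 \<le> pdist (1 - t)"
      using that False by (intro pdist_ge_half) auto
    also have "pdist (1 - t) = pdist t"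
      using pdist_minus[of "t - 1"] pdist_periodic(1)[of t] by simp
    finally show ?thesis by (auto simp: power2_commute)
  qed
  show ?thesis
  proof (cases "t \<ge> 0")
    case True
    then show ?thesis using *[of t] assms by auto
  next
    case False
    then have "\<exists>k\<in>{0, 1}. (- t - k)\<^sup>2 \<le> pdist (- t)"
      using assms by (intro *) auto
    then obtain k where k: "k \<in> {0, 1}" "(- t - k)\<^sup>2 \<le> pdist t"
      unfolding pdist_minus by blast
    have "(- t - k)\<^sup>2 = (t - (- k))\<^sup>2"
      using power2_minus[of "t - (- k)"] by simp
    with k(2) have "(t - (- k))\<^sup>2 \<le> pdist t" by (simp only:)
    moreover have "- k \<in> {-1, 0, 1}" using k(1) by auto
    ultimately show ?thesis by blast
  qed
qed

text \<open>An antiderivative is \<open>arctan (l * (a - s)) / l\<close>, and the range of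
  \<open>arctan\<close> has length \<open>pi\<close>, whence a bound independent of the centre
  \<open>s\<close>.\<close>

lemma nn_integral_lorentz:
  assumes l: "l > 0"
  shows "(\<integral>\<^sup>+a\<in>{0..1}. ennreal (1 / (1 + l\<^sup>2 * (a - s)\<^sup>2)) \<partial>lborel) \<le> ennreal (pi / l)"
proof -
  have pos: "1 + l\<^sup>2 * (x - s)\<^sup>2 > 0" for x
    by (intro add_pos_nonneg) auto
  have "(\<integral>\<^sup>+a\<in>{0..1}. ennreal (1 / (1 + l\<^sup>2 * (a - s)\<^sup>2)) \<partial>lborel) =
      ennreal (arctan (l * (1 - s)) / l - arctan (l * (0 - s)) / l)"
  proof (rule nn_integral_FTC_Icc)
    show "(\<lambda>a. 1 / (1 + l\<^sup>2 * (a - s)\<^sup>2)) \<in> borel_measurable borel"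
      by measurable
    fix x :: real
    show "((\<lambda>a. arctan (l * (a - s)) / l) has_real_derivative 1 / (1 + l\<^sup>2 * (x - s)\<^sup>2)) (at x)"
      using l by (auto intro!: derivative_eq_intros simp: power_mult_distrib inverse_eq_divide)
    show "0 \<le> 1 / (1 + l\<^sup>2 * (x - s)\<^sup>2)" using pos[of x] by simp
  qed simp
  also have "\<dots> \<le> ennreal (pi / l)"
    using arctan_ubound[of "l * (1 - s)"] arctan_lbound[of "l * (0 - s)"] l
    by (intro ennreal_leI) (simp add: divide_right_mono flip: diff_divide_distrib)
  finally show ?thesis .
qed

text \<open>The weight is dominated by a Lorentz profile centred at \<open>y\<close> plus the
  integer nearest to \<open>a - y\<close>. As that integer depends on \<open>a\<close>, the sum of
  all three possible profiles is integrated, which gives the factor 3.\<close>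

lemma nn_integral_pdist:
  assumes l: "l > 0" and y: "y \<in> {0..<1}"
  shows "(\<integral>\<^sup>+a\<in>{0..<1}. ennreal (1 / (1 + l\<^sup>2 * pdist (a - y))) \<partial>lborel) \<le> ennreal (3 * pi / l)"
proof -
  let ?w = "\<lambda>k a. ennreal (1 / (1 + l\<^sup>2 * (a - (y + k))\<^sup>2)) * indicator {0..1::real} a"
  have pos: "1 + l\<^sup>2 * z\<^sup>2 > 0" for z
    by (intro add_pos_nonneg) auto
  have "(\<integral>\<^sup>+a\<in>{0..<1}. ennreal (1 / (1 + l\<^sup>2 * pdist (a - y))) \<partial>lborel) \<le>
     (\<integral>\<^sup>+a. ?w (-1) a + (?w 0 a + ?w 1 a) \<partial>lborel)"
  proof (rule nn_integral_mono)
    fix a :: real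
    show "ennreal (1 / (1 + l\<^sup>2 * pdist (a - y))) * indicator {0..<1} a \<le> ?w (-1) a + (?w 0 a + ?w 1 a)"
    proof (cases "a \<in> {0..<1}")
      case True
      then have "\<bar>a - y\<bar> \<le> 1" using y by auto
      then obtain k where k: "k \<in> {-1, 0, 1}" "(a - y - k)\<^sup>2 \<le> pdist (a - y)"
        using pdist_ge by blast
      have "l\<^sup>2 * (a - (y + k))\<^sup>2 \<le> l\<^sup>2 * pdist (a - y)"
        using k(2) by (intro mult_left_mono) (auto simp: algebra_simps)
      then have "1 / (1 + l\<^sup>2 * pdist (a - y)) \<le> 1 / (1 + l\<^sup>2 * (a - (y + k))\<^sup>2)"
        using pos by (intro divide_left_mono mult_pos_pos) (auto intro: add_pos_nonneg simp: pdist_nonneg)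
      then have "ennreal (1 / (1 + l\<^sup>2 * pdist (a - y))) \<le> ?w k a"
        using True by (auto intro: ennreal_leI)
      also have "\<dots> \<le> ?w (-1) a + (?w 0 a + ?w 1 a)"
      proof -
        consider "k = -1" | "k = 0" | "k = 1" using k(1) by blast
        then show ?thesis
          by cases (simp_all only: add_increasing2[OF zero_le order_refl] add_increasing[OF zero_le order_refl]
            add_increasing[OF zero_le add_increasing2[OF zero_le order_refl]]
            add_increasing[OF zero_le add_increasing[OF zero_le order_refl]])
      qed
      finally show ?thesis using True by simp
    qed auto
  qed
  also have "\<dots> = (\<integral>\<^sup>+a. ?w (-1) a \<partial>lborel) + ((\<integral>\<^sup>+a. ?w 0 a \<partial>lborel) + (\<integral>\<^sup>+a. ?w 1 a \<partial>lborel))"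
    by (subst nn_integral_add; simp)+
  also have "\<dots> \<le> ennreal (pi / l) + (ennreal (pi / l) + ennreal (pi / l))"
    by (intro add_mono nn_integral_lorentz l)
  also have "\<dots> = ennreal (3 * pi / l)"
    using l by (simp flip: ennreal_plus)
  finally show ?thesis .
qed

subsection \<open>Uniform kernel bounds\<close>

definition torus_dist :: "real^2 \<Rightarrow> real" where
  "torus_dist z = pdist (z $ 1) + pdist (z $ 2)"

lemma torus_dist_nonneg: "0 \<le> torus_dist z"
  by (simp add: torus_dist_def pdist_nonneg)

lemma continuous_pdist [continuous_intros]:
  fixes f :: "'a::t2_space \<Rightarrow> real"
  shows "continuous_on S f \<Longrightarrow> continuous_on S (\<lambda>x. pdist (f x))"
  unfolding pdist_def by (intro continuous_intros)

lemma continuous_torus_dist [continuous_intros]: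
  fixes f :: "'a::t2_space \<Rightarrow> real^2"
  shows "continuous_on S f \<Longrightarrow> continuous_on S (\<lambda>x. torus_dist (f x))"
  unfolding torus_dist_def by (intro continuous_intros)

text \<open>The square of 1 + l^2 (s + t) dominates (1 + l^2 s) (1 + l^2 t) for nonnegative s and t,
  so the integral separates into two one-dimensional ones, each at most
  \<open>3 * pi / l\<close>.\<close>

lemma integral_torus_weight:
  assumes l: "l > 0" and y: "y \<in> cell"
  shows "(LINT x|torus. 1 / (1 + l\<^sup>2 * torus_dist (x - y))\<^sup>2) \<le> 9 * pi\<^sup>2 / l\<^sup>2"
proof (rule integral_real_bounded)
  let ?w = "\<lambda>i a. 1 / (1 + l\<^sup>2 * pdist (a - y $ i))"
  have pos: "1 + l\<^sup>2 * pdist t > 0" for t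
    by (intro add_pos_nonneg) (auto simp: pdist_nonneg)
  have wpos: "0 \<le> ?w i a" for i a
    using pos[of "a - y $ i"] by simp
  have yi: "y $ i \<in> {0..<1}" for i
    using y by (auto simp: cell_def)
  have m: "pdist \<in> borel_measurable borel"
    by (intro borel_measurable_continuous_onI continuous_intros)
  have mw [measurable]: "(\<lambda>a. ennreal (?w i a)) \<in> borel_measurable borel" for i
    using m by measurable
  have mx [measurable]: "(\<lambda>x. x $ i) \<in> borel_measurable borel" for i :: 2
    by (intro borel_measurable_continuous_onI continuous_intros)
  have mw2: "(\<lambda>x. ennreal (?w i (x $ i))) \<in> borel_measurable borel" for i
    by (rule measurable_compose[OF mx mw])
  have "(\<integral>\<^sup>+x. ennreal (1 / (1 + l\<^sup>2 * torus_dist (x - y))\<^sup>2) \<partial>torus) \<le>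
      (\<integral>\<^sup>+x. ennreal (?w 1 (x $ 1)) * ennreal (?w 2 (x $ 2)) \<partial>torus)"
  proof (rule nn_integral_mono)
    fix x :: "real^2"
    let ?a = "pdist (x $ 1 - y $ 1)" and ?b = "pdist (x $ 2 - y $ 2)"
    have "(1 + l\<^sup>2 * ?a) * (1 + l\<^sup>2 * ?b) \<le> (1 + l\<^sup>2 * (?a + ?b)) * (1 + l\<^sup>2 * (?a + ?b))"
      by (intro mult_mono add_left_mono mult_left_mono add_nonneg_nonneg mult_nonneg_nonneg)
        (auto simp: pdist_nonneg)
    then have "1 / (1 + l\<^sup>2 * torus_dist (x - y))\<^sup>2 \<le> 1 / ((1 + l\<^sup>2 * ?a) * (1 + l\<^sup>2 * ?b))"
      using pos less_imp_le[OF l] by (intro divide_left_mono)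
        (auto simp: torus_dist_def power2_eq_square intro!: mult_pos_pos add_pos_nonneg pdist_nonneg add_nonneg_nonneg mult_nonneg_nonneg)
    also have "\<dots> = ?w 1 (x $ 1) * ?w 2 (x $ 2)"
      by simp
    finally show "ennreal (1 / (1 + l\<^sup>2 * torus_dist (x - y))\<^sup>2) \<le> ennreal (?w 1 (x $ 1)) * ennreal (?w 2 (x $ 2))"
      using wpos by (subst ennreal_mult[symmetric]) (auto intro!: ennreal_leI)
  qed
  also have "\<dots> = (\<integral>\<^sup>+a\<in>{0..<1}. (\<integral>\<^sup>+b\<in>{0..<1}. ennreal (?w 1 a) * ennreal (?w 2 b) \<partial>lborel) \<partial>lborel)"
    using mw2 by (subst nn_integral_torus) (auto intro!: borel_measurable_times_ennreal)
  also have "\<dots> = (\<integral>\<^sup>+a\<in>{0..<1}. ennreal (?w 1 a) \<partial>lborel) * (\<integral>\<^sup>+b\<in>{0..<1}. ennreal (?w 2 b) \<partial>lborel)"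
    by (simp add: nn_integral_cmult nn_integral_multc mult.assoc mw mult.commute[of "_ * _" "indicator _ _"])
       (simp add: nn_integral_cmult nn_integral_multc mult_ac mw flip: mult.assoc)
  also have "\<dots> \<le> ennreal (3 * pi / l) * ennreal (3 * pi / l)"
    using nn_integral_pdist[OF l yi] by (intro mult_mono) auto
  also have "\<dots> = ennreal (9 * pi\<^sup>2 / l\<^sup>2)"
    using l by (simp add: power2_eq_square flip: ennreal_mult)
  finally show "(\<integral>\<^sup>+x. ennreal (1 / (1 + l\<^sup>2 * torus_dist (x - y))\<^sup>2) \<partial>torus) \<le> ennreal (9 * pi\<^sup>2 / l\<^sup>2)" .
qed simp

section \<open>Multiplier kernels and their weighted integrals\<close>

definition mult_kernel :: "(int^2 \<Rightarrow> real) \<Rightarrow> nat \<Rightarrow> real^2 \<Rightarrow> complex" where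
  "mult_kernel c N z = (\<Sum>\<alpha>\<in>freq_box N. of_real (c \<alpha>) * char \<alpha> z)"

lemma continuous_mult_kernel [continuous_intros]:
  "continuous_on S f \<Longrightarrow> continuous_on S (\<lambda>x. mult_kernel c N (f x))"
  unfolding mult_kernel_def by (intro continuous_intros)

lemma mult_kernel_minus:
  assumes "\<And>\<alpha>. c (- \<alpha>) = c \<alpha>"
  shows "mult_kernel c N (- z) = mult_kernel c N z"
proof -
  have "mult_kernel c N z = (\<Sum>\<alpha>\<in>uminus ` freq_box N. of_real (c \<alpha>) * char \<alpha> z)"
  proof -
    have "uminus ` freq_box N = freq_box N"
      by (auto simp: freq_box_def image_iff) (metis abs_minus_cancel minus_minus vector_uminus_component)
    then show ?thesis by (simp add: mult_kernel_def)
  qed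
  also have "\<dots> = mult_kernel c N (- z)"
    unfolding mult_kernel_def
    by (subst sum.reindex) (auto simp: assms char_def lattice_vec_uminus)
  finally show ?thesis by simp
qed

text \<open>The negative discrete Laplacian on the frequency lattice.\<close>

definition laplace_coeff :: "(int^2 \<Rightarrow> real) \<Rightarrow> int^2 \<Rightarrow> real" where
  "laplace_coeff c \<alpha> = - (\<Sum>j\<in>UNIV. c (\<alpha> + axis j 1) + c (\<alpha> - axis j 1) - 2 * c \<alpha>)"

lemma torus_dist_char:
  "complex_of_real (torus_dist z) = (\<Sum>j\<in>UNIV. 2 - char (axis j 1) z - char (- axis j 1) z)"
proof -
  have lat: "lattice_vec (axis j 1) \<bullet> z = z $ j" for j
    by (simp add: inner_vec_def axis_def if_distrib[of "\<lambda>x. x * _"] if_distrib[of of_int] cong: if_cong)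
  have "2 - char (axis j 1) z - char (- axis j 1) z = complex_of_real (pdist (z $ j))" for j
    unfolding char_uminus by (simp add: char_def lat pdist_def complex_eq_iff)
  then show ?thesis
    by (simp add: torus_dist_def sum_2)
qed

text \<open>\<open>torus_dist\<close> is itself a trigonometric polynomial, with frequencies 0 and
  plus or minus the unit vectors, so multiplying by it shifts coefficients. Spatial decay of the
  kernel is thereby traded for regularity of its symbol.\<close>

lemma torus_dist_mult_kernel:
  assumes supp: "{\<alpha>. c \<alpha> \<noteq> 0} \<subseteq> freq_box N"
  shows "of_real (torus_dist z) * mult_kernel c N z = mult_kernel (laplace_coeff c) (N + 1) z"
proof -
  have e: "axis j 1 \<in> freq_box 1" "- axis j 1 \<in> freq_box 1" "0 \<in> freq_box 1" for j
    by (auto simp: freq_box_def axis_def)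
  have supp': "{\<alpha>. complex_of_real (c \<alpha>) \<noteq> 0} \<subseteq> freq_box N"
    using supp by simp
  have sh: "(\<Sum>\<alpha>\<in>freq_box (N + 1). complex_of_real (c (\<alpha> - e)) * char \<alpha> z) = char e z * mult_kernel c N z"
    if "e \<in> freq_box 1" for e
    unfolding mult_kernel_def by (rule trig_shift[OF supp' that])
  have "mult_kernel (laplace_coeff c) (N + 1) z =
     (\<Sum>\<alpha>\<in>freq_box (N + 1). \<Sum>j\<in>UNIV. 2 * (complex_of_real (c (\<alpha> - 0)) * char \<alpha> z)
        - complex_of_real (c (\<alpha> - axis j 1)) * char \<alpha> z - complex_of_real (c (\<alpha> - (- axis j 1))) * char \<alpha> z)"
    unfolding mult_kernel_def laplace_coeff_def
    by (simp add: sum_2 algebra_simps)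
  also have "\<dots> = (\<Sum>j\<in>UNIV. 2 * (char 0 z * mult_kernel c N z) - char (axis j 1) z * mult_kernel c N z
      - char (- axis j 1) z * mult_kernel c N z)"
    unfolding sum_2 by (simp only: sum.distrib sum_subtractf sum_distrib_left[symmetric] sh[OF e(1)] sh[OF e(2)] sh[OF e(3)])
  also have "\<dots> = of_real (torus_dist z) * mult_kernel c N z"
    by (simp add: torus_dist_char sum_2 algebra_simps)
  finally show ?thesis by simp
qed

lemma parseval_mult_kernel:
  "(LINT x|torus. (norm (mult_kernel c N (x - y)))\<^sup>2) = (\<Sum>\<alpha>\<in>freq_box N. (c \<alpha>)\<^sup>2)"
proof -
  have "mult_kernel c N (x - y) = (\<Sum>\<alpha>\<in>freq_box N. (of_real (c \<alpha>) * cnj (char \<alpha> y)) * char \<alpha> x)" for x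
    by (simp add: mult_kernel_def char_diff_arg mult_ac)
  then show ?thesis
    by (simp add: parseval_trig freq_box(1) norm_mult)
qed

lemma sum_square_freq_box:
  assumes "\<And>\<alpha>. \<bar>c \<alpha>\<bar> \<le> B"
  shows "(\<Sum>\<alpha>\<in>freq_box N. (c \<alpha>)\<^sup>2) \<le> (2 * real N + 1)\<^sup>2 * B\<^sup>2"
proof -
  have "(c \<alpha>)\<^sup>2 \<le> B\<^sup>2" for \<alpha>
    using power_mono[OF assms[of \<alpha>], of 2] by simp
  then have "(\<Sum>\<alpha>\<in>freq_box N. (c \<alpha>)\<^sup>2) \<le> real (card (freq_box N)) * B\<^sup>2"
    using sum_bounded_above[of "freq_box N" "\<lambda>\<alpha>. (c \<alpha>)\<^sup>2" "B\<^sup>2"] by simp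
  also have "\<dots> \<le> (2 * real N + 1)\<^sup>2 * B\<^sup>2"
    by (intro mult_right_mono freq_box) auto
  finally show ?thesis .
qed

text \<open>Let D be the modulus of the kernel, s the value of \<open>torus_dist\<close> and n =
  \<open>N\<close>. The integrals of D^2, s^2 D^2 and (1 + n^2 s)^(-2) are at most of order n^2,
  n^(-2) and n^(-2). Writing D as (1 + n^2 s) D times (1 + n^2 s)^(-1) makes all powers of n cancel.
  \<open>M\<close> is half of the resulting constant 18 C0^2 + 200 C2^2 + 9 pi^2, increased by 1 for
  the sake of the second bound.\<close>

lemma mult_kernel_bounds:
  assumes supp: "{\<alpha>. c \<alpha> \<noteq> 0} \<subseteq> freq_box N" and N: "N \<ge> 1"
    and C0: "\<And>\<alpha>. \<bar>c \<alpha>\<bar> \<le> C0"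
    and C2: "\<And>\<alpha> j. \<bar>c (\<alpha> + axis j 1) + c (\<alpha> - axis j 1) - 2 * c \<alpha>\<bar> \<le> C2 / (real N)\<^sup>2"
    and y: "y \<in> cell"
    and M: "M = 9 * C0\<^sup>2 + 100 * C2\<^sup>2 + 9 * pi\<^sup>2 / 2 + 1"
  shows "(LINT x|torus. norm (mult_kernel c N (x - y))) \<le> M"
    and "(LINT x|torus. norm (mult_kernel c N (x - y)) * torus_dist (x - y)) \<le> M / N"
proof -
  let ?D = "\<lambda>x. norm (mult_kernel c N (x - y))"
  let ?s = "\<lambda>x. torus_dist (x - y)"
  define n where "n = real N"
  have n: "n \<ge> 1" using N by (simp add: n_def)
  note intg = integrable_torus_continuous
  have pos: "1 + n\<^sup>2 * ?s x > 0" for x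
    by (intro add_pos_nonneg) (auto simp: torus_dist_nonneg)
  have L: "\<bar>laplace_coeff c \<alpha>\<bar> \<le> 2 * (C2 / n\<^sup>2)" for \<alpha>
    using C2[of \<alpha> 1] C2[of \<alpha> 2] by (simp add: laplace_coeff_def sum_2 n_def abs_le_iff)
  have I1: "(LINT x|torus. (?D x)\<^sup>2) \<le> 9 * n\<^sup>2 * C0\<^sup>2"
  proof -
    have "(LINT x|torus. (?D x)\<^sup>2) \<le> (2 * n + 1)\<^sup>2 * C0\<^sup>2"
      unfolding parseval_mult_kernel n_def by (rule sum_square_freq_box[OF C0])
    also have "\<dots> \<le> (3 * n)\<^sup>2 * C0\<^sup>2"
      using n by (intro mult_right_mono power_mono) auto
    finally show ?thesis by (simp add: power_mult_distrib)
  qed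
  \<comment> \<open>The enlarged box has at most (5 n)^2 points since \<open>N \<ge> 1\<close>, and
    each coefficient of \<open>laplace_coeff c\<close> is at most 2 C2 / n^2, one half of it for
    each direction.\<close>
  have I2: "(LINT x|torus. (?s x)\<^sup>2 * (?D x)\<^sup>2) \<le> 100 * C2\<^sup>2 / n\<^sup>2"
  proof -
    have "(?s x)\<^sup>2 * (?D x)\<^sup>2 = (norm (mult_kernel (laplace_coeff c) (N + 1) (x - y)))\<^sup>2" for x
      by (simp add: torus_dist_mult_kernel[OF supp, symmetric] norm_mult power_mult_distrib del: One_nat_def)
    then have "(LINT x|torus. (?s x)\<^sup>2 * (?D x)\<^sup>2) \<le> (2 * real (N + 1) + 1)\<^sup>2 * (2 * (C2 / n\<^sup>2))\<^sup>2"
      by (simp only: parseval_mult_kernel) (rule sum_square_freq_box[OF L])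
    also have "\<dots> \<le> (5 * n)\<^sup>2 * (2 * (C2 / n\<^sup>2))\<^sup>2"
      using n by (intro mult_right_mono power_mono) (auto simp: n_def)
    also have "\<dots> = 100 * C2\<^sup>2 / n\<^sup>2"
      using n by (simp add: field_simps power2_eq_square)
    finally show ?thesis .
  qed
  have w: "(LINT x|torus. 1 / (1 + n\<^sup>2 * ?s x)\<^sup>2) \<le> 9 * pi\<^sup>2 / n\<^sup>2"
    using n y by (intro integral_torus_weight) auto
  \<comment> \<open>Cauchy-Schwarz in a pointwise form with a free parameter:
    \<open>t = 1 / n^2\<close> balances the first bound, \<open>t = n\<close> the second.\<close>
  have am: "2 * \<bar>a * b\<bar> \<le> t * a\<^sup>2 + b\<^sup>2 / t" if "t > 0" for a b t :: real
  proof -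
    have "0 \<le> (t * \<bar>a\<bar> - \<bar>b\<bar>)\<^sup>2 / t" using that by simp
    also have "(t * \<bar>a\<bar> - \<bar>b\<bar>)\<^sup>2 / t = t * a\<^sup>2 + b\<^sup>2 / t - 2 * \<bar>a * b\<bar>"
      using that by (simp add: power2_diff abs_mult power_mult_distrib) (simp add: field_simps power2_eq_square)
    finally show ?thesis by simp
  qed
  have c1: "continuous_on UNIV (\<lambda>x. 1 / (1 + n\<^sup>2 * ?s x)\<^sup>2)"
    using pos by (intro continuous_intros) (auto simp: less_imp_neq[OF pos, symmetric])
  have "2 * (LINT x|torus. ?D x) = (LINT x|torus. 2 * ?D x)"
    by simp
  also have "\<dots> \<le> (LINT x|torus. (1 / n\<^sup>2) * (2 * (?D x)\<^sup>2 + 2 * n^4 * ((?s x)\<^sup>2 * (?D x)\<^sup>2)) + n\<^sup>2 * (1 / (1 + n\<^sup>2 * ?s x)\<^sup>2))"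
  proof (rule integral_mono)
    show "integrable torus (\<lambda>x. (1 / n\<^sup>2) * (2 * (?D x)\<^sup>2 + 2 * n^4 * ((?s x)\<^sup>2 * (?D x)\<^sup>2)) + n\<^sup>2 * (1 / (1 + n\<^sup>2 * ?s x)\<^sup>2))"
      by (intro intg continuous_intros c1)
    fix x
    have "2 * ?D x = 2 * \<bar>((1 + n\<^sup>2 * ?s x) * ?D x) * (1 / (1 + n\<^sup>2 * ?s x))\<bar>"
      using pos[of x] by simp
    also have "\<dots> \<le> (1 / n\<^sup>2) * ((1 + n\<^sup>2 * ?s x) * ?D x)\<^sup>2 + (1 / (1 + n\<^sup>2 * ?s x))\<^sup>2 / (1 / n\<^sup>2)"
      using n by (intro am) auto
    also have "((1 + n\<^sup>2 * ?s x) * ?D x)\<^sup>2 \<le> 2 * (?D x)\<^sup>2 + 2 * n^4 * ((?s x)\<^sup>2 * (?D x)\<^sup>2)"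
    proof -
      have "(1 + n\<^sup>2 * ?s x)\<^sup>2 \<le> 2 + 2 * (n\<^sup>2 * ?s x)\<^sup>2"
        using zero_le_power2[of "1 - n\<^sup>2 * ?s x"] by (simp add: power2_sum power2_diff)
      then have "(1 + n\<^sup>2 * ?s x)\<^sup>2 * (?D x)\<^sup>2 \<le> (2 + 2 * (n\<^sup>2 * ?s x)\<^sup>2) * (?D x)\<^sup>2"
        by (rule mult_right_mono) simp
      also have "\<dots> = 2 * (?D x)\<^sup>2 + 2 * n^4 * ((?s x)\<^sup>2 * (?D x)\<^sup>2)"
        by (simp add: power_mult_distrib algebra_simps)
      finally show ?thesis by (simp only: power_mult_distrib)
    qed
    finally show "2 * ?D x \<le> (1 / n\<^sup>2) * (2 * (?D x)\<^sup>2 + 2 * n^4 * ((?s x)\<^sup>2 * (?D x)\<^sup>2)) + n\<^sup>2 * (1 / (1 + n\<^sup>2 * ?s x)\<^sup>2)"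
      by (simp add: power_divide mult_left_mono divide_right_mono)
  qed (intro intg continuous_intros)
  also have "\<dots> = (1 / n\<^sup>2) * (2 * (LINT x|torus. (?D x)\<^sup>2) + 2 * n^4 * (LINT x|torus. (?s x)\<^sup>2 * (?D x)\<^sup>2))
      + n\<^sup>2 * (LINT x|torus. 1 / (1 + n\<^sup>2 * ?s x)\<^sup>2)"
    by (subst Bochner_Integration.integral_add integral_mult_right_zero; (intro intg continuous_intros c1)?)+ simp
  also have "\<dots> \<le> (1 / n\<^sup>2) * (2 * (9 * n\<^sup>2 * C0\<^sup>2) + 2 * n^4 * (100 * C2\<^sup>2 / n\<^sup>2)) + n\<^sup>2 * (9 * pi\<^sup>2 / n\<^sup>2)"
    using n by (intro add_mono mult_left_mono I1 I2 w) auto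
  also have "\<dots> = 18 * C0\<^sup>2 + 200 * C2\<^sup>2 + 9 * pi\<^sup>2"
    using n by (simp add: field_simps power2_eq_square eval_nat_numeral)
  finally show "(LINT x|torus. ?D x) \<le> M"
    unfolding M by simp
  have "2 * (LINT x|torus. ?D x * ?s x) = (LINT x|torus. 2 * (?D x * ?s x))"
    by simp
  also have "\<dots> \<le> (LINT x|torus. n * ((?s x)\<^sup>2 * (?D x)\<^sup>2) + 1 / n)"
  proof (rule integral_mono)
    show "integrable torus (\<lambda>x. n * ((?s x)\<^sup>2 * (?D x)\<^sup>2) + 1 / n)"
      by (intro intg continuous_intros) (use n in auto)
    fix x
    show "2 * (?D x * ?s x) \<le> n * ((?s x)\<^sup>2 * (?D x)\<^sup>2) + 1 / n"
      using am[of n "?D x * ?s x" 1] n torus_dist_nonneg[of "x - y"] by (simp add: power_mult_distrib mult_ac)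
  qed (intro intg continuous_intros)
  also have "\<dots> = n * (LINT x|torus. (?s x)\<^sup>2 * (?D x)\<^sup>2) + 1 / n"
    by (subst Bochner_Integration.integral_add integral_mult_right_zero; (intro intg continuous_intros c1)?)+
      (simp add: measure_def emeasure_torus)
  also have "\<dots> \<le> n * (100 * C2\<^sup>2 / n\<^sup>2) + 1 / n"
    using n by (intro add_mono mult_left_mono I2) auto
  also have "\<dots> = (100 * C2\<^sup>2 + 1) / n"
    using n by (simp add: field_simps power2_eq_square)
  also have "\<dots> \<le> 2 * (M / n)"
    using n unfolding M by (simp add: field_simps)
  finally show "(LINT x|torus. ?D x * ?s x) \<le> M / N"
    by (simp add: n_def)
qed

section \<open>From the cutoff function to its kernels\<close>

lemma LP_cutoffD:
  assumes "LP_cutoff \<psi>"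
  shows "smooth \<psi>" "closure {\<xi>. \<psi> \<xi> \<noteq> 0} \<subseteq> ball 0 1" "norm \<xi> = norm \<eta> \<Longrightarrow> \<psi> \<xi> = \<psi> \<eta>"
    "norm \<xi> \<le> 1/2 \<Longrightarrow> \<psi> \<xi> = 1"
proof -
  note a = assms[unfolded LP_cutoff_def]
  show "smooth \<psi>" "closure {\<xi>. \<psi> \<xi> \<noteq> 0} \<subseteq> ball 0 1"
    by (rule a[THEN conjunct1], rule a[THEN conjunct2, THEN conjunct2, THEN conjunct2, THEN conjunct1])
  show "norm \<xi> = norm \<eta> \<Longrightarrow> \<psi> \<xi> = \<psi> \<eta>"
    by (rule a[THEN conjunct2, THEN conjunct2, THEN conjunct1, rule_format])
  show "norm \<xi> \<le> 1/2 \<Longrightarrow> \<psi> \<xi> = 1"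
    by (rule a[THEN conjunct2, THEN conjunct2, THEN conjunct2, THEN conjunct2, rule_format])
qed

lemma cutoff_support:
  assumes "LP_cutoff \<psi>"
  shows "{\<alpha>. \<psi> (inverse (freq q) *\<^sub>R lattice_vec \<alpha>) \<noteq> 0} \<subseteq> freq_box (2 ^ q)"
proof
  have supp: "closure {\<xi>. \<psi> \<xi> \<noteq> 0} \<subseteq> ball 0 1"
    by (rule LP_cutoffD[OF assms])
  fix \<alpha> :: "int^2" assume "\<alpha> \<in> {\<alpha>. \<psi> (inverse (freq q) *\<^sub>R lattice_vec \<alpha>) \<noteq> 0}"
  then have "inverse (freq q) *\<^sub>R lattice_vec \<alpha> \<in> ball 0 1"
    using closure_subset[of "{\<xi>. \<psi> \<xi> \<noteq> 0}"] supp by auto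
  then have "norm (lattice_vec \<alpha>) < 2 ^ q"
    by (simp add: freq_def field_simps)
  then have "\<bar>real_of_int (\<alpha> $ i)\<bar> \<le> 2 ^ q" for i
    using component_le_norm_cart[of "lattice_vec \<alpha>" i] by simp
  then have "\<bar>\<alpha> $ i\<bar> \<le> 2 ^ q" for i
    by (metis of_int_abs of_int_le_numeral_power_cancel_iff)
  then show "\<alpha> \<in> freq_box (2 ^ q)"
    by (simp add: freq_box_def)
qed

lemma cutoff_bounded:
  assumes "LP_cutoff \<psi>"
  shows "\<exists>C. \<forall>\<xi>. \<bar>\<psi> \<xi>\<bar> \<le> C"
proof -
  have supp: "closure {\<xi>. \<psi> \<xi> \<noteq> 0} \<subseteq> ball 0 1" and smooth: "smooth \<psi>"
    by (rule LP_cutoffD[OF assms])+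
  have cont: "continuous_on UNIV \<psi>"
    using smooth unfolding smooth_def by (metis C_k.simps(1))
  have "bounded (\<psi> ` cball 0 1)"
    by (intro compact_imp_bounded compact_continuous_image continuous_on_subset[OF cont]) auto
  then obtain B where B: "B > 0" "\<And>x. x \<in> cball 0 1 \<Longrightarrow> \<bar>\<psi> x\<bar> \<le> B"
    unfolding bounded_pos by auto
  moreover have "\<psi> x = 0" if "x \<notin> cball 0 1" for x
    using that supp closure_subset[of "{\<xi>. \<psi> \<xi> \<noteq> 0}"] by auto
  ultimately show ?thesis
    by (metis abs_zero less_imp_le)
qed

abbreviation LP_kernel :: "(real^2 \<Rightarrow> real) \<Rightarrow> nat \<Rightarrow> real^2 \<Rightarrow> complex" where
  "LP_kernel \<psi> q \<equiv> mult_kernel (\<lambda>\<alpha>. \<psi> (inverse (freq q) *\<^sub>R lattice_vec \<alpha>)) (2 ^ q)"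

text \<open>Sampling \<open>\<psi>\<close> at spacing \<open>h = inverse (freq q)\<close> turns the
  second-difference bound \<open>C2 * h^2\<close> into \<open>C2 / N^2\<close> with
  \<open>N = 2 ^ q\<close>, so one \<open>M\<close> serves all \<open>q\<close>.\<close>

lemma LP_kernel_bounds:
  assumes \<psi>: "LP_cutoff \<psi>"
  obtains M where "M > 0"
    "\<And>q y. y \<in> cell \<Longrightarrow> (LINT x|torus. norm (LP_kernel \<psi> q (x - y))) \<le> M"
    "\<And>q y. y \<in> cell \<Longrightarrow> (LINT x|torus. norm (LP_kernel \<psi> q (x - y)) * torus_dist (x - y)) \<le> M / 2 ^ q"
proof -
  obtain C0 where C0: "\<And>\<xi>. \<bar>\<psi> \<xi>\<bar> \<le> C0"
    using cutoff_bounded[OF \<psi>] by blast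
  obtain C2 where C2: "\<And>x h j. \<bar>\<psi> (x + h *\<^sub>R axis j 1) + \<psi> (x - h *\<^sub>R axis j 1) - 2 * \<psi> x\<bar> \<le> C2 * h\<^sup>2"
    using second_difference_bound[OF _ LP_cutoffD(2)[OF \<psi>]] LP_cutoffD(1)[OF \<psi>] unfolding smooth_def by metis
  have lat: "lattice_vec (axis j 1) = axis j 1" for j
    by (simp add: vec_eq_iff axis_def)
  have sd: "\<bar>\<psi> (inverse (freq q) *\<^sub>R lattice_vec (\<alpha> + axis j 1)) + \<psi> (inverse (freq q) *\<^sub>R lattice_vec (\<alpha> - axis j 1))
      - 2 * \<psi> (inverse (freq q) *\<^sub>R lattice_vec \<alpha>)\<bar> \<le> C2 / (real (2 ^ q))\<^sup>2" for \<alpha> q j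
    using C2[of "inverse (freq q) *\<^sub>R lattice_vec \<alpha>" "inverse (freq q)" j] lattice_vec_add[of \<alpha> "- axis j 1"]
    by (simp add: lattice_vec_add lattice_vec_uminus lat scaleR_right_distrib scaleR_right_diff_distrib freq_def power_inverse
      divide_inverse)
  define M where "M = 9 * C0\<^sup>2 + 100 * C2\<^sup>2 + 9 * pi\<^sup>2 / 2 + 1"
  have "M > 0"
    unfolding M_def by (intro add_nonneg_pos add_nonneg_nonneg) auto
  then show ?thesis
    using that[of M] mult_kernel_bounds[OF cutoff_support[OF \<psi>] _ C0 sd _ M_def] by simp
qed

subsection \<open>Powers\<close>

lemma powr_add_le:
  fixes a b p :: real
  assumes "a \<ge> 0" "b \<ge> 0" "p \<ge> 0"
  shows "(a + b) powr p \<le> 2 powr p * (a powr p + b powr p)"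
proof -
  have "(a + b) powr p \<le> (2 * max a b) powr p"
    using assms by (intro powr_mono2) auto
  also have "\<dots> = 2 powr p * max a b powr p"
    using assms by (simp add: powr_mult)
  also have "max a b powr p \<le> a powr p + b powr p"
    by (simp add: max_def)
  finally show ?thesis by simp
qed

lemma norm_diff_powr_le:
  fixes a b :: "'a::real_normed_vector"
  assumes "p \<ge> 0"
  shows "norm (a - b) powr p \<le> 2 powr p * (norm a powr p + norm b powr p)"
  by (rule order_trans[OF powr_mono2 powr_add_le]) (use assms norm_triangle_ineq4[of a b] in auto)

text \<open>Convexity of the \<open>p\<close>-th power in the form used for Jensen's inequality. It
  is Young's inequality for \<open>t\<close> and \<open>s powr (p - 1)\<close> with the exponent
  conjugate to \<open>p\<close>; the degenerate cases \<open>s = 0\<close> and \<open>p = 1\<close>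
  are treated separately.\<close>

lemma powr_tangent_line:
  fixes s t p :: real
  assumes "p \<ge> 1" "s \<ge> 0" "t \<ge> 0"
  shows "s powr p + p * s powr (p - 1) * (t - s) \<le> t powr p"
proof (cases "s = 0 \<or> p = 1")
  case True
  then show ?thesis
    using assms by (cases "s = 0") auto
next
  case False
  then have p: "p > 1" and s: "s > 0" using assms by auto
  define q where "q = p / (p - 1)"
  have q: "q > 1" "1 / p + 1 / q = 1"
    using p by (auto simp: q_def field_simps)
  have "t * s powr (p - 1) \<le> t powr p / p + (s powr (p - 1)) powr q / q"
    using p q assms by (intro Youngs_inequality) auto
  also have "(s powr (p - 1)) powr q = s powr p"
    using p by (simp add: powr_powr q_def)
  finally have "p * (t * s powr (p - 1)) \<le> p * (t powr p / p + s powr p / q)"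
    using p by (intro mult_left_mono) auto
  also have "\<dots> = t powr p + (p - 1) * s powr p"
    using p by (simp add: q_def field_simps)
  finally have "p * s powr (p - 1) * t \<le> t powr p + (p - 1) * s powr p"
    by (simp add: mult_ac)
  moreover have "s powr (p - 1) * s = s powr p"
    using s by (simp add: powr_diff)
  ultimately show ?thesis
    by (simp add: algebra_simps)
qed

subsection \<open>The spaces \<open>L\<^sup>p\<close> of one period cell\<close>

text \<open>Complex-valued and without periodicity, since Fourier coefficients see a function on one
  cell only.\<close>

definition Lp :: "real \<Rightarrow> (real^2 \<Rightarrow> complex) \<Rightarrow> bool" where
  "Lp p f \<longleftrightarrow> f \<in> borel_measurable torus \<and> integrable torus (\<lambda>x. norm (f x) powr p)"

lemma Lp_continuous: "continuous_on UNIV f \<Longrightarrow> p > 0 \<Longrightarrow> Lp p f"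
  unfolding Lp_def
  by (intro conjI borel_measurable_torus_continuous integrable_torus_continuous
      continuous_on_powr' continuous_intros) auto

lemma Lp_diff:
  assumes "Lp p f" "Lp p g" "p \<ge> 0"
  shows "Lp p (\<lambda>x. f x - g x)"
proof -
  have [measurable]: "f \<in> borel_measurable torus" "g \<in> borel_measurable torus"
    using assms by (auto simp: Lp_def)
  have "integrable torus (\<lambda>x. norm (f x - g x) powr p)"
    by (rule Bochner_Integration.integrable_bound[of _ "\<lambda>x. 2 powr p * (norm (f x) powr p + norm (g x) powr p)"])
       (use assms norm_diff_powr_le in \<open>auto simp: Lp_def intro!: Bochner_Integration.integrable_add integrable_mult_right\<close>)
  then show ?thesis by (simp add: Lp_def)
qed

text \<open>Stands in for Minkowski's inequality: estimates are carried through integrals of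
  \<open>p\<close>-th powers, without taking roots, at the price of the factor
  \<open>2 powr p\<close>.\<close>

lemma Lp_diff_integral_le:
  assumes "Lp p f" "Lp p g" "Lp p h" "p \<ge> 0"
  shows "(LINT x|torus. norm (f x - g x) powr p) \<le>
    2 powr p * ((LINT x|torus. norm (f x - h x) powr p) + (LINT x|torus. norm (g x - h x) powr p))"
proof -
  note int = Lp_diff[OF assms(1,2,4)] Lp_diff[OF assms(1,3,4)] Lp_diff[OF assms(2,3,4)]
  have "(LINT x|torus. norm (f x - g x) powr p) \<le>
    (LINT x|torus. 2 powr p * (norm (f x - h x) powr p + norm (g x - h x) powr p))"
  proof (rule integral_mono)
    fix x show "norm (f x - g x) powr p \<le> 2 powr p * (norm (f x - h x) powr p + norm (g x - h x) powr p)"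
      using norm_diff_powr_le[OF assms(4), of "f x - h x" "g x - h x"] by simp
  qed (use int in \<open>auto simp: Lp_def\<close>)
  also have "\<dots> = 2 powr p * ((LINT x|torus. norm (f x - h x) powr p) + (LINT x|torus. norm (g x - h x) powr p))"
    using int by (simp add: Lp_def)
  finally show ?thesis .
qed

lemma Lp_integrable:
  assumes "Lp p f" "p \<ge> 1"
  shows "integrable torus f"
proof (rule Bochner_Integration.integrable_bound[of _ "\<lambda>x. 1 + norm (f x) powr p"])
  show "AE x in torus. norm (f x) \<le> norm (1 + norm (f x) powr p)"
  proof (rule AE_I2)
    fix x
    show "norm (f x) \<le> norm (1 + norm (f x) powr p)"
    proof (cases "norm (f x) \<le> 1")
      case False
      then have "norm (f x) powr 1 \<le> norm (f x) powr p"
        using assms by (intro powr_mono) auto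
      then show ?thesis using False by simp
    qed (simp add: add_increasing2)
  qed
qed (use assms in \<open>auto simp: Lp_def\<close>)

text \<open>Jensen's inequality for the measure with density |K (x - y)| in y, followed by Tonelli:
  the row bound \<open>M1\<close> controls the average at \<open>x\<close>, the column bound
  \<open>M2\<close> the final integral. Continuity of \<open>T\<close> makes its \<open>p\<close>-th
  power integrable beforehand.\<close>

lemma Lp_schur:
  fixes K :: "real^2 \<Rightarrow> complex"
  assumes p: "p \<ge> 1" and f: "Lp p f" and K: "continuous_on UNIV K" and M: "M > 0"
    and M1: "\<And>x. x \<in> cell \<Longrightarrow> (LINT y|torus. norm (K (x - y))) \<le> M"
    and M2: "\<And>y. y \<in> cell \<Longrightarrow> (LINT x|torus. norm (K (x - y))) \<le> M"
    and T: "\<And>x. T x = (LINT y|torus. K (x - y) * f y)" "continuous_on UNIV T"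
  shows "(LINT x|torus. norm (T x) powr p) \<le> M powr p * (LINT x|torus. norm (f x) powr p)"
proof -
  have fm [measurable]: "f \<in> borel_measurable torus" and fp: "integrable torus (\<lambda>y. norm (f y) powr p)"
    using f by (auto simp: Lp_def)
  have fi: "integrable torus f" by (rule Lp_integrable[OF f p])
  have Kx: "continuous_on UNIV (\<lambda>y. K (x - y))" "continuous_on UNIV (\<lambda>y. K (y - x))" for x
    by (rule continuous_on_compose2[OF K]; auto intro!: continuous_intros)+
  have KI: "integrable torus (\<lambda>y. norm (K (x - y)))" "integrable torus (\<lambda>y. norm (K (y - x)))" for x
    by (intro integrable_torus_continuous continuous_intros Kx)+
  have Kmult: "integrable torus (\<lambda>y. norm (K (x - y)) * h y)" if "integrable torus h" for x and h :: "_ \<Rightarrow> real"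
  proof -
    obtain B where B: "B > 0" "\<And>y. y \<in> cell \<Longrightarrow> norm (K (x - y)) \<le> B"
      using continuous_bounded_cell[OF Kx(1)] by blast
    have [measurable]: "h \<in> borel_measurable torus" using that by auto
    have [measurable]: "(\<lambda>y. norm (K (x - y))) \<in> borel_measurable torus" using KI(1) by blast
    show ?thesis
      by (rule Bochner_Integration.integrable_bound[of _ "\<lambda>y. B * h y"])
        (use that B in \<open>auto intro!: AE_I2 mult_right_mono simp: abs_mult\<close>)
  qed
  have point: "norm (T x) powr p \<le> M powr (p - 1) * (LINT y|torus. norm (K (x - y)) * norm (f y) powr p)"
    if x: "x \<in> cell" for x
  proof -
    define J where "J = (LINT y|torus. norm (K (x - y)) * norm (f y))"
    define m where "m = (LINT y|torus. norm (K (x - y)))"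
    \<comment> \<open>The tangent is taken at \<open>J / M\<close> instead of at the mean
      \<open>J / m\<close>, because the mass \<open>m\<close> may vanish; the missing mass
      \<open>M - m\<close> is absorbed through \<open>p \<ge> 1\<close>.\<close>
    define s where "s = J / M"
    have J0: "J \<ge> 0" unfolding J_def by (intro Bochner_Integration.integral_nonneg) auto
    have s0: "s \<ge> 0" using J0 M by (simp add: s_def)
    have m: "0 \<le> m" "m \<le> M"
      unfolding m_def using M1[OF x] by (auto intro!: Bochner_Integration.integral_nonneg)
    have c: "p * (s powr (p - 1) * s) = p * s powr p"
      using s0 by (cases "s = 0") (auto simp: powr_diff)
    have "norm (T x) \<le> (LINT y|torus. norm (K (x - y) * f y))"
      unfolding T by (rule integral_norm_bound)
    then have TJ: "norm (T x) \<le> J" by (simp add: norm_mult J_def)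
    have "M * s powr p = m * s powr p + (M - m) * s powr p"
      by (simp add: algebra_simps)
    also have "\<dots> \<le> m * s powr p + (M - m) * (p * s powr p)"
      using m p mult_right_mono[of 1 p "s powr p"] by (intro add_left_mono mult_left_mono) auto
    also have "\<dots> = m * s powr p + p * s powr (p - 1) * (J - s * m)"
    proof -
      have "J = s * M" using M by (simp add: s_def)
      then have "p * s powr (p - 1) * (J - s * m) = (M - m) * (p * (s powr (p - 1) * s))"
        by (simp add: algebra_simps)
      then show ?thesis by (simp only: c)
    qed
    also have "\<dots> = (LINT y|torus. norm (K (x - y)) * (s powr p + p * s powr (p - 1) * (norm (f y) - s)))"
    proof -
      have i: "integrable torus (\<lambda>y. norm (K (x - y)) * norm (f y))"
        by (intro Kmult integrable_norm fi)
      have "(LINT y|torus. norm (K (x - y)) * (s powr p + p * s powr (p - 1) * (norm (f y) - s))) =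
        (LINT y|torus. (s powr p - p * s powr (p - 1) * s) * norm (K (x - y))
           + (p * s powr (p - 1)) * (norm (K (x - y)) * norm (f y)))"
        by (intro Bochner_Integration.integral_cong) (auto simp: algebra_simps)
      also have "\<dots> = (s powr p - p * s powr (p - 1) * s) * m + (p * s powr (p - 1)) * J"
        unfolding m_def J_def using KI(1)[of x] i by simp
      finally show ?thesis by (simp add: algebra_simps)
    qed
    also have "\<dots> \<le> (LINT y|torus. norm (K (x - y)) * norm (f y) powr p)"
    proof (rule integral_mono)
      have "integrable torus (\<lambda>y. s powr p + p * s powr (p - 1) * (norm (f y) - s))"
        by (intro Bochner_Integration.integrable_add integrable_mult_right Bochner_Integration.integrable_diff
            integrable_norm fi) auto
      then show "integrable torus (\<lambda>y. norm (K (x - y)) * (s powr p + p * s powr (p - 1) * (norm (f y) - s)))"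
        by (rule Kmult)
      show "integrable torus (\<lambda>y. norm (K (x - y)) * norm (f y) powr p)"
        by (rule Kmult[OF fp])
      fix y
      show "norm (K (x - y)) * (s powr p + p * s powr (p - 1) * (norm (f y) - s)) \<le> norm (K (x - y)) * norm (f y) powr p"
        using p s0 by (intro mult_left_mono powr_tangent_line) auto
    qed
    finally have main: "M * s powr p \<le> (LINT y|torus. norm (K (x - y)) * norm (f y) powr p)" .
    have "norm (T x) powr p \<le> J powr p"
      using TJ p by (intro powr_mono2) auto
    also have "\<dots> = (M * s) powr p"
      using M by (simp add: s_def)
    also have "\<dots> = M powr (p - 1) * (M * s powr p)"
      using M s0 by (simp add: powr_mult powr_diff)
    also have "\<dots> \<le> M powr (p - 1) * (LINT y|torus. norm (K (x - y)) * norm (f y) powr p)"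
      by (intro mult_left_mono main) auto
    finally show ?thesis .
  qed
  have Tint: "integrable torus (\<lambda>x. norm (T x) powr p)"
    using Lp_continuous[OF T(2), of p] p by (simp add: Lp_def)
  have KB: "K \<in> borel_measurable borel"
    by (rule borel_measurable_continuous_onI[OF K])
  have Km [measurable]: "(\<lambda>z. K (fst z - snd z)) \<in> borel_measurable (torus \<Otimes>\<^sub>M torus)"
  proof (rule measurable_compose[OF _ KB])
    have [measurable]: "fst \<in> measurable (torus \<Otimes>\<^sub>M torus) (borel :: (real^2) measure)"
      "snd \<in> measurable (torus \<Otimes>\<^sub>M torus) (borel :: (real^2) measure)"
      by (rule measurable_compose[OF measurable_fst id_measurable_torus],
          rule measurable_compose[OF measurable_snd id_measurable_torus])
    show "(\<lambda>z. fst z - snd z) \<in> borel_measurable (torus \<Otimes>\<^sub>M torus)"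
      by measurable
  qed
  interpret pair_sigma_finite torus torus ..
  \<comment> \<open>In \<open>ennreal\<close> the two integrals can be swapped on the strength of
    measurability alone.\<close>
  have "ennreal (LINT x|torus. norm (T x) powr p) = (\<integral>\<^sup>+x. ennreal (norm (T x) powr p) \<partial>torus)"
    using Tint by (subst nn_integral_eq_integral) auto
  also have "\<dots> \<le> (\<integral>\<^sup>+x. ennreal (M powr (p - 1)) * (\<integral>\<^sup>+y. ennreal (norm (K (x - y)) * norm (f y) powr p) \<partial>torus) \<partial>torus)"
  proof (rule nn_integral_mono)
    fix x assume "x \<in> space torus"
    then have "ennreal (norm (T x) powr p) \<le> ennreal (M powr (p - 1) * (LINT y|torus. norm (K (x - y)) * norm (f y) powr p))"
      by (intro ennreal_leI point) simp
    also have "\<dots> = ennreal (M powr (p - 1)) * (\<integral>\<^sup>+y. ennreal (norm (K (x - y)) * norm (f y) powr p) \<partial>torus)"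
      using Kmult[OF fp, of x] by (subst nn_integral_eq_integral) (auto simp: ennreal_mult')
    finally show "ennreal (norm (T x) powr p) \<le> ennreal (M powr (p - 1)) * (\<integral>\<^sup>+y. ennreal (norm (K (x - y)) * norm (f y) powr p) \<partial>torus)" .
  qed
  also have "\<dots> = ennreal (M powr (p - 1)) * (\<integral>\<^sup>+x. \<integral>\<^sup>+y. ennreal (norm (K (x - y)) * norm (f y) powr p) \<partial>torus \<partial>torus)"
    by (intro nn_integral_cmult torus.borel_measurable_nn_integral) (simp add: split_beta, measurable)
  also have "(\<integral>\<^sup>+x. \<integral>\<^sup>+y. ennreal (norm (K (x - y)) * norm (f y) powr p) \<partial>torus \<partial>torus) =
     (\<integral>\<^sup>+y. \<integral>\<^sup>+x. ennreal (norm (K (x - y)) * norm (f y) powr p) \<partial>torus \<partial>torus)"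
    by (rule Fubini'[symmetric]) (simp add: split_beta, measurable)
  also have "\<dots> \<le> (\<integral>\<^sup>+y. ennreal M * ennreal (norm (f y) powr p) \<partial>torus)"
  proof (rule nn_integral_mono)
    fix y assume y: "y \<in> space torus"
    have "(\<integral>\<^sup>+x. ennreal (norm (K (x - y)) * norm (f y) powr p) \<partial>torus) = ennreal ((LINT x|torus. norm (K (x - y)) * norm (f y) powr p))"
      using KI(2)[of y] by (subst nn_integral_eq_integral) auto
    also have "\<dots> = ennreal ((LINT x|torus. norm (K (x - y))) * norm (f y) powr p)"
      by simp
    also have "\<dots> \<le> ennreal (M * norm (f y) powr p)"
      using M2[of y] y by (intro ennreal_leI mult_right_mono) auto
    finally show "(\<integral>\<^sup>+x. ennreal (norm (K (x - y)) * norm (f y) powr p) \<partial>torus) \<le> ennreal M * ennreal (norm (f y) powr p)"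
      using M by (simp add: ennreal_mult')
  qed
  also have "\<dots> = ennreal (M * (LINT y|torus. norm (f y) powr p))"
    using M fp by (subst nn_integral_cmult) (auto simp: nn_integral_eq_integral ennreal_mult')
  finally have "ennreal (LINT x|torus. norm (T x) powr p) \<le> ennreal (M powr (p - 1) * (M * (LINT y|torus. norm (f y) powr p)))"
    by (simp add: ennreal_mult' mult_left_mono)
  then have "(LINT x|torus. norm (T x) powr p) \<le> M powr (p - 1) * (M * (LINT y|torus. norm (f y) powr p))"
    using M by (subst (asm) ennreal_le_iff) (auto intro!: mult_nonneg_nonneg Bochner_Integration.integral_nonneg)
  then show ?thesis
    using M by (simp add: powr_diff)
qed

subsection \<open>Littlewood-Paley truncations on \<open>L\<^sup>p\<close>\<close>

lemma LP_trunc_eq_sum: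
  assumes "LP_cutoff \<psi>"
  shows "LP_trunc \<psi> q f x = (\<Sum>\<alpha>\<in>freq_box (2 ^ q).
    of_real (\<psi> (inverse (freq q) *\<^sub>R lattice_vec \<alpha>)) * fourier_coeff f \<alpha> * char \<alpha> x)"
proof -
  have "LP_trunc \<psi> q f x = (\<Sum>\<^sub>\<infinity>\<alpha>\<in>freq_box (2 ^ q).
    of_real (\<psi> (inverse (freq q) *\<^sub>R lattice_vec \<alpha>)) * fourier_coeff f \<alpha> * char \<alpha> x)"
    unfolding LP_trunc_def exp_eq_char
    by (rule infsum_cong_neutral) (use cutoff_support[OF assms, of q] in auto)
  then show ?thesis
    by (simp add: freq_box(1))
qed

lemma continuous_LP_trunc:
  assumes "LP_cutoff \<psi>"
  shows "continuous_on UNIV (LP_trunc \<psi> q f)"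
  unfolding LP_trunc_eq_sum[OF assms, abs_def] by (intro continuous_intros)

lemma integrable_char_mult:
  assumes "integrable torus f"
  shows "integrable torus (\<lambda>x. char \<alpha> x * f x)" "integrable torus (\<lambda>x. cnj (char \<alpha> x) * f x)"
proof -
  have [measurable]: "char \<alpha> \<in> borel_measurable torus" "(\<lambda>x. cnj (char \<alpha> x)) \<in> borel_measurable torus"
    by (intro borel_measurable_torus_continuous continuous_intros continuous_on_id)+
  have [measurable]: "f \<in> borel_measurable torus" using assms by auto
  show "integrable torus (\<lambda>x. char \<alpha> x * f x)" "integrable torus (\<lambda>x. cnj (char \<alpha> x) * f x)"
    by (rule Bochner_Integration.integrable_bound[OF assms]; auto simp: norm_mult)+
qed

lemma LP_trunc_eq_kernel:
  assumes \<psi>: "LP_cutoff \<psi>" and f: "integrable torus f"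
  shows "LP_trunc \<psi> q f x = (LINT y|torus. LP_kernel \<psi> q (x - y) * f y)"
proof -
  let ?c = "\<lambda>\<alpha>. complex_of_real (\<psi> (inverse (freq q) *\<^sub>R lattice_vec \<alpha>))"
  have "(LINT y|torus. LP_kernel \<psi> q (x - y) * f y) =
    (LINT y|torus. (\<Sum>\<alpha>\<in>freq_box (2 ^ q). (?c \<alpha> * char \<alpha> x) * (cnj (char \<alpha> y) * f y)))"
    by (simp add: mult_kernel_def char_diff_arg sum_distrib_left sum_distrib_right mult_ac)
  also have "\<dots> = (\<Sum>\<alpha>\<in>freq_box (2 ^ q). (?c \<alpha> * char \<alpha> x) * fourier_coeff f \<alpha>)"
    by (simp only: fourier_coeff_eq integral_mult_right_zero Bochner_Integration.integral_sum
        integrable_char_mult[OF f] integrable_mult_right)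
  finally show ?thesis
    by (simp add: LP_trunc_eq_sum[OF \<psi>] mult_ac)
qed

lemma LP_trunc_diff:
  assumes \<psi>: "LP_cutoff \<psi>" and "integrable torus f" "integrable torus g"
  shows "LP_trunc \<psi> q (\<lambda>x. f x - g x) x = LP_trunc \<psi> q f x - LP_trunc \<psi> q g x"
  using assms
  by (simp add: LP_trunc_eq_sum fourier_coeff_eq right_diff_distrib left_diff_distrib integrable_char_mult sum_subtractf)

lemma LP_kernel_minus:
  assumes \<psi>: "LP_cutoff \<psi>"
  shows "LP_kernel \<psi> q (- z) = LP_kernel \<psi> q z"
proof (rule mult_kernel_minus)
  fix \<alpha>
  show "\<psi> (inverse (freq q) *\<^sub>R lattice_vec (- \<alpha>)) = \<psi> (inverse (freq q) *\<^sub>R lattice_vec \<alpha>)"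
    by (rule LP_cutoffD(3)[OF \<psi>]) (simp add: lattice_vec_uminus)
qed

text \<open>Evenness of the kernel and of \<open>torus_dist\<close> exchanges the two variables; the
  Schur test asks for the bound in both.\<close>

lemma LP_kernel_bounds':
  assumes \<psi>: "LP_cutoff \<psi>"
  obtains M where "M > 0"
    "\<And>q y. y \<in> cell \<Longrightarrow> (LINT x|torus. norm (LP_kernel \<psi> q (x - y))) \<le> M"
    "\<And>q x. x \<in> cell \<Longrightarrow> (LINT y|torus. norm (LP_kernel \<psi> q (x - y))) \<le> M"
    "\<And>q x. x \<in> cell \<Longrightarrow> (LINT y|torus. norm (LP_kernel \<psi> q (x - y)) * torus_dist (x - y)) \<le> M / 2 ^ q"
proof -
  obtain M where M: "M > 0"
    "\<And>q y. y \<in> cell \<Longrightarrow> (LINT x|torus. norm (LP_kernel \<psi> q (x - y))) \<le> M"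
    "\<And>q y. y \<in> cell \<Longrightarrow> (LINT x|torus. norm (LP_kernel \<psi> q (x - y)) * torus_dist (x - y)) \<le> M / 2 ^ q"
    by (rule LP_kernel_bounds[OF \<psi>]) (rule that; blast)
  have K: "LP_kernel \<psi> q (x - y) = LP_kernel \<psi> q (y - x)" for q x y
    using LP_kernel_minus[OF \<psi>, of q "y - x"] by simp
  have d: "torus_dist (x - y) = torus_dist (y - x)" for x y
    using pdist_minus[of "y $ 1 - x $ 1"] pdist_minus[of "y $ 2 - x $ 2"] by (simp add: torus_dist_def)
  have M': "(LINT y|torus. norm (LP_kernel \<psi> q (x - y))) \<le> M"
    "(LINT y|torus. norm (LP_kernel \<psi> q (x - y)) * torus_dist (x - y)) \<le> M / 2 ^ q" if "x \<in> cell" for q x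
    using M(2,3)[OF that, of q] by (simp_all only: K[of q x] d[of x])
  show ?thesis
    by (rule that[OF M(1) M(2) M'])
qed

lemma LP_trunc_Lp_bound:
  assumes \<psi>: "LP_cutoff \<psi>"
  obtains M where "M > 0"
    "\<And>p q f. p \<ge> 1 \<Longrightarrow> Lp p f \<Longrightarrow>
      (LINT x|torus. norm (LP_trunc \<psi> q f x) powr p) \<le> M powr p * (LINT x|torus. norm (f x) powr p)"
proof -
  obtain M where M: "M > 0"
    "\<And>q y. y \<in> cell \<Longrightarrow> (LINT x|torus. norm (LP_kernel \<psi> q (x - y))) \<le> M"
    "\<And>q x. x \<in> cell \<Longrightarrow> (LINT y|torus. norm (LP_kernel \<psi> q (x - y))) \<le> M"
    by (rule LP_kernel_bounds'[OF \<psi>]) (rule that; blast)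
  show ?thesis
  proof (rule that[OF M(1)])
    fix p q f assume "p \<ge> 1" "Lp p f"
    then show "(LINT x|torus. norm (LP_trunc \<psi> q f x) powr p) \<le> M powr p * (LINT x|torus. norm (f x) powr p)"
      using M by (intro Lp_schur[where K = "LP_kernel \<psi> q"] LP_trunc_eq_kernel[OF \<psi>] Lp_integrable continuous_LP_trunc[OF \<psi>]
          continuous_intros continuous_on_id) auto
  qed
qed

lemma LP_trunc_Lp: "LP_cutoff \<psi> \<Longrightarrow> p > 0 \<Longrightarrow> Lp p (LP_trunc \<psi> q f)"
  by (intro Lp_continuous continuous_LP_trunc)

section \<open>Approximate identities and continuous functions\<close>

lemma integral_LP_kernel:
  assumes \<psi>: "LP_cutoff \<psi>"
  shows "(LINT y|torus. LP_kernel \<psi> q (x - y)) = 1"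
proof -
  have fc: "fourier_coeff (\<lambda>_. 1) \<alpha> = (if \<alpha> = 0 then 1 else 0)" for \<alpha>
    using integral_char[of "- \<alpha>"] by (simp add: fourier_coeff_eq char_uminus)
  have \<psi>0: "\<psi> 0 = 1"
    by (rule LP_cutoffD(4)[OF \<psi>]) simp
  have 0: "0 \<in> freq_box (2 ^ q)"
    by (simp add: freq_box_def)
  have "LP_trunc \<psi> q (\<lambda>_. 1) x = (\<Sum>\<alpha>\<in>freq_box (2 ^ q). if \<alpha> = 0 then 1 else 0)"
    unfolding LP_trunc_eq_sum[OF \<psi>] fc by (intro sum.cong refl) (simp add: \<psi>0)
  also have "\<dots> = 1"
    using 0 by (simp add: freq_box(1))
  finally have "LP_trunc \<psi> q (\<lambda>_. 1) x = 1" .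
  then show ?thesis
    using LP_trunc_eq_kernel[OF \<psi>, of "\<lambda>_. 1" q x] by simp
qed

text \<open>A small \<open>torus_dist\<close> also occurs for points near opposite edges of the
  cell. If \<open>x\<close> keeps the margin \<open>\<eta>\<close> from all edges, the nearest
  integers must be 0, and closeness is Euclidean.\<close>

lemma torus_dist_cell:
  assumes x: "x \<in> cell" and y: "y \<in> cell" and \<eta>: "\<eta> > 0" "\<And>i. \<eta> \<le> x $ i" "\<And>i. \<eta> \<le> 1 - x $ i"
    and d: "torus_dist (x - y) < \<eta>\<^sup>2"
  shows "norm (x - y) < 2 * \<eta>"
proof -
  have c: "\<bar>x $ i - y $ i\<bar> < \<eta>" if le: "pdist (x $ i - y $ i) \<le> torus_dist (x - y)" for i
  proof -
    have xy: "0 \<le> x $ i" "x $ i < 1" "0 \<le> y $ i" "y $ i < 1"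
      using x y by (auto simp: cell_def)
    then have "\<exists>k\<in>{-1, 0, 1}. (x $ i - y $ i - k)\<^sup>2 \<le> pdist (x $ i - y $ i)"
      by (intro pdist_ge) auto
    then obtain k where k: "k \<in> {-1, 0, 1}" "(x $ i - y $ i - k)\<^sup>2 \<le> pdist (x $ i - y $ i)"
      by blast
    then have "(x $ i - y $ i - k)\<^sup>2 < \<eta>\<^sup>2"
      using le d by linarith
    then have "\<bar>x $ i - y $ i - k\<bar> < \<eta>"
      using \<eta>(1) by (metis abs_of_pos abs_le_square_iff linorder_not_le)
    then show ?thesis
      using k(1) \<eta>(2)[of i] \<eta>(3)[of i] xy by auto
  qed
  have "norm (x - y) \<le> (\<Sum>i\<in>UNIV. \<bar>(x - y) $ i\<bar>)"
    by (rule norm_le_l1_cart)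
  also have "\<dots> < 2 * \<eta>"
    using c[of 1] c[of 2] pdist_nonneg by (simp add: sum_2 torus_dist_def)
  finally show ?thesis .
qed

lemma AE_interior_cell: "AE x in torus. x \<in> cell \<and> (\<forall>i. 0 < x $ i)"
proof -
  have "negligible (\<Union>i\<in>UNIV. {x::real^2. x $ i = 0})"
    by (intro negligible_Union) (auto simp: negligible_standard_hyperplane_cart)
  then have "(\<Union>i\<in>UNIV. {x::real^2. x $ i = 0}) \<in> null_sets lebesgue"
    by (simp add: negligible_iff_null_sets)
  then have "AE x in lebesgue. x \<notin> (\<Union>i\<in>UNIV. {x::real^2. x $ i = 0})"
    by (rule AE_not_in)
  then have "AE x in lebesgue. x \<in> cell \<longrightarrow> x \<in> cell \<and> (\<forall>i. 0 < x $ i)"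
    by eventually_elim (auto simp: cell_def order.order_iff_strict)
  then show ?thesis
    unfolding torus_eq by (subst AE_restrict_space_iff) (use cell_lebesgue in auto)
qed

text \<open>Truncation sees only the values of \<open>g\<close> on one cell, and their periodic
  extension may jump across the edges; hence the restriction to interior points.\<close>

lemma LP_trunc_tendsto_pointwise:
  assumes \<psi>: "LP_cutoff \<psi>" and g: "continuous_on UNIV g" and x: "x \<in> cell" "\<And>i. 0 < x $ i"
  shows "(\<lambda>q. LP_trunc \<psi> q g x) \<longlonglongrightarrow> g x"
proof (rule LIMSEQ_I)
  fix \<epsilon> :: real assume \<epsilon>: "\<epsilon> > 0"
  obtain M where M: "M > 0"
    "\<And>q x. x \<in> cell \<Longrightarrow> (LINT y|torus. norm (LP_kernel \<psi> q (x - y))) \<le> M"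
    "\<And>q x. x \<in> cell \<Longrightarrow> (LINT y|torus. norm (LP_kernel \<psi> q (x - y)) * torus_dist (x - y)) \<le> M / 2 ^ q"
    by (rule LP_kernel_bounds'[OF \<psi>]) (rule that; blast)
  obtain B where B: "B > 0" "\<And>y. y \<in> cell \<Longrightarrow> norm (g y) \<le> B"
    using continuous_bounded_cell[OF g] by blast
  define e where "e = \<epsilon> / (4 * M)"
  have e: "e > 0" using \<epsilon> M by (simp add: e_def)
  obtain d where d: "d > 0" "\<And>y. norm (y - x) < d \<Longrightarrow> norm (g y - g x) < e"
    using g e unfolding continuous_on_iff dist_norm by (metis UNIV_I)
  \<comment> \<open>The entry \<open>d / 2\<close> puts the distance \<open>2 * \<eta>\<close> of
    \<open>torus_dist_cell\<close> within the modulus of continuity; the others are the margins to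
    the four edges.\<close>
  define \<eta> where "\<eta> = Min {d / 2, x $ 1, x $ 2, 1 - x $ 1, 1 - x $ 2}"
  have "\<eta> > 0"
    using d x unfolding \<eta>_def by (subst Min_gr_iff) (auto simp: cell_def)
  moreover have "\<eta> \<le> d / 2" "\<eta> \<le> x $ 1" "\<eta> \<le> x $ 2" "\<eta> \<le> 1 - x $ 1" "\<eta> \<le> 1 - x $ 2"
    unfolding \<eta>_def by (rule Min_le; simp)+
  ultimately have \<eta>: "\<eta> > 0" "\<eta> \<le> d / 2" "\<eta> \<le> x $ 1" "\<eta> \<le> x $ 2" "\<eta> \<le> 1 - x $ 1" "\<eta> \<le> 1 - x $ 2"
    by auto
  have \<eta>': "\<eta> \<le> x $ i" "\<eta> \<le> 1 - x $ i" for i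
    using \<eta> exhaust_2[of i] by auto
  \<comment> \<open>One majorant for near and far points: far away \<open>torus_dist\<close> is at
    least the square of \<open>\<eta>\<close>, so the trivial bound \<open>2 * B\<close> is paid for
    by the integral of the kernel against \<open>torus_dist\<close>, which is at most
    \<open>M / 2 ^ q\<close>.\<close>
  have bound: "norm (g y - g x) \<le> e + (2 * B / \<eta>\<^sup>2) * torus_dist (x - y)" if y: "y \<in> cell" for y
  proof (cases "torus_dist (x - y) < \<eta>\<^sup>2")
    case True
    then have "norm (x - y) < 2 * \<eta>"
      using torus_dist_cell[OF x(1) y \<eta>(1) \<eta>'] by blast
    then have "norm (g y - g x) < e"
      using d(2)[of y] \<eta>(2) by (simp add: norm_minus_commute)
    moreover have "0 \<le> (2 * B / \<eta>\<^sup>2) * torus_dist (x - y)"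
      using B torus_dist_nonneg by (intro mult_nonneg_nonneg) auto
    ultimately show ?thesis by linarith
  next
    case False
    have "norm (g y - g x) \<le> 2 * B"
      using norm_triangle_ineq4[of "g y" "g x"] B(2)[OF y] B(2)[OF x(1)] by linarith
    also have "\<dots> = (2 * B / \<eta>\<^sup>2) * \<eta>\<^sup>2"
      using \<eta>(1) by simp
    also have "\<dots> \<le> (2 * B / \<eta>\<^sup>2) * torus_dist (x - y)"
      using False B by (intro mult_left_mono) auto
    finally show ?thesis using e by linarith
  qed
  have int: "continuous_on UNIV (\<lambda>y. LP_kernel \<psi> q (x - y))" for q
    by (intro continuous_intros)
  have tc: "continuous_on UNIV (\<lambda>y. torus_dist (x - y))"
    by (intro continuous_intros)
  have main: "norm (LP_trunc \<psi> q g x - g x) \<le> e * M + (2 * B / \<eta>\<^sup>2) * (M / 2 ^ q)" for q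
  proof -
    have "LP_trunc \<psi> q g x - g x = (LINT y|torus. LP_kernel \<psi> q (x - y) * g y) - (LINT y|torus. LP_kernel \<psi> q (x - y)) * g x"
      by (simp add: LP_trunc_eq_kernel[OF \<psi> integrable_torus_continuous[OF g]] integral_LP_kernel[OF \<psi>])
    also have "\<dots> = (LINT y|torus. LP_kernel \<psi> q (x - y) * (g y - g x))"
      using g by (simp add: right_diff_distrib integrable_torus_continuous int continuous_on_mult)
    also have "norm \<dots> \<le> (LINT y|torus. norm (LP_kernel \<psi> q (x - y) * (g y - g x)))"
      by (rule integral_norm_bound)
    also have "\<dots> \<le> (LINT y|torus. e * norm (LP_kernel \<psi> q (x - y)) + (2 * B / \<eta>\<^sup>2) * (norm (LP_kernel \<psi> q (x - y)) * torus_dist (x - y)))"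
    proof (rule integral_mono)
      show "integrable torus (\<lambda>y. norm (LP_kernel \<psi> q (x - y) * (g y - g x)))"
        by (intro integrable_torus_continuous continuous_intros int g)
      show "integrable torus (\<lambda>y. e * norm (LP_kernel \<psi> q (x - y)) + (2 * B / \<eta>\<^sup>2) * (norm (LP_kernel \<psi> q (x - y)) * torus_dist (x - y)))"
        by (intro integrable_torus_continuous continuous_on_add continuous_on_mult continuous_on_norm continuous_on_const int tc)
      fix y assume "y \<in> space torus"
      then have "norm (LP_kernel \<psi> q (x - y)) * norm (g y - g x) \<le> norm (LP_kernel \<psi> q (x - y)) * (e + (2 * B / \<eta>\<^sup>2) * torus_dist (x - y))"
        by (intro mult_left_mono bound) auto
      then show "norm (LP_kernel \<psi> q (x - y) * (g y - g x)) \<le> e * norm (LP_kernel \<psi> q (x - y)) + (2 * B / \<eta>\<^sup>2) * (norm (LP_kernel \<psi> q (x - y)) * torus_dist (x - y))"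
        unfolding norm_mult by (simp add: algebra_simps)
    qed
    also have "\<dots> = e * (LINT y|torus. norm (LP_kernel \<psi> q (x - y))) + (2 * B / \<eta>\<^sup>2) * (LINT y|torus. norm (LP_kernel \<psi> q (x - y)) * torus_dist (x - y))"
      by (subst Bochner_Integration.integral_add;
          (intro integrable_torus_continuous continuous_on_mult continuous_on_norm continuous_on_const int tc)?) simp
    also have "\<dots> \<le> e * M + (2 * B / \<eta>\<^sup>2) * (M / 2 ^ q)"
      using e B M x by (intro add_mono mult_left_mono) auto
    finally show ?thesis .
  qed
  have "(\<lambda>q. e * M + (2 * B / \<eta>\<^sup>2) * (M / 2 ^ q)) \<longlonglongrightarrow> e * M + (2 * B / \<eta>\<^sup>2) * 0"
    by (intro tendsto_intros) (simp add: LIMSEQ_divide_realpow_zero)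
  moreover have "e * M + (2 * B / \<eta>\<^sup>2) * 0 < \<epsilon>"
    using \<epsilon> M by (simp add: e_def)
  ultimately have "eventually (\<lambda>q. e * M + (2 * B / \<eta>\<^sup>2) * (M / 2 ^ q) < \<epsilon>) sequentially"
    by (rule order_tendstoD(2))
  then obtain q0 where "\<And>q. q \<ge> q0 \<Longrightarrow> e * M + (2 * B / \<eta>\<^sup>2) * (M / 2 ^ q) < \<epsilon>"
    by (auto simp: eventually_sequentially)
  then show "\<exists>q0. \<forall>q\<ge>q0. norm (LP_trunc \<psi> q g x - g x) < \<epsilon>"
    using main by (meson le_less_trans)
qed

text \<open>Pointwise convergence almost everywhere is dominated by a constant, because the kernel
  masses are bounded uniformly in \<open>q\<close>.\<close>

lemma LP_trunc_tendsto_continuous: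
  assumes \<psi>: "LP_cutoff \<psi>" and g: "continuous_on UNIV g" and p: "p \<ge> 1"
  shows "(\<lambda>q. LINT x|torus. norm (LP_trunc \<psi> q g x - g x) powr p) \<longlonglongrightarrow> 0"
proof -
  obtain M where M: "M > 0"
    "\<And>q x. x \<in> cell \<Longrightarrow> (LINT y|torus. norm (LP_kernel \<psi> q (x - y))) \<le> M"
    by (rule LP_kernel_bounds'[OF \<psi>]) (rule that; blast)
  obtain B where B: "B > 0" "\<And>y. y \<in> cell \<Longrightarrow> norm (g y) \<le> B"
    using continuous_bounded_cell[OF g] by blast
  have cp: "continuous_on UNIV (\<lambda>x. norm (LP_trunc \<psi> q g x - g x) powr p)" for q
    using p by (intro continuous_on_powr' continuous_intros continuous_LP_trunc[OF \<psi>] g) auto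
  have bd: "norm (LP_trunc \<psi> q g x) \<le> B * M" if x: "x \<in> cell" for q x
  proof -
    have int: "continuous_on UNIV (\<lambda>y. LP_kernel \<psi> q (x - y))" for q
      by (intro continuous_intros)
    have "norm (LP_trunc \<psi> q g x) \<le> (LINT y|torus. norm (LP_kernel \<psi> q (x - y) * g y))"
      unfolding LP_trunc_eq_kernel[OF \<psi> integrable_torus_continuous[OF g]] by (rule integral_norm_bound)
    also have "\<dots> \<le> (LINT y|torus. B * norm (LP_kernel \<psi> q (x - y)))"
    proof (rule integral_mono)
      fix y assume "y \<in> space torus"
      then show "norm (LP_kernel \<psi> q (x - y) * g y) \<le> B * norm (LP_kernel \<psi> q (x - y))"
        using B(2)[of y] mult_left_mono[of "norm (g y)" B "norm (LP_kernel \<psi> q (x - y))"] by (simp add: norm_mult mult.commute)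
    qed (intro integrable_torus_continuous continuous_intros int g)+
    also have "\<dots> \<le> B * M"
      using M B x by simp
    finally show ?thesis .
  qed
  have "(\<lambda>q. LINT x|torus. norm (LP_trunc \<psi> q g x - g x) powr p) \<longlonglongrightarrow> (LINT x|torus. 0)"
  proof (rule integral_dominated_convergence[where w = "\<lambda>_. (B * M + B) powr p"])
    show "AE x in torus. (\<lambda>q. norm (LP_trunc \<psi> q g x - g x) powr p) \<longlonglongrightarrow> 0"
      using AE_interior_cell
    proof eventually_elim
      case (elim x)
      have "(\<lambda>q. norm (LP_trunc \<psi> q g x - g x)) \<longlonglongrightarrow> 0"
        using LP_trunc_tendsto_pointwise[OF \<psi> g, of x] elim
        by (auto simp: LIM_zero_iff tendsto_norm_zero_iff)
      then show ?case
        using p by (intro tendsto_zero_powrI[where b = p]) (auto intro!: tendsto_const)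
    qed
    show "AE x in torus. norm (norm (LP_trunc \<psi> q g x - g x) powr p) \<le> (B * M + B) powr p" for q
    proof (rule AE_I2)
      fix x assume "x \<in> space torus"
      then have "norm (LP_trunc \<psi> q g x - g x) \<le> B * M + B"
        using bd[of x q] B(2)[of x] norm_triangle_ineq4[of "LP_trunc \<psi> q g x" "g x"] by simp
      then show "norm (norm (LP_trunc \<psi> q g x - g x) powr p) \<le> (B * M + B) powr p"
        using p by (auto intro!: powr_mono2)
    qed
  qed (auto intro!: borel_measurable_torus_continuous cp)
  then show ?thesis by simp
qed

text \<open>Cutting off large values leaves a bounded function, which is an almost everywhere limit
  of continuous ones; clamping these to the same bound permits dominated convergence.\<close>

lemma Lp_dense_continuous:
  assumes f: "Lp p f" and p: "p \<ge> 1" and \<epsilon>: "\<epsilon> > 0"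
  shows "\<exists>g. continuous_on UNIV g \<and> (LINT x|torus. norm (f x - g x) powr p) < \<epsilon>"
proof -
  have fm [measurable]: "f \<in> borel_measurable torus" and fp: "integrable torus (\<lambda>x. norm (f x) powr p)"
    using f by (auto simp: Lp_def)
  define \<delta> where "\<delta> = \<epsilon> / (4 * 2 powr p)"
  have \<delta>: "\<delta> > 0" using \<epsilon> by (simp add: \<delta>_def)
  define fk where "fk = (\<lambda>k::nat. \<lambda>x. if norm (f x) \<le> real k then f x else 0)"
  have fkm [measurable]: "fk k \<in> borel_measurable torus" for k
    unfolding fk_def by measurable
  have "(\<lambda>k. LINT x|torus. norm (f x - fk k x) powr p) \<longlonglongrightarrow> (LINT x|torus. 0)"
  proof (rule integral_dominated_convergence[where w = "\<lambda>x. norm (f x) powr p"])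
    show "AE x in torus. (\<lambda>k. norm (f x - fk k x) powr p) \<longlonglongrightarrow> 0"
    proof (rule AE_I2)
      fix x
      obtain k0 where "norm (f x) \<le> real k0" using real_arch_simple by blast
      then have "\<And>k. k \<ge> k0 \<Longrightarrow> norm (f x - fk k x) powr p = 0"
        using p by (auto simp: fk_def)
      then show "(\<lambda>k. norm (f x - fk k x) powr p) \<longlonglongrightarrow> 0"
        by (intro tendsto_eventually) (auto simp: eventually_sequentially)
    qed
    show "AE x in torus. norm (norm (f x - fk k x) powr p) \<le> norm (f x) powr p" for k
      by (rule AE_I2) (auto simp: fk_def)
  qed (auto intro: fp)
  then have "eventually (\<lambda>k. (LINT x|torus. norm (f x - fk k x) powr p) < \<delta>) sequentially"
    using \<delta> by (intro order_tendstoD(2)[of _ 0]) auto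
  then obtain k where k: "k \<ge> 1" "(LINT x|torus. norm (f x - fk k x) powr p) < \<delta>"
    unfolding eventually_sequentially by (metis le_add1 le_add2)
  define B where "B = real k"
  have B: "B > 0" "\<And>x. norm (fk k x) \<le> B"
    using k(1) by (auto simp: B_def fk_def)
  have "fk k measurable_on cell"
    using fkm[of k] unfolding torus_eq by (subst measurable_on_iff_borel_measurable) (auto simp: cell_lebesgue)
  then obtain N g where N: "negligible N" and g: "\<And>n. continuous_on UNIV (g n)"
    and gl: "\<And>x. x \<notin> N \<Longrightarrow> (\<lambda>n. g n x) \<longlonglongrightarrow> (if x \<in> cell then fk k x else 0)"
    unfolding measurable_on_def by blast
  \<comment> \<open>Radial clamp to the ball of radius \<open>B\<close>; it is continuous and fixes
    the limit \<open>fk k x\<close>, whose norm is at most \<open>B\<close>.\<close>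
  define h where "h = (\<lambda>(n::nat) x. (B / max B (norm (g n x))) *\<^sub>R g n x)"
  have mx: "max B t > 0" "max B t \<noteq> 0" for t using B(1) by (auto simp: less_max_iff_disj max_def)
  have h: "continuous_on UNIV (h n)" for n
    unfolding h_def using mx by (intro continuous_intros g) auto
  have hB: "norm (h n x) \<le> B" for n x
  proof -
    have "norm (h n x) = B * (norm (g n x) / max B (norm (g n x)))"
      using B(1) mx[of "norm (g n x)"] by (simp add: h_def)
    also have "\<dots> \<le> B * 1"
      using B(1) mx[of "norm (g n x)"] by (intro mult_left_mono) auto
    finally show ?thesis by simp
  qed
  have "(\<lambda>n. LINT x|torus. norm (h n x - fk k x) powr p) \<longlonglongrightarrow> (LINT x|torus. 0)"
  proof (rule integral_dominated_convergence[where w = "\<lambda>x. (2 * B) powr p"])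
    have "N \<in> null_sets lebesgue"
      using N by (simp add: negligible_iff_null_sets)
    then have "AE x in lebesgue. x \<notin> N"
      by (rule AE_not_in)
    then have "AE x in torus. x \<in> cell \<and> x \<notin> N"
      unfolding torus_eq by (subst AE_restrict_space_iff) (use cell_lebesgue in auto)
    then show "AE x in torus. (\<lambda>n. norm (h n x - fk k x) powr p) \<longlonglongrightarrow> 0"
    proof eventually_elim
      case (elim x)
      then have "(\<lambda>n. g n x) \<longlonglongrightarrow> fk k x" using gl[of x] by simp
      then have "(\<lambda>n. h n x) \<longlonglongrightarrow> (B / max B (norm (fk k x))) *\<^sub>R fk k x"
        unfolding h_def using mx by (intro tendsto_intros) auto
      also have "(B / max B (norm (fk k x))) *\<^sub>R fk k x = fk k x"
        using B by (simp add: max_absorb1)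
      finally have "(\<lambda>n. norm (h n x - fk k x)) \<longlonglongrightarrow> 0"
        by (simp add: LIM_zero_iff tendsto_norm_zero_iff)
      then show ?case
        using p by (intro tendsto_zero_powrI[where b = p]) (auto intro!: tendsto_const)
    qed
    show "AE x in torus. norm (norm (h n x - fk k x) powr p) \<le> (2 * B) powr p" for n
    proof (rule AE_I2)
      fix x
      have "norm (h n x - fk k x) \<le> 2 * B"
        using hB[of n x] B(2)[of x] norm_triangle_ineq4[of "h n x" "fk k x"] by simp
      then show "norm (norm (h n x - fk k x) powr p) \<le> (2 * B) powr p"
        using p by (auto intro!: powr_mono2)
    qed
    show "(\<lambda>x. norm (h n x - fk k x) powr p) \<in> borel_measurable torus" for n
      using borel_measurable_torus_continuous[OF h[of n]] by measurable
  qed auto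
  then have "eventually (\<lambda>n. (LINT x|torus. norm (h n x - fk k x) powr p) < \<delta>) sequentially"
    using \<delta> by (intro order_tendstoD(2)[of _ 0]) auto
  then obtain n where n: "(LINT x|torus. norm (h n x - fk k x) powr p) < \<delta>"
    unfolding eventually_sequentially by blast
  have "Lp p (fk k)"
    unfolding Lp_def
    by (auto intro!: Bochner_Integration.integrable_bound[OF fp]) (auto simp: fk_def)
  then have "(LINT x|torus. norm (f x - h n x) powr p) \<le> 2 powr p * ((LINT x|torus. norm (f x - fk k x) powr p) + (LINT x|torus. norm (h n x - fk k x) powr p))"
    using p by (intro Lp_diff_integral_le f Lp_continuous[OF h]) auto
  also have "\<dots> \<le> 2 powr p * (\<delta> + \<delta>)"
    using k n by (intro mult_left_mono add_mono) auto
  also have "\<dots> < \<epsilon>"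
    using \<epsilon> by (simp add: \<delta>_def)
  finally show ?thesis using h by blast
qed

text \<open>Uniform boundedness on \<open>L^p\<close> controls the truncation of
  \<open>f - g\<close>, and convergence is known for the continuous \<open>g\<close>.\<close>

lemma LP_trunc_tendsto:
  assumes \<psi>: "LP_cutoff \<psi>" and f: "Lp p f" and p: "p \<ge> 1"
  shows "(\<lambda>q. LINT x|torus. norm (LP_trunc \<psi> q f x - f x) powr p) \<longlonglongrightarrow> 0"
proof (rule LIMSEQ_I)
  fix \<epsilon> :: real assume \<epsilon>: "\<epsilon> > 0"
  obtain M where M: "M > 0"
    "\<And>p q f. p \<ge> 1 \<Longrightarrow> Lp p f \<Longrightarrow>
      (LINT x|torus. norm (LP_trunc \<psi> q f x) powr p) \<le> M powr p * (LINT x|torus. norm (f x) powr p)"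
    by (rule LP_trunc_Lp_bound[OF \<psi>]) (rule that; blast)
  define c where "c = 2 powr p"
  \<comment> \<open>Two uses of \<open>Lp_diff_integral_le\<close> yield c (M^p \<delta> + c
    (\<delta> + r)), where r is the error of truncating \<open>g\<close>. This \<delta> makes the
    \<delta>-terms add up to \<epsilon> / 2, and r < \<epsilon> / (2 c c) accounts for the other
    half.\<close>
  define \<delta> where "\<delta> = \<epsilon> / (2 * (c * (c + M powr p)))"
  have c: "c > 0" by (simp add: c_def)
  have "M powr p > 0" using M(1) by simp
  then have cM: "c * (c + M powr p) > 0" using c by (intro mult_pos_pos add_pos_pos)
  have \<delta>: "\<delta> > 0"
    unfolding \<delta>_def using \<epsilon> cM by simp
  obtain g where g: "continuous_on UNIV g" "(LINT x|torus. norm (f x - g x) powr p) < \<delta>"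
    using Lp_dense_continuous[OF f p \<delta>] by blast
  have gp: "Lp p g" using g p by (intro Lp_continuous) auto
  have "eventually (\<lambda>q. (LINT x|torus. norm (LP_trunc \<psi> q g x - g x) powr p) < \<epsilon> / (2 * c * c)) sequentially"
    using LP_trunc_tendsto_continuous[OF \<psi> g(1) p] \<epsilon> c by (intro order_tendstoD(2)[of _ 0]) auto
  then obtain q0 where q0: "\<And>q. q \<ge> q0 \<Longrightarrow> (LINT x|torus. norm (LP_trunc \<psi> q g x - g x) powr p) < \<epsilon> / (2 * c * c)"
    unfolding eventually_sequentially by blast
  have "norm ((LINT x|torus. norm (LP_trunc \<psi> q f x - f x) powr p) - 0) < \<epsilon>" if q: "q \<ge> q0" for q
  proof -
    let ?S = "LP_trunc \<psi> q"
    have Lp: "Lp p (?S f)" "Lp p (?S g)"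
      using p by (auto intro!: LP_trunc_Lp[OF \<psi>])
    have "(LINT x|torus. norm (?S f x - ?S g x) powr p) = (LINT x|torus. norm (?S (\<lambda>x. f x - g x) x) powr p)"
      by (simp add: LP_trunc_diff[OF \<psi> Lp_integrable[OF f p] Lp_integrable[OF gp p]])
    also have "\<dots> \<le> M powr p * (LINT x|torus. norm (f x - g x) powr p)"
      using p by (intro M(2) Lp_diff f gp) auto
    also have "\<dots> \<le> M powr p * \<delta>"
      using g(2) by (intro mult_left_mono) auto
    finally have 1: "(LINT x|torus. norm (?S f x - ?S g x) powr p) \<le> M powr p * \<delta>" .
    have 2: "(LINT x|torus. norm (f x - ?S g x) powr p) \<le> c * ((LINT x|torus. norm (f x - g x) powr p) + (LINT x|torus. norm (?S g x - g x) powr p))"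
      unfolding c_def using p by (intro Lp_diff_integral_le f gp Lp) auto
    have "(LINT x|torus. norm (?S f x - f x) powr p) \<le> c * ((LINT x|torus. norm (?S f x - ?S g x) powr p) + (LINT x|torus. norm (f x - ?S g x) powr p))"
      unfolding c_def using p by (intro Lp_diff_integral_le f gp Lp) auto
    also have "\<dots> \<le> c * (M powr p * \<delta> + c * ((LINT x|torus. norm (f x - g x) powr p) + (LINT x|torus. norm (?S g x - g x) powr p)))"
      using c 1 2 by (intro mult_left_mono add_mono) auto
    also have "\<dots> < c * (M powr p * \<delta> + c * (\<delta> + \<epsilon> / (2 * c * c)))"
      using c q0[OF q] g(2) by (intro mult_strict_left_mono add_strict_left_mono add_strict_mono) auto
    also have "\<dots> = \<delta> * (c * (c + M powr p)) + \<epsilon> / 2"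
      using c by (simp add: field_simps)
    also have "\<delta> * (c * (c + M powr p)) = \<epsilon> / 2"
    proof -
      have "\<epsilon> / (2 * W) * W = \<epsilon> / 2" if "W > 0" for W using that by simp
      from this[OF cM] show ?thesis by (simp only: \<delta>_def)
    qed
    finally show ?thesis
      by (simp add: Bochner_Integration.integral_nonneg)
  qed
  then show "\<exists>q0. \<forall>q\<ge>q0. norm ((LINT x|torus. norm (LP_trunc \<psi> q f x - f x) powr p) - 0) < \<epsilon>"
    by blast
qed

subsection \<open>A Gagliardo-Nirenberg inequality\<close>

text \<open>Young's inequality for \<open>x * y\<close> and \<open>z\<close> with exponents 3 and
  3/2, and then for the cubes of \<open>x\<close> and \<open>y\<close> with exponents 2 and
  2.\<close>

lemma young3:
  fixes x y z :: real
  assumes "x \<ge> 0" "y \<ge> 0" "z \<ge> 0"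
  shows "x * y * z \<le> x ^ 6 / 6 + y ^ 6 / 6 + 2 / 3 * z powr (3 / 2)"
proof -
  have "(x * y) * z \<le> (x * y) powr 3 / 3 + z powr (3 / 2) / (3 / 2)"
    using assms by (intro Youngs_inequality) auto
  also have "(x * y) powr 3 = x ^ 3 * y ^ 3"
    using assms by (simp add: power_mult_distrib flip: powr_numeral) (simp add: powr_numeral powr_mult)
  finally have "x * y * z \<le> x ^ 3 * y ^ 3 / 3 + 2 / 3 * z powr (3 / 2)"
    by simp
  moreover have "2 * (x ^ 3 * y ^ 3) \<le> x ^ 6 + y ^ 6"
    using zero_le_power2[of "x ^ 3 - y ^ 3"] by (simp add: power2_diff flip: power_mult)
  ultimately show ?thesis by simp
qed

text \<open>Young's inequality for the normalised factors, integrated; its weights 1/6, 1/6 and 2/3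
  add up to 1. Positive upper bounds \<open>A\<close>, \<open>B\<close>, \<open>C\<close> in place
  of the norms keep the normalisation safe when a function vanishes.\<close>

lemma holder_6_6_three_halves:
  fixes a b c :: "real^2 \<Rightarrow> real"
  assumes [measurable]: "a \<in> borel_measurable torus" "b \<in> borel_measurable torus" "c \<in> borel_measurable torus"
    and int: "integrable torus (\<lambda>x. \<bar>a x\<bar> ^ 6)" "integrable torus (\<lambda>x. \<bar>b x\<bar> ^ 6)"
      "integrable torus (\<lambda>x. \<bar>c x\<bar> powr (3 / 2))"
    and pos: "A > 0" "B > 0" "C > 0"
    and le: "(LINT x|torus. \<bar>a x\<bar> ^ 6) \<le> A ^ 6" "(LINT x|torus. \<bar>b x\<bar> ^ 6) \<le> B ^ 6"
      "(LINT x|torus. \<bar>c x\<bar> powr (3 / 2)) \<le> C powr (3 / 2)"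
  shows "integrable torus (\<lambda>x. a x * b x * c x)"
    and "(LINT x|torus. \<bar>a x * b x * c x\<bar>) \<le> A * B * C"
proof -
  let ?w = "\<lambda>x. A * B * C * (\<bar>a x\<bar> ^ 6 / (6 * A ^ 6) + \<bar>b x\<bar> ^ 6 / (6 * B ^ 6) +
    2 / 3 * (\<bar>c x\<bar> powr (3 / 2) / C powr (3 / 2)))"
  have iw: "integrable torus ?w"
    using int by (intro integrable_mult_right Bochner_Integration.integrable_add integrable_divide) auto
  have point: "\<bar>a x * b x * c x\<bar> \<le> ?w x" for x
  proof -
    have "(\<bar>a x\<bar> / A) * (\<bar>b x\<bar> / B) * (\<bar>c x\<bar> / C) \<le>
      (\<bar>a x\<bar> / A) ^ 6 / 6 + (\<bar>b x\<bar> / B) ^ 6 / 6 + 2 / 3 * (\<bar>c x\<bar> / C) powr (3 / 2)"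
      using pos by (intro young3) auto
    then have "A * B * C * ((\<bar>a x\<bar> / A) * (\<bar>b x\<bar> / B) * (\<bar>c x\<bar> / C)) \<le> A * B * C * ((\<bar>a x\<bar> / A) ^ 6 / 6 + (\<bar>b x\<bar> / B) ^ 6 / 6 + 2 / 3 * (\<bar>c x\<bar> / C) powr (3 / 2))"
      using pos by (intro mult_left_mono) auto
    moreover have "A * B * C * ((\<bar>a x\<bar> / A) * (\<bar>b x\<bar> / B) * (\<bar>c x\<bar> / C)) = \<bar>a x * b x * c x\<bar>"
      using pos by (simp add: abs_mult)
    moreover have "(\<bar>a x\<bar> / A) ^ 6 / 6 = \<bar>a x\<bar> ^ 6 / (6 * A ^ 6)" "(\<bar>b x\<bar> / B) ^ 6 / 6 = \<bar>b x\<bar> ^ 6 / (6 * B ^ 6)"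
      "(\<bar>c x\<bar> / C) powr (3 / 2) = \<bar>c x\<bar> powr (3 / 2) / C powr (3 / 2)"
      using pos by (simp_all add: power_divide powr_divide)
    ultimately show ?thesis by (simp only:)
  qed
  show "integrable torus (\<lambda>x. a x * b x * c x)"
  proof (rule Bochner_Integration.integrable_bound[OF iw])
    have "norm (a x * b x * c x) \<le> norm (?w x)" for x
      using order_trans[OF point abs_ge_self, of x] by (simp only: real_norm_def)
    then show "AE x in torus. norm (a x * b x * c x) \<le> norm (?w x)"
      by (intro AE_I2)
  qed measurable
  then have "(LINT x|torus. \<bar>a x * b x * c x\<bar>) \<le> (LINT x|torus. ?w x)"
    by (intro integral_mono iw point) auto
  also have "\<dots> = A * B * C * ((LINT x|torus. \<bar>a x\<bar> ^ 6) / (6 * A ^ 6) + (LINT x|torus. \<bar>b x\<bar> ^ 6) / (6 * B ^ 6) +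
    2 / 3 * ((LINT x|torus. \<bar>c x\<bar> powr (3 / 2)) / C powr (3 / 2)))"
    using int by simp
  also have "\<dots> \<le> A * B * C * (A ^ 6 / (6 * A ^ 6) + B ^ 6 / (6 * B ^ 6) + 2 / 3 * (C powr (3 / 2) / C powr (3 / 2)))"
    using pos by (intro mult_left_mono add_mono divide_right_mono le) auto
  also have "\<dots> = A * B * C"
    using pos by simp
  finally show "(LINT x|torus. \<bar>a x * b x * c x\<bar>) \<le> A * B * C" .
qed

section \<open>Slicing estimates over the unit square\<close>

lemma nn_integral_Icc_Ico:
  fixes f :: "real \<Rightarrow> ennreal"
  shows "(\<integral>\<^sup>+t\<in>{a..b}. f t \<partial>lborel) = (\<integral>\<^sup>+t\<in>{a..<b}. f t \<partial>lborel)"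
proof (rule nn_integral_cong_AE)
  show "AE x in lborel. f x * indicator {a..b} x = f x * indicator {a..<b} x"
    using AE_lborel_singleton[of b] by eventually_elim (auto simp: indicator_def)
qed

text \<open>For each \<open>t\<close>, \<open>norm (F a)\<close> is at most
  \<open>norm (F t)\<close> plus the integral of \<open>norm (F' t)\<close>; averaging over
  \<open>t\<close> removes the choice of a starting point. The term without derivative remains
  because \<open>F\<close> need not vanish anywhere.\<close>

lemma sup_le_nn_integral_derivative:
  fixes F F' :: "real \<Rightarrow> complex"
  assumes der: "\<And>t. (F has_vector_derivative F' t) (at t)" and cont: "continuous_on UNIV F'"
    and a: "a \<in> {0..<1}"
  shows "ennreal (norm (F a)) \<le> (\<integral>\<^sup>+t\<in>{0..<1}. ennreal (norm (F t) + norm (F' t)) \<partial>lborel)"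
proof -
  have cF: "continuous_on UNIV F"
    using der by (intro continuous_at_imp_continuous_on) (auto intro: has_vector_derivative_continuous)
  have [measurable]: "F \<in> borel_measurable borel" "F' \<in> borel_measurable borel"
    using cF cont by (auto intro: borel_measurable_continuous_onI)
  define J where "J = (LINT t|lborel. indicator {0..1} t *\<^sub>R norm (F' t))"
  have JI: "integrable lborel (\<lambda>t. indicator {0..1} t *\<^sub>R norm (F' t))"
    by (rule borel_integrable_compact) (auto intro!: continuous_on_norm continuous_on_subset[OF cont])
  have diff: "norm (F y - F x) \<le> J" if "0 \<le> x" "x \<le> y" "y \<le> 1" for x y
  proof -
    have eq: "(LINT t|lborel. indicator {x..y} t *\<^sub>R F' t) = F y - F x"
      by (rule integral_FTC_atLeastAtMost)
        (use that der in \<open>auto intro: has_vector_derivative_at_within continuous_on_subset[OF cont]\<close>)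
    have "norm (F y - F x) \<le> (LINT t|lborel. norm (indicator {x..y} t *\<^sub>R F' t))"
      unfolding eq[symmetric] by (rule integral_norm_bound)
    also have "\<dots> \<le> J"
      unfolding J_def
    proof (rule integral_mono[OF _ JI])
      show "integrable lborel (\<lambda>t. norm (indicator {x..y} t *\<^sub>R F' t))"
        by (intro integrable_norm borel_integrable_compact) (auto intro!: continuous_on_subset[OF cont])
      show "norm (indicator {x..y} t *\<^sub>R F' t) \<le> indicator {0..1} t *\<^sub>R norm (F' t)" for t
        using that by (auto simp: indicator_def)
    qed
    finally show ?thesis .
  qed
  have J: "ennreal J = (\<integral>\<^sup>+t\<in>{0..<1}. ennreal (norm (F' t)) \<partial>lborel)"
  proof -
    have "ennreal J = (\<integral>\<^sup>+t. ennreal (indicator {0..1} t *\<^sub>R norm (F' t)) \<partial>lborel)"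
      unfolding J_def by (rule nn_integral_eq_integral[symmetric, OF JI]) auto
    also have "\<dots> = (\<integral>\<^sup>+t\<in>{0..1}. ennreal (norm (F' t)) \<partial>lborel)"
      by (intro nn_integral_cong) (auto simp: indicator_def)
    finally show ?thesis by (simp only: nn_integral_Icc_Ico)
  qed
  have J0: "J \<ge> 0"
    unfolding J_def by (intro Bochner_Integration.integral_nonneg) auto
  have point: "norm (F a) \<le> norm (F t) + J" if t: "t \<in> {0..<1}" for t
  proof -
    have "norm (F a - F t) \<le> J"
      using diff[of t a] diff[of a t] a t by (cases "t \<le> a") (auto simp: norm_minus_commute)
    then show ?thesis
      using norm_triangle_ineq[of "F t" "F a - F t"] by simp
  qed
  have "ennreal (norm (F a)) = (\<integral>\<^sup>+t\<in>{0..<1::real}. ennreal (norm (F a)) \<partial>lborel)"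
    by (subst nn_integral_cmult_indicator) auto
  also have "\<dots> \<le> (\<integral>\<^sup>+t. ennreal (norm (F t)) * indicator {0..<1} t + ennreal J * indicator {0..<1} t \<partial>lborel)"
  proof (rule nn_integral_mono)
    fix t :: real
    show "ennreal (norm (F a)) * indicator {0..<1} t \<le> ennreal (norm (F t)) * indicator {0..<1} t + ennreal J * indicator {0..<1} t"
    proof (cases "t \<in> {0..<1}")
      case True
      then have "ennreal (norm (F a)) \<le> ennreal (norm (F t) + J)"
        by (intro ennreal_leI point)
      then show ?thesis
        using True J0 by simp
    qed simp
  qed
  also have "\<dots> = (\<integral>\<^sup>+t\<in>{0..<1}. ennreal (norm (F t)) \<partial>lborel) + ennreal J"
    by (subst nn_integral_add) (auto simp: nn_integral_cmult_indicator)
  also have "\<dots> = (\<integral>\<^sup>+t. ennreal (norm (F t)) * indicator {0..<1} t + ennreal (norm (F' t)) * indicator {0..<1} t \<partial>lborel)"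
    unfolding J by (subst nn_integral_add) auto
  also have "\<dots> = (\<integral>\<^sup>+t\<in>{0..<1}. ennreal (norm (F t) + norm (F' t)) \<partial>lborel)"
    by (intro nn_integral_cong) (auto simp: indicator_def)
  finally show ?thesis .
qed

definition has_partial :: "2 \<Rightarrow> (real^2 \<Rightarrow> complex) \<Rightarrow> (real^2 \<Rightarrow> complex) \<Rightarrow> bool" where
  "has_partial j f f' \<longleftrightarrow> continuous_on UNIV f' \<and>
     (\<forall>x s. ((\<lambda>t. f (x + t *\<^sub>R axis j 1)) has_vector_derivative f' (x + s *\<^sub>R axis j 1)) (at s))"

lemma vec2_line: "vec2 a b = vec2 0 b + a *\<^sub>R axis 1 1" "vec2 a b = vec2 a 0 + b *\<^sub>R axis 2 1"
  by (simp_all add: vec_eq_iff forall_2 axis_def)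

text \<open>Gagliardo's argument: slices in the first direction bound |g| by a function
  \<open>A\<close> of \<open>b\<close> alone, slices in the second by a function \<open>B\<close> of
  \<open>a\<close> alone, and the integral of the product \<open>A b * B a\<close>
  factorises.\<close>

lemma L2_le_L1_derivative:
  assumes g: "continuous_on UNIV g" "has_partial 1 g g1" "has_partial 2 g g2"
  shows "(LINT x|torus. (norm (g x))\<^sup>2) \<le>
    (LINT x|torus. norm (g x) + norm (g1 x)) * (LINT x|torus. norm (g x) + norm (g2 x))"
proof -
  have c: "continuous_on UNIV g1" "continuous_on UNIV g2"
    and d1: "\<And>x s. ((\<lambda>t. g (x + t *\<^sub>R axis 1 1)) has_vector_derivative g1 (x + s *\<^sub>R axis 1 1)) (at s)"
    and d2: "\<And>x s. ((\<lambda>t. g (x + t *\<^sub>R axis 2 1)) has_vector_derivative g2 (x + s *\<^sub>R axis 2 1)) (at s)"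
    using g(2,3) unfolding has_partial_def by blast+
  have gb [measurable]: "g \<in> borel_measurable borel" "g1 \<in> borel_measurable borel" "g2 \<in> borel_measurable borel"
    using g(1) c by (auto intro: borel_measurable_continuous_onI)
  define A where "A = (\<lambda>b. \<integral>\<^sup>+t\<in>{0..<1}. ennreal (norm (g (vec2 t b)) + norm (g1 (vec2 t b))) \<partial>lborel)"
  define B where "B = (\<lambda>a. \<integral>\<^sup>+t\<in>{0..<1}. ennreal (norm (g (vec2 a t)) + norm (g2 (vec2 a t))) \<partial>lborel)"
  have A: "ennreal (norm (g (vec2 a b))) \<le> A b" if "a \<in> {0..<1}" for a b
    unfolding A_def
  proof (rule sup_le_nn_integral_derivative[OF _ _ that])
    show "((\<lambda>t. g (vec2 t b)) has_vector_derivative g1 (vec2 t b)) (at t)" for t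
      using d1[of "vec2 0 b" t] by (simp flip: vec2_line)
    show "continuous_on UNIV (\<lambda>t. g1 (vec2 t b))"
    proof (rule continuous_on_compose2[OF c(1)])
      have "continuous_on UNIV (\<lambda>t. vec2 0 b + t *\<^sub>R axis 1 1)"
        by (intro continuous_intros)
      then show "continuous_on UNIV (\<lambda>t. vec2 t b)"
        by (simp flip: vec2_line)
    qed simp
  qed
  have B: "ennreal (norm (g (vec2 a b))) \<le> B a" if "b \<in> {0..<1}" for a b
    unfolding B_def
  proof (rule sup_le_nn_integral_derivative[OF _ _ that])
    show "((\<lambda>t. g (vec2 a t)) has_vector_derivative g2 (vec2 a t)) (at t)" for t
      using d2[of "vec2 a 0" t] by (simp flip: vec2_line)
    show "continuous_on UNIV (\<lambda>t. g2 (vec2 a t))"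
    proof (rule continuous_on_compose2[OF c(2)])
      have "continuous_on UNIV (\<lambda>t. vec2 a 0 + t *\<^sub>R axis 2 1)"
        by (intro continuous_intros)
      then show "continuous_on UNIV (\<lambda>t. vec2 a t)"
        by (simp flip: vec2_line)
    qed simp
  qed
  have v: "(\<lambda>z. vec2 (fst z) (snd z)) \<in> measurable (lborel \<Otimes>\<^sub>M lborel) borel"
    "(\<lambda>z. vec2 (snd z) (fst z)) \<in> measurable (lborel \<Otimes>\<^sub>M lborel) borel"
    by measurable
  have gm [measurable]: "(\<lambda>z. g (vec2 (fst z) (snd z))) \<in> borel_measurable (lborel \<Otimes>\<^sub>M lborel)"
    "(\<lambda>z. g1 (vec2 (fst z) (snd z))) \<in> borel_measurable (lborel \<Otimes>\<^sub>M lborel)"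
    "(\<lambda>z. g2 (vec2 (fst z) (snd z))) \<in> borel_measurable (lborel \<Otimes>\<^sub>M lborel)"
    "(\<lambda>z. g (vec2 (snd z) (fst z))) \<in> borel_measurable (lborel \<Otimes>\<^sub>M lborel)"
    "(\<lambda>z. g1 (vec2 (snd z) (fst z))) \<in> borel_measurable (lborel \<Otimes>\<^sub>M lborel)"
    by (rule measurable_compose[OF v(1) gb(1)] measurable_compose[OF v(1) gb(2)] measurable_compose[OF v(1) gb(3)]
        measurable_compose[OF v(2) gb(1)] measurable_compose[OF v(2) gb(2)])+
  have Am [measurable]: "A \<in> borel_measurable lborel"
    unfolding A_def using gm
    by (intro lborel.borel_measurable_nn_integral) (simp add: split_beta, measurable)
  have Bm [measurable]: "B \<in> borel_measurable lborel"
    unfolding B_def using gm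
    by (intro lborel.borel_measurable_nn_integral) (simp add: split_beta, measurable)
  have "ennreal (LINT x|torus. (norm (g x))\<^sup>2) = (\<integral>\<^sup>+x. ennreal ((norm (g x))\<^sup>2) \<partial>torus)"
    by (intro nn_integral_eq_integral[symmetric] integrable_torus_continuous continuous_intros g) auto
  also have "\<dots> = (\<integral>\<^sup>+a\<in>{0..<1}. (\<integral>\<^sup>+b\<in>{0..<1}. ennreal ((norm (g (vec2 a b)))\<^sup>2) \<partial>lborel) \<partial>lborel)"
    by (rule nn_integral_torus) measurable
  also have "\<dots> \<le> (\<integral>\<^sup>+a\<in>{0..<1}. (\<integral>\<^sup>+b\<in>{0..<1}. A b * B a \<partial>lborel) \<partial>lborel)"
  proof (rule nn_integral_mono)
    fix a :: real
    show "(\<integral>\<^sup>+b\<in>{0..<1}. ennreal ((norm (g (vec2 a b)))\<^sup>2) \<partial>lborel) * indicator {0..<1} a \<le>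
      (\<integral>\<^sup>+b\<in>{0..<1}. A b * B a \<partial>lborel) * indicator {0..<1} a"
    proof (cases "a \<in> {0..<1}")
      case True
      have "(\<integral>\<^sup>+b\<in>{0..<1}. ennreal ((norm (g (vec2 a b)))\<^sup>2) \<partial>lborel) \<le> (\<integral>\<^sup>+b\<in>{0..<1}. A b * B a \<partial>lborel)"
      proof (rule nn_integral_mono)
        fix b :: real
        have "ennreal ((norm (g (vec2 a b)))\<^sup>2) \<le> A b * B a" if "b \<in> {0..<1}"
          unfolding power2_eq_square ennreal_mult[OF norm_ge_zero norm_ge_zero]
          by (intro mult_mono A B True that) auto
        then show "ennreal ((norm (g (vec2 a b)))\<^sup>2) * indicator {0..<1} b \<le> A b * B a * indicator {0..<1} b"
          by (auto simp: indicator_def)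
      qed
      then show ?thesis using True by simp
    qed simp
  qed
  also have "\<dots> = (\<integral>\<^sup>+a. (\<integral>\<^sup>+b. A b * indicator {0..<1} b \<partial>lborel) * (B a * indicator {0..<1} a) \<partial>lborel)"
  proof (rule nn_integral_cong)
    fix a :: real
    have "(\<integral>\<^sup>+b. A b * B a * indicator {0..<1} b \<partial>lborel) = (\<integral>\<^sup>+b. (A b * indicator {0..<1} b) * B a \<partial>lborel)"
      by (simp add: mult_ac)
    also have "\<dots> = (\<integral>\<^sup>+b. A b * indicator {0..<1} b \<partial>lborel) * B a"
      by (rule nn_integral_multc) measurable
    finally show "(\<integral>\<^sup>+b. A b * B a * indicator {0..<1} b \<partial>lborel) * indicator {0..<1} a =
       (\<integral>\<^sup>+b. A b * indicator {0..<1} b \<partial>lborel) * (B a * indicator {0..<1} a)"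
      by (simp add: mult.assoc)
  qed
  also have "\<dots> = (\<integral>\<^sup>+b\<in>{0..<1}. A b \<partial>lborel) * (\<integral>\<^sup>+a\<in>{0..<1}. B a \<partial>lborel)"
    by (rule nn_integral_cmult) measurable
  also have "(\<integral>\<^sup>+a\<in>{0..<1}. B a \<partial>lborel) = (\<integral>\<^sup>+x. ennreal (norm (g x) + norm (g2 x)) \<partial>torus)"
    unfolding B_def by (rule nn_integral_torus[symmetric]) measurable
  also have "(\<integral>\<^sup>+b\<in>{0..<1}. A b \<partial>lborel) = (\<integral>\<^sup>+x. ennreal (norm (g x) + norm (g1 x)) \<partial>torus)"
  proof -
    let ?h = "\<lambda>a b. ennreal (norm (g (vec2 a b)) + norm (g1 (vec2 a b))) * indicator {0..<1} a * indicator {0..<1::real} b"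
    have "(\<integral>\<^sup>+b\<in>{0..<1}. A b \<partial>lborel) = (\<integral>\<^sup>+b. \<integral>\<^sup>+a. ?h a b \<partial>lborel \<partial>lborel)"
      unfolding A_def by (intro nn_integral_cong) (auto simp: indicator_def)
    also have "\<dots> = (\<integral>\<^sup>+a. \<integral>\<^sup>+b. ?h a b \<partial>lborel \<partial>lborel)"
      using gm by (intro lborel_pair.Fubini') (simp add: split_beta, measurable)
    also have "\<dots> = (\<integral>\<^sup>+a\<in>{0..<1}. (\<integral>\<^sup>+b\<in>{0..<1}. ennreal (norm (g (vec2 a b)) + norm (g1 (vec2 a b))) \<partial>lborel) \<partial>lborel)"
      by (intro nn_integral_cong) (auto simp: indicator_def)
    also have "\<dots> = (\<integral>\<^sup>+x. ennreal (norm (g x) + norm (g1 x)) \<partial>torus)"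
      by (rule nn_integral_torus[symmetric]) measurable
    finally show ?thesis .
  qed
  also have "(\<integral>\<^sup>+x. ennreal (norm (g x) + norm (g1 x)) \<partial>torus) = ennreal (LINT x|torus. norm (g x) + norm (g1 x))"
    by (intro nn_integral_eq_integral integrable_torus_continuous continuous_intros g c) auto
  also have "(\<integral>\<^sup>+x. ennreal (norm (g x) + norm (g2 x)) \<partial>torus) = ennreal (LINT x|torus. norm (g x) + norm (g2 x))"
    by (intro nn_integral_eq_integral integrable_torus_continuous continuous_intros g c) auto
  also have "ennreal (LINT x|torus. norm (g x) + norm (g1 x)) * ennreal (LINT x|torus. norm (g x) + norm (g2 x)) =
     ennreal ((LINT x|torus. norm (g x) + norm (g1 x)) * (LINT x|torus. norm (g x) + norm (g2 x)))"
    by (intro ennreal_mult[symmetric] Bochner_Integration.integral_nonneg) auto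
  finally show ?thesis
    by (subst (asm) ennreal_le_iff) (auto intro!: mult_nonneg_nonneg Bochner_Integration.integral_nonneg)
qed

text \<open>The previous estimate applied to \<open>P\<^sup>3\<close>; the derivative \<open>3 P\<^sup>2 \<partial>P\<close> is paired by Hoelder with exponents
  \<open>6, 6, 3/2\<close>, and the resulting power of \<open>\<parallel>P\<parallel>\<^sub>6\<close> is absorbed into the left-hand side.\<close>

lemma gagliardo_nirenberg:
  assumes P: "continuous_on UNIV P" "has_partial 1 P P1" "has_partial 2 P P2"
    and H: "H > 0" "(LINT x|torus. norm (P x) powr (3 / 2)) \<le> H"
      "(LINT x|torus. norm (P1 x) powr (3 / 2)) \<le> H" "(LINT x|torus. norm (P2 x) powr (3 / 2)) \<le> H"
  shows "(LINT x|torus. norm (P x) ^ 6) \<le> 4096 * H ^ 4"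
\<comment> \<open>The absorption divides by a power of the left-hand side, so its vanishing is set
  apart.\<close>
proof (cases "(LINT x|torus. norm (P x) ^ 6) = 0")
  case True
  then show ?thesis using H(1) by simp
next
  case False
  define X where "X = (LINT x|torus. norm (P x) ^ 6)"
  have "X \<ge> 0" unfolding X_def by (intro Bochner_Integration.integral_nonneg) auto
  then have X: "X > 0" using False unfolding X_def by linarith
  define A where "A = X powr (1 / 6)"
  have A: "A > 0" using X by (simp add: A_def)
  have A6: "X = A ^ 6" using X by (simp add: A_def powr_powr flip: powr_numeral)
  define C where "C = H powr (2 / 3)"
  have C: "C > 0" using H by (simp add: C_def)
  have C32: "C powr (3 / 2) = H" using H by (simp add: C_def powr_powr)
  have C6: "C ^ 6 = H ^ 4" using H by (simp add: C_def powr_powr flip: powr_numeral)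
  have c: "continuous_on UNIV P1" "continuous_on UNIV P2"
    using P(2,3) unfolding has_partial_def by blast+
  have hol: "(LINT x|torus. (norm (P x))\<^sup>2 * norm (Q x)) \<le> A * A * C"
    if Q: "continuous_on UNIV Q" "(LINT x|torus. norm (Q x) powr (3 / 2)) \<le> H" for Q :: "real^2 \<Rightarrow> complex"
  proof -
    have "(LINT x|torus. \<bar>norm (P x) * norm (P x) * norm (Q x)\<bar>) \<le> A * A * C"
    proof (rule holder_6_6_three_halves)
      show "integrable torus (\<lambda>x. \<bar>norm (Q x)\<bar> powr (3 / 2))"
        using Lp_continuous[OF Q(1), of "3/2"] by (simp add: Lp_def)
      show "(LINT x|torus. \<bar>norm (Q x)\<bar> powr (3 / 2)) \<le> C powr (3 / 2)"
        using Q(2) by (simp add: C32)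
      show "(LINT x|torus. \<bar>norm (P x)\<bar> ^ 6) \<le> A ^ 6" "(LINT x|torus. \<bar>norm (P x)\<bar> ^ 6) \<le> A ^ 6"
        using A6 by (simp_all add: X_def)
    qed (auto intro!: borel_measurable_torus_continuous integrable_torus_continuous continuous_intros A C P Q)
    then show ?thesis by (simp add: power2_eq_square)
  qed
  have part: "has_partial j (\<lambda>x. P x ^ 3) (\<lambda>x. 3 * P x ^ 2 * Q x)" if Q: "has_partial j P Q" for j Q
    unfolding has_partial_def
  proof (intro conjI allI)
    have cQ: "continuous_on UNIV Q" using Q unfolding has_partial_def by blast
    show "continuous_on UNIV (\<lambda>x. 3 * P x ^ 2 * Q x)"
      by (intro continuous_intros P cQ)
    fix x s
    have d: "((\<lambda>t. P (x + t *\<^sub>R axis j 1)) has_vector_derivative Q (x + s *\<^sub>R axis j 1)) (at s)"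
      using Q unfolding has_partial_def by blast
    show "((\<lambda>t. P (x + t *\<^sub>R axis j 1) ^ 3) has_vector_derivative
        3 * P (x + s *\<^sub>R axis j 1) ^ 2 * Q (x + s *\<^sub>R axis j 1)) (at s)"
      using has_vector_derivative_mult[OF has_vector_derivative_mult[OF d d] d]
      by (simp add: power3_eq_cube power2_eq_square algebra_simps)
  qed
  \<comment> \<open>The 4 is 1 + 3: one for \<open>P ^ 3\<close> itself, read as the square of
    \<open>P\<close> times \<open>P\<close>, and three for the factor in its derivative.\<close>
  have bound: "(LINT x|torus. norm (P x ^ 3) + norm (3 * P x ^ 2 * Q x)) \<le> 4 * (A * A * C)"
    if Q: "continuous_on UNIV Q" "(LINT x|torus. norm (Q x) powr (3 / 2)) \<le> H" for Q
  proof -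
    have "(LINT x|torus. norm (P x ^ 3) + norm (3 * P x ^ 2 * Q x)) =
      (LINT x|torus. (norm (P x))\<^sup>2 * norm (P x) + 3 * ((norm (P x))\<^sup>2 * norm (Q x)))"
      by (intro Bochner_Integration.integral_cong) (auto simp: norm_mult norm_power power2_eq_square power3_eq_cube)
    also have "\<dots> = (LINT x|torus. (norm (P x))\<^sup>2 * norm (P x)) + 3 * (LINT x|torus. (norm (P x))\<^sup>2 * norm (Q x))"
      by (subst Bochner_Integration.integral_add) (auto intro!: integrable_torus_continuous continuous_intros P Q)
    also have "\<dots> \<le> A * A * C + 3 * (A * A * C)"
      by (intro add_mono mult_left_mono hol P H Q) auto
    finally show ?thesis by simp
  qed
  have "X = (LINT x|torus. (norm (P x ^ 3))\<^sup>2)"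
    unfolding X_def by (intro Bochner_Integration.integral_cong) (auto simp: norm_power simp flip: power_mult)
  also have "\<dots> \<le> (LINT x|torus. norm (P x ^ 3) + norm (3 * P x ^ 2 * P1 x)) * (LINT x|torus. norm (P x ^ 3) + norm (3 * P x ^ 2 * P2 x))"
    by (intro L2_le_L1_derivative part P continuous_intros)
  also have "\<dots> \<le> (4 * (A * A * C)) * (4 * (A * A * C))"
    by (intro mult_mono bound c H) (use A C in \<open>auto intro!: Bochner_Integration.integral_nonneg\<close>)
  \<comment> \<open>Cancelling leaves \<open>A\<close> at most \<open>4 * C\<close>; the sixth power
    of 4 is the constant 4096, and \<open>C ^ 6 = H ^ 4\<close>.\<close>
  finally have "A ^ 4 * A\<^sup>2 \<le> A ^ 4 * (4 * C)\<^sup>2"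
    unfolding A6 by (simp add: power2_eq_square eval_nat_numeral algebra_simps)
  then have "A\<^sup>2 \<le> (4 * C)\<^sup>2"
    using A by (simp only: mult_le_cancel_left_pos zero_less_power)
  then have "(A\<^sup>2) ^ 3 \<le> ((4 * C)\<^sup>2) ^ 3"
    by (rule power_mono[OF _ zero_le_power2])
  then have "A ^ 6 \<le> 4096 * C ^ 6"
    by (simp add: power_mult_distrib flip: power_mult)
  then show ?thesis
    by (simp add: A6[symmetric, unfolded X_def] C6)
qed

subsection \<open>Trigonometric test functions\<close>

lemma partial_eq: "(f has_derivative D) (at x) \<Longrightarrow> partial j f x = D (axis j 1)"
  unfolding partial_def using frechet_derivative_at by metis

text \<open>Closed under products by construction, so that half the squared modulus of a truncation
  is a test function without computing its frequencies.\<close>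

inductive trig_poly :: "(real^2 \<Rightarrow> real) \<Rightarrow> bool" where
  const: "trig_poly (\<lambda>_. c)"
| cos: "trig_poly (\<lambda>x. cos (2 * pi * (lattice_vec \<alpha> \<bullet> x)))"
| sin: "trig_poly (\<lambda>x. sin (2 * pi * (lattice_vec \<alpha> \<bullet> x)))"
| add: "trig_poly f \<Longrightarrow> trig_poly g \<Longrightarrow> trig_poly (\<lambda>x. f x + g x)"
| mult: "trig_poly f \<Longrightarrow> trig_poly g \<Longrightarrow> trig_poly (\<lambda>x. f x * g x)"

lemma inner_lattice_vec_axis: "lattice_vec \<alpha> \<bullet> axis j 1 = of_int (\<alpha> $ j)"
  by (simp add: inner_axis)

lemma partial_cos: "partial j (\<lambda>x. cos (2 * pi * (lattice_vec \<alpha> \<bullet> x))) x =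
    - (2 * pi * of_int (\<alpha> $ j)) * sin (2 * pi * (lattice_vec \<alpha> \<bullet> x))"
proof -
  have "((\<lambda>x. cos (2 * pi * (lattice_vec \<alpha> \<bullet> x))) has_derivative
      (\<lambda>h. - (2 * pi * (lattice_vec \<alpha> \<bullet> h)) * sin (2 * pi * (lattice_vec \<alpha> \<bullet> x)))) (at x)"
    by (auto intro!: derivative_eq_intros)
  from partial_eq[OF this, of j] show ?thesis
    by (simp add: inner_lattice_vec_axis)
qed

lemma partial_sin: "partial j (\<lambda>x. sin (2 * pi * (lattice_vec \<alpha> \<bullet> x))) x =
    (2 * pi * of_int (\<alpha> $ j)) * cos (2 * pi * (lattice_vec \<alpha> \<bullet> x))"
proof -
  have "((\<lambda>x. sin (2 * pi * (lattice_vec \<alpha> \<bullet> x))) has_derivative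
      (\<lambda>h. (2 * pi * (lattice_vec \<alpha> \<bullet> h)) * cos (2 * pi * (lattice_vec \<alpha> \<bullet> x)))) (at x)"
    by (auto intro!: derivative_eq_intros)
  from partial_eq[OF this, of j] show ?thesis
    by (simp add: inner_lattice_vec_axis)
qed

lemma partial_add:
  assumes "f differentiable (at x)" "g differentiable (at x)"
  shows "partial j (\<lambda>x. f x + g x) x = partial j f x + partial j g x"
  using assms partial_eq[OF has_derivative_add] unfolding partial_def frechet_derivative_works by blast

lemma partial_mult:
  assumes "f differentiable (at x)" "g differentiable (at x)"
  shows "partial j (\<lambda>x. f x * g x) x = f x * partial j g x + partial j f x * g x"
  using assms partial_eq[OF has_derivative_mult] unfolding partial_def frechet_derivative_works by blast

text \<open>Both claims go through one induction: the sum and product rules for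
  \<open>partial\<close> presuppose differentiability of the parts.\<close>

lemma trig_poly_partial:
  assumes "trig_poly f"
  shows "f differentiable (at x)" "trig_poly (partial j f)"
proof -
  have "(\<forall>x. f differentiable (at x)) \<and> trig_poly (partial j f)"
    using assms
  proof induction
    case (const c)
    have "partial j (\<lambda>_. c) = (\<lambda>_. 0)"
      by (rule ext, subst partial_eq[OF has_derivative_const]) simp
    then show ?case by (auto intro: trig_poly.intros)
  next
    case (cos \<alpha>)
    have "trig_poly (\<lambda>x. - (2 * pi * of_int (\<alpha> $ j)) * sin (2 * pi * (lattice_vec \<alpha> \<bullet> x)))"
      by (intro trig_poly.intros)
    then show ?case
      unfolding partial_cos[abs_def]
      by (auto simp: differentiable_def intro!: exI derivative_eq_intros)
  next
    case (sin \<alpha>)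
    have "trig_poly (\<lambda>x. (2 * pi * of_int (\<alpha> $ j)) * cos (2 * pi * (lattice_vec \<alpha> \<bullet> x)))"
      by (intro trig_poly.intros)
    then show ?case
      unfolding partial_sin[abs_def]
      by (auto simp: differentiable_def intro!: exI derivative_eq_intros)
  next
    case (add f g)
    then have "partial j (\<lambda>x. f x + g x) = (\<lambda>x. partial j f x + partial j g x)"
      by (intro ext partial_add) auto
    then show ?case
      using add by (auto intro: trig_poly.intros)
  next
    case (mult f g)
    then have "partial j (\<lambda>x. f x * g x) = (\<lambda>x. f x * partial j g x + partial j f x * g x)"
      by (intro ext partial_mult) auto
    then show ?case
      using mult by (auto intro!: trig_poly.intros)
  qed
  then show "f differentiable (at x)" "trig_poly (partial j f)" by auto
qed

lemma trig_poly_continuous: "trig_poly f \<Longrightarrow> continuous_on S f"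
  by (intro continuous_at_imp_continuous_on ballI differentiable_imp_continuous_within trig_poly_partial)

lemma trig_poly_smooth: "trig_poly f \<Longrightarrow> smooth f"
proof -
  have "trig_poly f \<Longrightarrow> C_k k f" for k
    by (induction k arbitrary: f) (auto intro: trig_poly_continuous trig_poly_partial)
  then show "trig_poly f \<Longrightarrow> smooth f" by (simp add: smooth_def)
qed

lemma trig_poly_periodic: "trig_poly f \<Longrightarrow> torus_periodic f"
  unfolding torus_periodic_def
proof (induction rule: trig_poly.induct)
  case (cos \<alpha>)
  then show ?case using char_periodic[of \<alpha>] by (auto simp: char_def complex_eq_iff)
next
  case (sin \<alpha>)
  then show ?case using char_periodic[of \<alpha>] by (auto simp: char_def complex_eq_iff)
qed auto

lemma trig_poly_sum:
  "(\<And>i. i \<in> I \<Longrightarrow> trig_poly (f i)) \<Longrightarrow> trig_poly (\<lambda>x. \<Sum>i\<in>I. f i x)"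
  by (induction I rule: infinite_finite_induct) (auto intro: trig_poly.intros)

subsection \<open>Truncations and weak derivatives\<close>

lemma fourier_coeff_LP_trunc:
  assumes \<psi>: "LP_cutoff \<psi>"
  shows "fourier_coeff (LP_trunc \<psi> q f) \<alpha> =
    of_real (\<psi> (inverse (freq q) *\<^sub>R lattice_vec \<alpha>)) * fourier_coeff f \<alpha>"
proof -
  have "fourier_coeff (LP_trunc \<psi> q f) \<alpha> = (if \<alpha> \<in> freq_box (2 ^ q) then
      of_real (\<psi> (inverse (freq q) *\<^sub>R lattice_vec \<alpha>)) * fourier_coeff f \<alpha> else 0)"
    unfolding LP_trunc_eq_sum[OF \<psi>, abs_def] by (rule fourier_coeff_trig[OF freq_box(1)])
  then show ?thesis
    using cutoff_support[OF \<psi>, of q] by auto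
qed

lemma fourier_coeff_diff:
  assumes "integrable torus f" "integrable torus g"
  shows "fourier_coeff (\<lambda>x. f x - g x) \<alpha> = fourier_coeff f \<alpha> - fourier_coeff g \<alpha>"
  using assms by (simp add: fourier_coeff_eq right_diff_distrib integrable_char_mult)

text \<open>Frequencies that survive at level \<open>m\<close> have modulus below
  \<open>2 ^ m\<close>, which is at most half of \<open>2 ^ q\<close>; there the cutoff of level
  \<open>q\<close> equals 1.\<close>

lemma LP_trunc_LP_trunc:
  assumes \<psi>: "LP_cutoff \<psi>" and mq: "m < q"
  shows "LP_trunc \<psi> q (LP_trunc \<psi> m f) = LP_trunc \<psi> m f"
proof
  fix x
  let ?c = "\<lambda>q \<alpha>. complex_of_real (\<psi> (inverse (freq q) *\<^sub>R lattice_vec \<alpha>))"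
  have one: "?c q \<alpha> = 1" if "?c m \<alpha> \<noteq> 0" for \<alpha>
  proof -
    have "\<psi> (inverse (freq m) *\<^sub>R lattice_vec \<alpha>) \<noteq> 0" using that by simp
    then have "inverse (freq m) *\<^sub>R lattice_vec \<alpha> \<in> ball 0 1"
      using closure_subset[of "{\<xi>. \<psi> \<xi> \<noteq> 0}"] LP_cutoffD(2)[OF \<psi>] by auto
    then have "norm (lattice_vec \<alpha>) < 2 ^ m"
      by (simp add: freq_def field_simps)
    moreover have "2 * (2 ^ m :: real) \<le> 2 ^ q"
      using mq power_increasing[of "Suc m" q "2::real"] by simp
    ultimately have "norm (inverse (freq q) *\<^sub>R lattice_vec \<alpha>) \<le> 1 / 2"
      by (simp add: freq_def field_simps)
    then show ?thesis using LP_cutoffD(4)[OF \<psi>] by simp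
  qed
  have "LP_trunc \<psi> q (LP_trunc \<psi> m f) x = (\<Sum>\<alpha>\<in>freq_box (2 ^ q). ?c m \<alpha> * fourier_coeff f \<alpha> * char \<alpha> x)"
    unfolding LP_trunc_eq_sum[OF \<psi>, of q] fourier_coeff_LP_trunc[OF \<psi>]
    by (intro sum.cong refl) (use one in \<open>auto simp: mult_ac\<close>)
  also have "\<dots> = (\<Sum>\<alpha>\<in>freq_box (2 ^ m). ?c m \<alpha> * fourier_coeff f \<alpha> * char \<alpha> x)"
    using cutoff_support[OF \<psi>, of m] mq
    by (intro sum.mono_neutral_right freq_box freq_box_mono) auto
  finally show "LP_trunc \<psi> q (LP_trunc \<psi> m f) x = LP_trunc \<psi> m f x"
    by (simp add: LP_trunc_eq_sum[OF \<psi>])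
qed

text \<open>The pairing is bilinear, without a conjugate, so the frequency \<alpha> meets its
  opposite.\<close>

lemma LP_trunc_pairing:
  assumes \<psi>: "LP_cutoff \<psi>" and g: "integrable torus g"
  shows "(LINT x|torus. LP_trunc \<psi> q f x * g x) =
    (\<Sum>\<alpha>\<in>freq_box (2 ^ q). of_real (\<psi> (inverse (freq q) *\<^sub>R lattice_vec \<alpha>)) * fourier_coeff f \<alpha> * fourier_coeff g (- \<alpha>))"
proof -
  let ?c = "\<lambda>\<alpha>. complex_of_real (\<psi> (inverse (freq q) *\<^sub>R lattice_vec \<alpha>)) * fourier_coeff f \<alpha>"
  have "(LINT x|torus. LP_trunc \<psi> q f x * g x) = (LINT x|torus. (\<Sum>\<alpha>\<in>freq_box (2 ^ q). ?c \<alpha> * (char \<alpha> x * g x)))"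
    by (simp add: LP_trunc_eq_sum[OF \<psi>] sum_distrib_right mult.assoc)
  also have "\<dots> = (\<Sum>\<alpha>\<in>freq_box (2 ^ q). ?c \<alpha> * (LINT x|torus. char \<alpha> x * g x))"
    by (simp only: integral_mult_right_zero Bochner_Integration.integral_sum
        integrable_char_mult[OF g] integrable_mult_right)
  finally show ?thesis
    by (simp add: fourier_coeff_eq char_uminus)
qed

text \<open>Moving the symbol across the pairing evaluates it at the opposite frequency, which
  changes nothing because a radial \<open>\<psi>\<close> is even.\<close>

lemma LP_trunc_self_adjoint:
  assumes \<psi>: "LP_cutoff \<psi>" and g: "integrable torus g"
  shows "(LINT x|torus. LP_trunc \<psi> q f x * LP_trunc \<psi> q g x) = (LINT x|torus. LP_trunc \<psi> q (LP_trunc \<psi> q f) x * g x)"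
proof -
  let ?p = "\<lambda>\<alpha>. complex_of_real (\<psi> (inverse (freq q) *\<^sub>R lattice_vec \<alpha>))"
  have even: "?p (- \<alpha>) = ?p \<alpha>" for \<alpha>
    using LP_cutoffD(3)[OF \<psi>, of "inverse (freq q) *\<^sub>R lattice_vec (- \<alpha>)" "inverse (freq q) *\<^sub>R lattice_vec \<alpha>"]
    by (simp add: lattice_vec_uminus)
  have "(LINT x|torus. LP_trunc \<psi> q f x * LP_trunc \<psi> q g x) =
    (\<Sum>\<alpha>\<in>freq_box (2 ^ q). ?p \<alpha> * fourier_coeff f \<alpha> * (?p (- \<alpha>) * fourier_coeff g (- \<alpha>)))"
    by (simp only: LP_trunc_pairing[OF \<psi> integrable_torus_continuous[OF continuous_LP_trunc[OF \<psi>]]]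
        fourier_coeff_LP_trunc[OF \<psi>])
  also have "\<dots> = (LINT x|torus. LP_trunc \<psi> q (LP_trunc \<psi> q f) x * g x)"
    by (simp only: LP_trunc_pairing[OF \<psi> g] fourier_coeff_LP_trunc[OF \<psi>] even) (simp add: mult_ac)
  finally show ?thesis .
qed

text \<open>The Fourier side of \<open>G\<close> being a derivative of \<open>F\<close>. It is
  inherited by truncations and differences, and for truncations it becomes a classical
  derivative.\<close>

definition coeff_deriv :: "2 \<Rightarrow> (real^2 \<Rightarrow> complex) \<Rightarrow> (real^2 \<Rightarrow> complex) \<Rightarrow> bool" where
  "coeff_deriv j F G \<longleftrightarrow> (\<forall>\<alpha>. fourier_coeff G \<alpha> = 2 * of_real pi * \<i> * of_int (\<alpha> $ j) * fourier_coeff F \<alpha>)"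

lemma coeff_deriv_LP_trunc:
  "LP_cutoff \<psi> \<Longrightarrow> coeff_deriv j F G \<Longrightarrow> coeff_deriv j (LP_trunc \<psi> q F) (LP_trunc \<psi> q G)"
  by (simp add: coeff_deriv_def fourier_coeff_LP_trunc mult_ac)

lemma coeff_deriv_diff:
  assumes "coeff_deriv j F G" "coeff_deriv j F' G'"
    and "integrable torus F" "integrable torus F'" "integrable torus G" "integrable torus G'"
  shows "coeff_deriv j (\<lambda>x. F x - F' x) (\<lambda>x. G x - G' x)"
  using assms by (simp add: coeff_deriv_def fourier_coeff_diff right_diff_distrib)

lemma char_line_derivative:
  "((\<lambda>t. char \<alpha> (x + t *\<^sub>R axis j 1)) has_vector_derivative
     2 * of_real pi * \<i> * of_int (\<alpha> $ j) * char \<alpha> (x + s *\<^sub>R axis j 1)) (at s)"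
proof -
  let ?k = "2 * of_real pi * \<i> * of_int (\<alpha> $ j) :: complex"
  have eq: "char \<alpha> (x + t *\<^sub>R axis j 1) = char \<alpha> x * exp (?k * of_real t)" for t
    by (simp add: char_def inner_add_right inner_lattice_vec_axis distrib_left cis_conv_exp mult_ac flip: exp_add)
  have "((\<lambda>z. char \<alpha> x * exp (?k * z)) has_field_derivative ?k * (char \<alpha> x * exp (?k * of_real s))) (at (of_real s))"
    by (auto intro!: derivative_eq_intros)
  from has_vector_derivative_real_field[OF this] show ?thesis
    by (simp only: eq)
qed

lemma LP_trunc_has_partial:
  assumes \<psi>: "LP_cutoff \<psi>" and FG: "coeff_deriv j F G"
  shows "has_partial j (LP_trunc \<psi> q F) (LP_trunc \<psi> q G)"
  unfolding has_partial_def
proof (intro conjI allI continuous_LP_trunc[OF \<psi>])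
  fix x s
  let ?c = "\<lambda>\<alpha>. complex_of_real (\<psi> (inverse (freq q) *\<^sub>R lattice_vec \<alpha>)) * fourier_coeff F \<alpha>"
  have "((\<lambda>t. \<Sum>\<alpha>\<in>freq_box (2 ^ q). ?c \<alpha> * char \<alpha> (x + t *\<^sub>R axis j 1)) has_vector_derivative
     (\<Sum>\<alpha>\<in>freq_box (2 ^ q). ?c \<alpha> * (2 * of_real pi * \<i> * of_int (\<alpha> $ j) * char \<alpha> (x + s *\<^sub>R axis j 1)))) (at s)"
    by (intro has_vector_derivative_sum has_vector_derivative_mult_right char_line_derivative)
  moreover have "(\<Sum>\<alpha>\<in>freq_box (2 ^ q). ?c \<alpha> * (2 * of_real pi * \<i> * of_int (\<alpha> $ j) * char \<alpha> (x + s *\<^sub>R axis j 1))) =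
     LP_trunc \<psi> q G (x + s *\<^sub>R axis j 1)"
    using FG unfolding LP_trunc_eq_sum[OF \<psi>] coeff_deriv_def by (intro sum.cong) (auto simp: mult_ac)
  ultimately show "((\<lambda>t. LP_trunc \<psi> q F (x + t *\<^sub>R axis j 1)) has_vector_derivative LP_trunc \<psi> q G (x + s *\<^sub>R axis j 1)) (at s)"
    unfolding LP_trunc_eq_sum[OF \<psi>] by simp
qed

section \<open>Weak derivatives and their Fourier coefficients\<close>

lemma integrable_mult_continuous:
  fixes f g :: "real^2 \<Rightarrow> real"
  assumes f: "integrable torus f" and g: "continuous_on UNIV g"
  shows "integrable torus (\<lambda>x. f x * g x)"
proof -
  obtain B where B: "B > 0" "\<And>x. x \<in> cell \<Longrightarrow> norm (g x) \<le> B"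
    using continuous_bounded_cell[OF g] by blast
  have [measurable]: "f \<in> borel_measurable torus" "g \<in> borel_measurable torus"
    using f borel_measurable_torus_continuous[OF g] by auto
  show ?thesis
  proof (rule Bochner_Integration.integrable_bound)
    show "integrable torus (\<lambda>x. B * f x)" using f by simp
    show "AE x in torus. norm (f x * g x) \<le> norm (B * f x)"
    proof (rule AE_I2)
      fix x assume "x \<in> space torus"
      then have "\<bar>f x\<bar> * \<bar>g x\<bar> \<le> \<bar>f x\<bar> * B" using B(2)[of x] by (intro mult_left_mono) auto
      then show "norm (f x * g x) \<le> norm (B * f x)" using B(1) by (simp add: abs_mult mult.commute)
    qed
  qed measurable
qed

lemma torus_L1_integrable:
  fixes f :: "real^2 \<Rightarrow> real"
  assumes "torus_Lp 1 f"
  shows "integrable torus f"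
proof -
  have m: "f \<in> borel_measurable torus" and "integrable torus (\<lambda>x. norm (f x) powr 1)"
    using assms unfolding torus_Lp_def by auto
  then have "integrable torus (\<lambda>x. norm (f x))" by simp
  then show ?thesis by (rule integrable_norm_cancel[OF _ m])
qed

lemma has_weak_partial_trig_poly:
  assumes "has_weak_partial j f g" "trig_poly \<phi>"
  shows "(LINT x|torus. f x * partial j \<phi> x) = - (LINT x|torus. g x * \<phi> x)"
  using assms trig_poly_smooth trig_poly_periodic unfolding has_weak_partial_def by blast

text \<open>Test functions are real, so the character is tested through its cosine and sine parts;
  differentiation exchanges the two, and the results are recombined into the complex
  coefficient.\<close>

lemma has_weak_partial_coeff_deriv:
  assumes w: "has_weak_partial j f g"
  shows "coeff_deriv j (\<lambda>x. of_real (f x)) (\<lambda>x. of_real (g x))"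
  unfolding coeff_deriv_def
proof
  fix \<alpha>
  have int: "integrable torus f" "integrable torus g"
    using w torus_L1_integrable unfolding has_weak_partial_def by auto
  let ?c = "\<lambda>x. cos (2 * pi * (lattice_vec \<alpha> \<bullet> x))" and ?s = "\<lambda>x. sin (2 * pi * (lattice_vec \<alpha> \<bullet> x))"
  have cont: "continuous_on UNIV ?c" "continuous_on UNIV ?s"
    by (intro continuous_intros)+
  have fc: "fourier_coeff (\<lambda>x. of_real (h x)) \<alpha> =
     of_real (LINT x|torus. h x * ?c x) - \<i> * of_real (LINT x|torus. h x * ?s x)" if h: "integrable torus h" for h
  proof -
    have i: "integrable torus (\<lambda>x. complex_of_real (h x * ?c x))" "integrable torus (\<lambda>x. complex_of_real (h x * ?s x))"
      by (intro integrable_of_real integrable_mult_continuous h cont)+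
    have "fourier_coeff (\<lambda>x. of_real (h x)) \<alpha> =
      (LINT x|torus. complex_of_real (h x * ?c x) - \<i> * complex_of_real (h x * ?s x))"
      unfolding fourier_coeff_eq
      by (intro Bochner_Integration.integral_cong refl) (simp add: char_def complex_eq_iff)
    also have "\<dots> = (LINT x|torus. complex_of_real (h x * ?c x)) - \<i> * (LINT x|torus. complex_of_real (h x * ?s x))"
      by (subst Bochner_Integration.integral_diff) (use i in \<open>simp_all only: integral_mult_right_zero integrable_mult_right\<close>)
    finally show ?thesis
      by (simp only: integral_complex_of_real)
  qed
  have "(LINT x|torus. f x * (- (2 * pi * of_int (\<alpha> $ j)) * ?s x)) = - (LINT x|torus. g x * ?c x)"
    using has_weak_partial_trig_poly[OF w trig_poly.cos] by (simp only: partial_cos)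
  moreover have "(LINT x|torus. f x * ((2 * pi * of_int (\<alpha> $ j)) * ?c x)) = - (LINT x|torus. g x * ?s x)"
    using has_weak_partial_trig_poly[OF w trig_poly.sin] by (simp only: partial_sin)
  moreover have "(LINT x|torus. f x * (k * ?s x)) = k * (LINT x|torus. f x * ?s x)"
    "(LINT x|torus. f x * (k * ?c x)) = k * (LINT x|torus. f x * ?c x)" for k
    by (simp_all only: mult.left_commute[of _ k] integral_mult_right_zero)
  ultimately have "(LINT x|torus. g x * ?c x) = 2 * pi * of_int (\<alpha> $ j) * (LINT x|torus. f x * ?s x)"
    "(LINT x|torus. g x * ?s x) = - (2 * pi * of_int (\<alpha> $ j)) * (LINT x|torus. f x * ?c x)"
    by simp_all
  then show "fourier_coeff (\<lambda>x. of_real (g x)) \<alpha> = 2 * of_real pi * \<i> * of_int (\<alpha> $ j) * fourier_coeff (\<lambda>x. of_real (f x)) \<alpha>"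
    by (simp add: fc[OF int(1)] fc[OF int(2)] algebra_simps)
qed

text \<open>All truncations of such an \<open>f\<close> vanish identically, yet they converge to
  \<open>f\<close> in \<open>L^1\<close>.\<close>

lemma fourier_coeff_unique:
  assumes \<psi>: "LP_cutoff \<psi>" and f: "integrable torus f" and 0: "\<And>\<alpha>. fourier_coeff f \<alpha> = 0"
  shows "AE x in torus. f x = 0"
proof -
  have "Lp 1 f" using f by (auto simp: Lp_def)
  then have "(\<lambda>q. LINT x|torus. norm (LP_trunc \<psi> q f x - f x) powr 1) \<longlonglongrightarrow> 0"
    by (intro LP_trunc_tendsto[OF \<psi>]) auto
  moreover have "LP_trunc \<psi> q f x = 0" for q x
    by (simp add: LP_trunc_eq_sum[OF \<psi>] 0)
  ultimately have "(\<lambda>q::nat. LINT x|torus. norm (f x)) \<longlonglongrightarrow> 0"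
    by simp
  then have "(LINT x|torus. norm (f x)) = 0"
    by (simp add: LIMSEQ_const_iff)
  then show ?thesis
    using f by (subst (asm) integral_nonneg_eq_0_iff_AE) auto
qed

lemma weak_partial_unique:
  assumes \<psi>: "LP_cutoff \<psi>" and g: "has_weak_partial j f g" and h: "has_weak_partial j f h"
  shows "AE x in torus. g x = h x"
proof -
  have i: "integrable torus (\<lambda>x. complex_of_real (g x))" "integrable torus (\<lambda>x. complex_of_real (h x))"
    using g h torus_L1_integrable unfolding has_weak_partial_def by (auto intro: integrable_of_real)
  have "AE x in torus. complex_of_real (g x) - complex_of_real (h x) = 0"
    using has_weak_partial_coeff_deriv[OF g] has_weak_partial_coeff_deriv[OF h] i
    by (intro fourier_coeff_unique[OF \<psi>]) (auto simp: fourier_coeff_diff coeff_deriv_def)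
  then show ?thesis by eventually_elim simp
qed

text \<open>\<open>weak_partial\<close> selects some weak derivative, whose definition grants it
  only \<open>L^1\<close>; by uniqueness it agrees almost everywhere with \<open>g\<close>, which is
  of class \<open>L^p\<close>.\<close>

lemma Lp_weak_partial:
  assumes \<psi>: "LP_cutoff \<psi>" and g: "has_weak_partial j f g" "torus_Lp p g"
  shows "has_weak_partial j f (weak_partial j f)" "Lp p (\<lambda>x. of_real (weak_partial j f x))"
proof -
  show w: "has_weak_partial j f (weak_partial j f)"
    unfolding weak_partial_def by (rule someI[of "has_weak_partial j f", OF g(1)])
  have m [measurable]: "weak_partial j f \<in> borel_measurable torus" "g \<in> borel_measurable torus"
    using w g unfolding has_weak_partial_def torus_Lp_def by auto
  have "AE x in torus. norm (g x) powr p = norm (complex_of_real (weak_partial j f x)) powr p"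
    using weak_partial_unique[OF \<psi> g(1) w] by eventually_elim simp
  then have "integrable torus (\<lambda>x. norm (complex_of_real (weak_partial j f x)) powr p)"
    using g(2) unfolding torus_Lp_def by (subst (asm) integrable_cong_AE) auto
  then show "Lp p (\<lambda>x. of_real (weak_partial j f x))"
    by (simp add: Lp_def)
qed

text \<open>The kernel is real: conjugation reflects its argument, and it is even.\<close>

lemma LP_trunc_real:
  assumes \<psi>: "LP_cutoff \<psi>" and h: "integrable torus h"
  shows "LP_trunc \<psi> q (\<lambda>x. of_real (h x)) x = of_real (Re (LP_trunc \<psi> q (\<lambda>x. of_real (h x)) x))"
proof -
  have hc: "integrable torus (\<lambda>x. complex_of_real (h x))" using h by (rule integrable_of_real)
  have K: "cnj (LP_kernel \<psi> q z) = LP_kernel \<psi> q z" for z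
  proof -
    have "cnj (LP_kernel \<psi> q z) = LP_kernel \<psi> q (- z)"
      by (simp add: mult_kernel_def char_def cis_cnj)
    then show ?thesis by (simp add: LP_kernel_minus[OF \<psi>])
  qed
  have "cnj (LP_trunc \<psi> q (\<lambda>x. of_real (h x)) x) = LP_trunc \<psi> q (\<lambda>x. of_real (h x)) x"
    unfolding LP_trunc_eq_kernel[OF \<psi> hc] by (subst Bochner_Integration.integral_cnj[symmetric]) (simp add: K)
  then show ?thesis
    by (metis Reals_cnj_iff of_real_Re)
qed

lemma trig_poly_Re_LP_trunc:
  assumes \<psi>: "LP_cutoff \<psi>"
  shows "trig_poly (\<lambda>x. Re (LP_trunc \<psi> q f x))"
proof -
  let ?c = "\<lambda>\<alpha>. complex_of_real (\<psi> (inverse (freq q) *\<^sub>R lattice_vec \<alpha>)) * fourier_coeff f \<alpha>"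
  have "Re (LP_trunc \<psi> q f x) = (\<Sum>\<alpha>\<in>freq_box (2 ^ q). Re (?c \<alpha>) * cos (2 * pi * (lattice_vec \<alpha> \<bullet> x)) +
      (- Im (?c \<alpha>)) * sin (2 * pi * (lattice_vec \<alpha> \<bullet> x)))" for x
    by (simp add: LP_trunc_eq_sum[OF \<psi>] char_def)
  then show ?thesis
    by (simp only:) (intro trig_poly_sum trig_poly.intros)
qed

text \<open>Along a coordinate line the derivative given by \<open>partial\<close> and the one from
  termwise differentiation of the sum must agree.\<close>

lemma partial_Re_LP_trunc:
  assumes \<psi>: "LP_cutoff \<psi>" and FG: "coeff_deriv j F G"
  shows "partial j (\<lambda>x. Re (LP_trunc \<psi> q F x)) x = Re (LP_trunc \<psi> q G x)"
proof -
  have "((\<lambda>t. LP_trunc \<psi> q F (x + t *\<^sub>R axis j 1)) has_vector_derivative LP_trunc \<psi> q G (x + 0 *\<^sub>R axis j 1)) (at 0)"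
    using LP_trunc_has_partial[OF \<psi> FG] unfolding has_partial_def by blast
  from bounded_linear.has_vector_derivative[OF bounded_linear_Re this]
  have "((\<lambda>t. Re (LP_trunc \<psi> q F (x + t *\<^sub>R axis j 1))) has_vector_derivative Re (LP_trunc \<psi> q G x)) (at 0)"
    by simp
  moreover have "((\<lambda>t. Re (LP_trunc \<psi> q F (x + t *\<^sub>R axis j 1))) has_real_derivative
      partial j (\<lambda>x. Re (LP_trunc \<psi> q F x)) (x + 0 *\<^sub>R axis j 1)) (at 0)"
    by (rule partial_line_derivative) (rule trig_poly_partial[OF trig_poly_Re_LP_trunc[OF \<psi>]])
  ultimately show ?thesis
    by (simp add: has_real_derivative_iff_has_vector_derivative vector_derivative_unique_at)
qed

subsection \<open>The Sobolev embedding\<close>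

lemma LP_trunc_L6:
  assumes \<psi>: "LP_cutoff \<psi>" and FG: "\<And>j. coeff_deriv j F (G j)"
    and H: "H > 0" "(LINT x|torus. norm (LP_trunc \<psi> q F x) powr (3 / 2)) \<le> H"
      "\<And>j. (LINT x|torus. norm (LP_trunc \<psi> q (G j) x) powr (3 / 2)) \<le> H"
  shows "(LINT x|torus. norm (LP_trunc \<psi> q F x) ^ 6) \<le> 4096 * H ^ 4"
  by (rule gagliardo_nirenberg[OF continuous_LP_trunc[OF \<psi>] LP_trunc_has_partial[OF \<psi> FG]
        LP_trunc_has_partial[OF \<psi> FG] H(1,2) H(3) H(3)])

text \<open>The Gagliardo-Nirenberg bound for the truncations is uniform in \<open>q\<close>; along
  a subsequence converging almost everywhere it passes to \<open>F\<close> by Fatou's lemma.\<close>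

lemma sobolev_L6:
  assumes \<psi>: "LP_cutoff \<psi>" and FG: "\<And>j. coeff_deriv j F (G j)"
    and F: "Lp (3 / 2) F" and G: "\<And>j. Lp (3 / 2) (G j)"
  shows "integrable torus (\<lambda>x. norm (F x) ^ 6)"
proof -
  obtain M where M: "M > 0"
    "\<And>p q f. p \<ge> 1 \<Longrightarrow> Lp p f \<Longrightarrow>
      (LINT x|torus. norm (LP_trunc \<psi> q f x) powr p) \<le> M powr p * (LINT x|torus. norm (f x) powr p)"
    by (rule LP_trunc_Lp_bound[OF \<psi>]) (rule that; blast)
  let ?N = "\<lambda>f. LINT x|torus. norm (f x) powr (3 / 2)"
  have N0: "?N f \<ge> 0" for f :: "real^2 \<Rightarrow> complex"
    by (intro Bochner_Integration.integral_nonneg) auto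
  define D where "D = ?N F + (\<Sum>j\<in>UNIV. ?N (G j)) + 1"
  have D: "D > 0" "?N F \<le> D" "\<And>j. ?N (G j) \<le> D"
  proof -
    have s: "(\<Sum>j\<in>UNIV. ?N (G j)) \<ge> 0" using N0 by (intro sum_nonneg) auto
    show "D > 0" "?N F \<le> D" using s N0[of F] unfolding D_def by linarith+
    fix j
    have "?N (G j) \<le> (\<Sum>j\<in>UNIV. ?N (G j))" using N0 by (intro member_le_sum) auto
    then show "?N (G j) \<le> D" using N0[of F] unfolding D_def by linarith
  qed
  define H where "H = M powr (3 / 2) * D"
  have H: "H > 0" using M(1) D(1) by (simp add: H_def)
  have NH: "?N (LP_trunc \<psi> q f) \<le> H" if "Lp (3 / 2) f" "?N f \<le> D" for q f
    using order_trans[OF M(2)[OF _ that(1)] mult_left_mono[OF that(2), of "M powr (3 / 2)"]] by (simp add: H_def)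
  have bound: "(LINT x|torus. norm (LP_trunc \<psi> q F x) ^ 6) \<le> 4096 * H ^ 4" for q
    by (rule LP_trunc_L6[where G = G, OF \<psi> FG H NH[OF F D(2)] NH[OF G D(3)]])
  have Lq: "Lp (3 / 2) (\<lambda>x. LP_trunc \<psi> q F x - F x)" for q
    by (intro Lp_diff LP_trunc_Lp[OF \<psi>] F) auto
  have "(\<lambda>q. LINT x|torus. norm (norm (LP_trunc \<psi> q F x - F x) powr (3 / 2))) \<longlonglongrightarrow> 0"
    using LP_trunc_tendsto[OF \<psi> F] by simp
  then obtain r :: "nat \<Rightarrow> nat" where r: "AE x in torus. (\<lambda>n. norm (LP_trunc \<psi> (r n) F x - F x) powr (3 / 2)) \<longlonglongrightarrow> 0"
    using tendsto_L1_AE_subseq[of torus "\<lambda>q x. norm (LP_trunc \<psi> q F x - F x) powr (3 / 2)"] Lq unfolding Lp_def by blast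
  have Fm [measurable]: "F \<in> borel_measurable torus" using F by (simp add: Lp_def)
  have lim: "AE x in torus. ennreal (norm (F x) ^ 6) = liminf (\<lambda>n. ennreal (norm (LP_trunc \<psi> (r n) F x) ^ 6))"
    using r
  proof eventually_elim
    case (elim x)
    have "(\<lambda>n. (norm (LP_trunc \<psi> (r n) F x - F x) powr (3 / 2)) powr (2 / 3)) \<longlonglongrightarrow> 0"
      by (rule tendsto_zero_powrI[OF elim]) (auto intro!: tendsto_const)
    then have "(\<lambda>n. norm (LP_trunc \<psi> (r n) F x - F x)) \<longlonglongrightarrow> 0"
      by (simp add: powr_powr)
    then have "(\<lambda>n. LP_trunc \<psi> (r n) F x) \<longlonglongrightarrow> F x"
      by (simp add: tendsto_norm_zero_iff LIM_zero_iff)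
    then have "(\<lambda>n. ennreal (norm (LP_trunc \<psi> (r n) F x) ^ 6)) \<longlonglongrightarrow> ennreal (norm (F x) ^ 6)"
      by (intro tendsto_intros)
    then show ?case
      by (intro lim_imp_Liminf[symmetric]) auto
  qed
  have cS: "continuous_on UNIV (\<lambda>x. norm (LP_trunc \<psi> q F x) ^ 6)" for q
    by (intro continuous_intros continuous_LP_trunc[OF \<psi>])
  have [measurable]: "(\<lambda>x. norm (LP_trunc \<psi> q F x) ^ 6) \<in> borel_measurable torus" for q
    by (intro borel_measurable_torus_continuous cS)
  have "(\<integral>\<^sup>+x. ennreal (norm (F x) ^ 6) \<partial>torus) = (\<integral>\<^sup>+x. liminf (\<lambda>n. ennreal (norm (LP_trunc \<psi> (r n) F x) ^ 6)) \<partial>torus)"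
    by (rule nn_integral_cong_AE[OF lim])
  also have "\<dots> \<le> liminf (\<lambda>n. \<integral>\<^sup>+x. ennreal (norm (LP_trunc \<psi> (r n) F x) ^ 6) \<partial>torus)"
    by (rule nn_integral_liminf) measurable
  also have "\<dots> \<le> liminf (\<lambda>n::nat. ennreal (4096 * H ^ 4))"
  proof (rule Liminf_mono, rule always_eventually, rule allI)
    fix n
    have "(\<integral>\<^sup>+x. ennreal (norm (LP_trunc \<psi> (r n) F x) ^ 6) \<partial>torus) = ennreal (LINT x|torus. norm (LP_trunc \<psi> (r n) F x) ^ 6)"
      by (intro nn_integral_eq_integral integrable_torus_continuous cS) auto
    then show "(\<integral>\<^sup>+x. ennreal (norm (LP_trunc \<psi> (r n) F x) ^ 6) \<partial>torus) \<le> ennreal (4096 * H ^ 4)"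
      using bound[of "r n"] by (simp add: ennreal_leI)
  qed
  also have "\<dots> < \<infinity>"
    by (simp add: Liminf_const)
  finally have fin: "(\<integral>\<^sup>+x. ennreal (norm (F x) ^ 6) \<partial>torus) < \<infinity>" .
  show ?thesis
    unfolding integrable_iff_bounded using fin by simp
qed

lemma trilinear_bound:
  fixes a b c :: "real^2 \<Rightarrow> complex"
  assumes m [measurable]: "a \<in> borel_measurable torus" "b \<in> borel_measurable torus" "c \<in> borel_measurable torus"
    and int: "integrable torus (\<lambda>x. norm (a x) ^ 6)" "integrable torus (\<lambda>x. norm (b x) ^ 6)"
      "integrable torus (\<lambda>x. norm (c x) powr (3 / 2))"
    and pos: "A > 0" "B > 0" "C > 0"
    and le: "(LINT x|torus. norm (a x) ^ 6) \<le> A ^ 6" "(LINT x|torus. norm (b x) ^ 6) \<le> B ^ 6"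
      "(LINT x|torus. norm (c x) powr (3 / 2)) \<le> C powr (3 / 2)"
  shows "integrable torus (\<lambda>x. a x * b x * c x)"
    and "norm (LINT x|torus. a x * b x * c x) \<le> A * B * C"
proof -
  have n: "\<bar>norm (a x) * norm (b x) * norm (c x)\<bar> = norm (a x * b x * c x)" for x
    by (simp add: norm_mult)
  have "integrable torus (\<lambda>x. norm (a x) * norm (b x) * norm (c x))"
    by (rule holder_6_6_three_halves[OF _ _ _ _ _ _ pos]) (use int le in \<open>auto\<close>)
  then have "integrable torus (\<lambda>x. norm (a x * b x * c x))"
    by (simp add: norm_mult)
  then show "integrable torus (\<lambda>x. a x * b x * c x)"
    by (rule integrable_norm_cancel) measurable
  have "norm (LINT x|torus. a x * b x * c x) \<le> (LINT x|torus. norm (a x * b x * c x))"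
    by (rule integral_norm_bound)
  also have "\<dots> = (LINT x|torus. \<bar>norm (a x) * norm (b x) * norm (c x)\<bar>)"
    by (simp only: n)
  also have "\<dots> \<le> A * B * C"
    by (rule holder_6_6_three_halves(2)[OF _ _ _ _ _ _ pos]) (use int le in \<open>auto\<close>)
  finally show "norm (LINT x|torus. a x * b x * c x) \<le> A * B * C" .
qed

subsection \<open>The energy flux\<close>

lemma has_weak_partial_integrable:
  assumes "has_weak_partial j f g"
  shows "integrable torus f" "integrable torus g"
proof -
  have "torus_Lp 1 f" "torus_Lp 1 g"
    using assms unfolding has_weak_partial_def by blast+
  then show "integrable torus f" "integrable torus g"
    by (simp_all add: torus_L1_integrable)
qed

text \<open>Integration by parts puts all derivatives on \<open>u\<close>, where they add up to the
  divergence.\<close>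

lemma divergence_free_orthogonal:
  assumes div: "divergence_free u"
    and w: "\<And>j. has_weak_partial j (\<lambda>x. u x $ j) (weak_partial j (\<lambda>x. u x $ j))"
    and \<phi>: "trig_poly \<phi>"
  shows "(LINT x|torus. (\<Sum>j\<in>UNIV. u x $ j * partial j \<phi> x)) = 0"
proof -
  let ?W = "\<lambda>j. weak_partial j (\<lambda>x. u x $ j)"
  have int: "integrable torus (\<lambda>x. u x $ j)" "integrable torus (?W j)" for j
    using has_weak_partial_integrable[OF w] .
  have i1: "integrable torus (\<lambda>x. u x $ j * partial j \<phi> x)" for j
    by (intro integrable_mult_continuous int trig_poly_continuous trig_poly_partial \<phi>)
  have i2: "integrable torus (\<lambda>x. ?W j x * \<phi> x)" for j
    by (intro integrable_mult_continuous int trig_poly_continuous \<phi>)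
  have "(LINT x|torus. (\<Sum>j\<in>UNIV. u x $ j * partial j \<phi> x)) = (\<Sum>j\<in>UNIV. - (LINT x|torus. ?W j x * \<phi> x))"
    by (simp add: Bochner_Integration.integral_sum i1 has_weak_partial_trig_poly[OF w \<phi>])
  also have "\<dots> = - (LINT x|torus. (\<Sum>j\<in>UNIV. ?W j x) * \<phi> x)"
    by (simp add: sum_negf sum_distrib_right Bochner_Integration.integral_sum i2)
  also have "(LINT x|torus. (\<Sum>j\<in>UNIV. ?W j x) * \<phi> x) = (LINT x|torus. 0)"
  proof (rule integral_cong_AE)
    show "AE x in torus. (\<Sum>j\<in>UNIV. ?W j x) * \<phi> x = 0"
      using div unfolding divergence_free_def by eventually_elim simp
    show "(\<lambda>x. (\<Sum>j\<in>UNIV. ?W j x) * \<phi> x) \<in> borel_measurable torus"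
      using int(2) borel_measurable_torus_continuous[OF trig_poly_continuous[OF \<phi>]] by measurable
  qed simp
  finally show ?thesis by simp
qed

text \<open>The gradient of the energy density. As a test function, this density makes the
  cancellation valid for a merely weakly differentiable \<open>u\<close>.\<close>

lemma partial_half_square_sum:
  assumes R: "\<And>i. trig_poly (R i)"
  shows "trig_poly (\<lambda>x. \<Sum>i\<in>(UNIV :: 2 set). 1 / 2 * (R i x * R i x))"
    and "partial j (\<lambda>x. \<Sum>i\<in>(UNIV :: 2 set). 1 / 2 * (R i x * R i x)) x = (\<Sum>i\<in>UNIV. R i x * partial j (R i) x)"
proof -
  show "trig_poly (\<lambda>x. \<Sum>i\<in>(UNIV :: 2 set). 1 / 2 * (R i x * R i x))"
    by (intro trig_poly_sum trig_poly.intros R)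
  have d: "(R i has_derivative frechet_derivative (R i) (at x)) (at x)" for i
    using trig_poly_partial(1)[OF R] frechet_derivative_works by blast
  have "((\<lambda>x. \<Sum>i\<in>(UNIV :: 2 set). 1 / 2 * (R i x * R i x)) has_derivative
    (\<lambda>h. \<Sum>i\<in>UNIV. 1 / 2 * (R i x * frechet_derivative (R i) (at x) h + frechet_derivative (R i) (at x) h * R i x))) (at x)"
    by (intro has_derivative_sum has_derivative_mult_right has_derivative_mult d)
  from partial_eq[OF this, of j]
  show "partial j (\<lambda>x. \<Sum>i\<in>(UNIV :: 2 set). 1 / 2 * (R i x * R i x)) x = (\<Sum>i\<in>UNIV. R i x * partial j (R i) x)"
    by (simp add: partial_def field_simps sum_2)
qed

theorem proposition1:
  fixes u :: "real^2 \<Rightarrow> real^2" and \<psi> :: "real^2 \<Rightarrow> real"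
  assumes "LP_cutoff \<psi>"
    and "u \<in> sobolev_W1 (3/2)"
    and "divergence_free u"
  shows "(\<lambda>q. energy_flux \<psi> q u) \<longlonglongrightarrow> 0"
proof (rule LIMSEQ_I)
  fix \<epsilon> :: real assume \<epsilon>: "\<epsilon> > 0"
  note \<psi> = assms(1)
  define F where "F = (\<lambda>i x. complex_of_real (u x $ i))"
  define W where "W = (\<lambda>i j. weak_partial j (\<lambda>x. u x $ i))"
  define G where "G = (\<lambda>i j x. complex_of_real (W i j x))"
  define A where "A = (\<lambda>i x. complex_of_real (advect u x $ i))"
  let ?S = "LP_trunc \<psi>"
  let ?N = "\<lambda>f. LINT x|torus. norm (f x) powr (3 / 2)"

  have uLp: "torus_Lp (3 / 2) u"
    and ex: "\<And>i j. \<exists>g. torus_Lp (3 / 2) g \<and> has_weak_partial j (\<lambda>x. u x $ i) g"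
    using assms(2) unfolding sobolev_W1_def by blast+
  have w: "has_weak_partial j (\<lambda>x. u x $ i) (W i j)" and GLp: "Lp (3 / 2) (G i j)" for i j
  proof -
    obtain g where g: "has_weak_partial j (\<lambda>x. u x $ i) g" "torus_Lp (3 / 2) g"
      using ex by blast
    show "has_weak_partial j (\<lambda>x. u x $ i) (W i j)" "Lp (3 / 2) (G i j)"
      unfolding W_def G_def by (rule Lp_weak_partial[OF \<psi> g])+
  qed
  have ui: "integrable torus (\<lambda>x. u x $ i)" for i
    by (rule has_weak_partial_integrable(1)[OF w[of 1 i]])
  have um [measurable]: "(\<lambda>x. u x $ i) \<in> borel_measurable torus" for i
    using ui by (rule borel_measurable_integrable)
  have FLp: "Lp (3 / 2) (F i)" for i
  proof -
    have "integrable torus (\<lambda>x. norm (u x) powr (3 / 2))"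
      using uLp[unfolded torus_Lp_def] by (elim conjE)
    then have "integrable torus (\<lambda>x. norm (F i x) powr (3 / 2))"
      by (rule Bochner_Integration.integrable_bound)
        (auto simp: F_def intro!: AE_I2 powr_mono2 component_le_norm_cart)
    then show ?thesis unfolding Lp_def F_def by auto
  qed
  have FG: "coeff_deriv j (F i) (G i j)" for i j
    unfolding F_def G_def by (rule has_weak_partial_coeff_deriv[OF w])
  have Fm [measurable]: "F i \<in> borel_measurable torus" and Gm [measurable]: "G i j \<in> borel_measurable torus" for i j
    using FLp GLp unfolding Lp_def by auto
  have Fi: "integrable torus (F i)" and Gi: "integrable torus (G i j)" for i j
    using Lp_integrable[OF FLp] Lp_integrable[OF GLp] by auto
  have Gp: "integrable torus (\<lambda>x. norm (G i j x) powr (3 / 2))" for i j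
    using GLp unfolding Lp_def by blast
  have F6: "integrable torus (\<lambda>x. norm (F i x) ^ 6)" for i
    by (rule sobolev_L6[OF \<psi> FG FLp GLp])

  obtain M where M: "M > 0"
    "\<And>p q f. p \<ge> 1 \<Longrightarrow> Lp p f \<Longrightarrow> (LINT x|torus. norm (?S q f x) powr p) \<le> M powr p * (LINT x|torus. norm (f x) powr p)"
    by (rule LP_trunc_Lp_bound[OF \<psi>]) (rule that; blast)
  have MN: "?N (?S q f) \<le> M powr (3 / 2) * D" if "Lp (3 / 2) f" "?N f \<le> D" for q f D
    using order_trans[OF M(2)[OF _ that(1)] mult_left_mono[OF that(2), of "M powr (3 / 2)"]] by simp
  have N0: "?N f \<ge> 0" for f :: "real^2 \<Rightarrow> complex"
    by (intro Bochner_Integration.integral_nonneg) auto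

  \<comment> \<open>The 1 added to the sum keeps the bound positive, as the Hoelder estimates
    require.\<close>
  obtain D where D: "D > 0" "\<And>i. ?N (F i) \<le> D" "\<And>i j. ?N (G i j) \<le> D"
  proof
    let ?D = "(\<Sum>i\<in>UNIV. ?N (F i) + (\<Sum>j\<in>UNIV. ?N (G i j))) + 1"
    have i: "?N (F i) + (\<Sum>j\<in>UNIV. ?N (G i j)) \<le> (\<Sum>i\<in>UNIV. ?N (F i) + (\<Sum>j\<in>UNIV. ?N (G i j)))" for i
      using N0 by (intro member_le_sum add_nonneg_nonneg sum_nonneg) auto
    have j: "?N (G i j) \<le> (\<Sum>j\<in>UNIV. ?N (G i j))" for i j
      using N0 by (intro member_le_sum) auto
    show "?D > 0" "?N (F i) \<le> ?D" "?N (G i j) \<le> ?D" for i j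
      using i[of i] j[of i j] N0[of "F i"] N0[of "G i j"] by linarith+
  qed
  define C where "C = D powr (2 / 3)"
  have C: "C > 0" "C powr (3 / 2) = D" using D(1) by (auto simp: C_def powr_powr)
  obtain U where U: "U > 0" "\<And>i. (LINT x|torus. norm (F i x) ^ 6) \<le> U ^ 6"
  proof
    define X where "X = (\<Sum>i\<in>UNIV. (LINT x|torus. norm (F i x) ^ 6)) + 1"
    have X0: "(LINT x|torus. norm (F i x) ^ 6) \<ge> 0" for i
      by (intro Bochner_Integration.integral_nonneg) auto
    then have X: "X > 0" "(LINT x|torus. norm (F i x) ^ 6) \<le> X" for i
      using member_le_sum[of i UNIV "\<lambda>i. LINT x|torus. norm (F i x) ^ 6"]
        sum_nonneg[of UNIV "\<lambda>i. LINT x|torus. norm (F i x) ^ 6"] unfolding X_def by (simp_all add: add_nonneg_pos)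
    have "(X powr (1 / 6)) ^ 6 = X"
      using X(1) by (simp add: powr_powr flip: powr_numeral)
    then show "X powr (1 / 6) > 0" "(LINT x|torus. norm (F i x) ^ 6) \<le> (X powr (1 / 6)) ^ 6" for i
      using X by auto
  qed

  \<comment> \<open>\<open>P6\<close> bounds the \<open>L^6\<close> norm of the truncations of all
    levels at once, by \<open>LP_trunc_L6\<close> with \<open>H = M powr (3 / 2) * D\<close> and
    4096 = 4^6. Hence \<open>c\<close> and \<open>e\<close> can be fixed before the level
    \<open>m\<close>, which depends on them.\<close>
  define P6 where "P6 = 4 * (M powr (3 / 2) * D) powr (2 / 3)"
  \<comment> \<open>There are four index pairs; each contributes 4 M^2 U C from the term with
    \<open>V\<close> and \<open>P6 * U\<close> from the term with \<open>P\<close>, both times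
    \<open>e powr (2 / 3)\<close>. The choice of \<open>e\<close> below turns the total into
    \<open>\<epsilon> / 2\<close>.\<close>
  define c where "c = 4 * U * (4 * M\<^sup>2 * C + P6)"
  have P6: "P6 > 0" using M(1) D(1) by (simp add: P6_def)
  have c: "c > 0" unfolding c_def using U(1) M(1) C(1) P6 by (intro mult_pos_pos add_pos_pos) auto
  have sixth: "(4 * H powr (2 / 3)) ^ 6 = 4096 * H ^ 4" if "H > 0" for H :: real
    using that by (simp add: power_mult_distrib powr_powr flip: powr_numeral)
  define e where "e = (\<epsilon> / (2 * c)) powr (3 / 2)"
  have e: "e > 0" "e powr (2 / 3) = \<epsilon> / (2 * c)" using \<epsilon> c by (auto simp: e_def powr_powr)

  have "eventually (\<lambda>m. \<forall>i. ?N (\<lambda>x. ?S m (F i) x - F i x) < e \<and> (\<forall>j. ?N (\<lambda>x. ?S m (G i j) x - G i j x) < e)) sequentially"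
    by (intro eventually_all_finite eventually_conj order_tendstoD(2)[OF LP_trunc_tendsto[OF \<psi>]] FLp GLp e) simp_all
  then obtain m where m: "\<And>i. ?N (\<lambda>x. ?S m (F i) x - F i x) < e" "\<And>i j. ?N (\<lambda>x. ?S m (G i j) x - G i j x) < e"
    unfolding eventually_sequentially by blast
  define P where "P = (\<lambda>i. ?S m (F i))"
  define Q where "Q = (\<lambda>i j. ?S m (G i j))"
  have swap: "?N (\<lambda>x. f x - g x) = ?N (\<lambda>x. g x - f x)" for f g :: "real^2 \<Rightarrow> complex"
    by (simp add: norm_minus_commute)
  have dF: "?N (\<lambda>x. F i x - P i x) \<le> e" and dG: "?N (\<lambda>x. G i j x - Q i j x) \<le> e" for i j
    using m(1)[of i] m(2)[of i j] swap unfolding P_def Q_def by (metis less_imp_le)+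
  have PLp: "Lp (3 / 2) (P i)" and QLp: "Lp (3 / 2) (Q i j)" for i j
    unfolding P_def Q_def by (intro LP_trunc_Lp[OF \<psi>]; simp)+
  have dFLp: "Lp (3 / 2) (\<lambda>x. F i x - P i x)" and dGLp: "Lp (3 / 2) (\<lambda>x. G i j x - Q i j x)" for i j
    by (intro Lp_diff FLp PLp GLp QLp; simp)+
  have Pc: "continuous_on UNIV (P i)" and Qc: "continuous_on UNIV (Q i j)" for i j
    unfolding P_def Q_def by (intro continuous_LP_trunc[OF \<psi>])+
  have Pm [measurable]: "P i \<in> borel_measurable torus" and Qm [measurable]: "Q i j \<in> borel_measurable torus" for i j
    by (intro borel_measurable_torus_continuous Pc Qc)+
  have P6i: "integrable torus (\<lambda>x. norm (P i x) ^ 6)" for i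
    by (intro integrable_torus_continuous continuous_intros Pc)
  have P6le: "(LINT x|torus. norm (P i x) ^ 6) \<le> P6 ^ 6" for i
    unfolding P_def P6_def using M(1) D
    by (subst sixth) (auto intro!: LP_trunc_L6[where G = "G i", OF \<psi> FG] MN FLp GLp)

  have tri1: "integrable torus (\<lambda>x. P i x * F j x * G i j x)" for i j
    by (rule trilinear_bound[OF _ _ _ P6i F6 Gp P6 U(1) C(1) P6le U(2)]) (use C D in auto)
  have tri2: "integrable torus (\<lambda>x. P i x * F j x * (G i j x - Q i j x))"
    "norm (LINT x|torus. P i x * F j x * (G i j x - Q i j x)) \<le> P6 * U * e powr (2 / 3)" for i j
    by (rule trilinear_bound[where C = "e powr (2 / 3)", OF _ _ _ P6i F6 _ P6 U(1) _ P6le U(2)];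
        use dGLp[of i j] dG[of i j] e(1) in \<open>simp add: Lp_def powr_powr\<close>)+
  have one6: "integrable torus (\<lambda>x. norm (1::complex) ^ 6)" by simp
  have Ai: "A i = (\<lambda>x. \<Sum>j\<in>UNIV. F j x * G i j x)" for i
    by (rule ext) (simp add: A_def F_def G_def W_def advect_def)
  \<comment> \<open>The same Hoelder estimate with the constant 1 as first factor, whose
    \<open>L^6\<close> norm is 1 because the cell has measure 1.\<close>
  have FGi: "integrable torus (\<lambda>x. F j x * G i j x)" for i j
    using trilinear_bound(1)[of "\<lambda>_. 1" "F j" "G i j" 1 U C, OF _ _ _ one6 F6 Gp _ U(1) C(1) _ U(2)] C D
    by (simp add: measure_def emeasure_torus)
  have AI: "integrable torus (A i)" for i
    unfolding Ai by (intro Bochner_Integration.integrable_sum FGi)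

  \<comment> \<open>\<open>P\<close> is real and \<open>Q i j\<close> is the classical derivative of
    \<open>P i\<close>, so the double sum is the integral of \<open>u\<close> against the gradient
    of half the squared modulus of \<open>P\<close>.\<close>
  have zero: "(\<Sum>i\<in>UNIV. \<Sum>j\<in>UNIV. LINT x|torus. P i x * F j x * Q i j x) = 0"
  proof -
    define R where "R = (\<lambda>i x. Re (P i x))"
    have R: "trig_poly (R i)" for i
      unfolding R_def P_def by (rule trig_poly_Re_LP_trunc[OF \<psi>])
    have PR: "P i x = of_real (R i x)" for i x
      unfolding R_def P_def F_def by (rule LP_trunc_real[OF \<psi> ui])
    have Wi: "integrable torus (W i j)" for i j
      by (rule has_weak_partial_integrable(2)[OF w])
    have QR: "Q i j x = of_real (partial j (R i) x)" for i j x
    proof -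
      have "partial j (R i) x = Re (Q i j x)"
        unfolding R_def P_def Q_def by (rule partial_Re_LP_trunc[OF \<psi> FG])
      then show ?thesis
        unfolding Q_def G_def using LP_trunc_real[OF \<psi> Wi] by simp
    qed
    have i: "integrable torus (\<lambda>x. P i x * F j x * Q i j x)" for i j
      using Bochner_Integration.integrable_diff[OF tri1 tri2(1), of i j i j] by (simp add: algebra_simps)
    let ?\<phi> = "\<lambda>x. \<Sum>i\<in>(UNIV :: 2 set). 1 / 2 * (R i x * R i x)"
    have "(\<Sum>i\<in>UNIV. \<Sum>j\<in>UNIV. LINT x|torus. P i x * F j x * Q i j x) =
      (LINT x|torus. (\<Sum>i\<in>UNIV. \<Sum>j\<in>UNIV. P i x * F j x * Q i j x))"
      by (simp add: Bochner_Integration.integral_sum i)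
    also have "\<dots> = (LINT x|torus. complex_of_real (\<Sum>j\<in>UNIV. u x $ j * partial j ?\<phi> x))"
      unfolding partial_half_square_sum(2)[OF R] PR QR F_def
      by (intro Bochner_Integration.integral_cong refl) (simp add: sum_2 algebra_simps)
    also have "\<dots> = 0"
      unfolding integral_complex_of_real
      using divergence_free_orthogonal[OF assms(3) w[unfolded W_def] partial_half_square_sum(1)[OF R]] by simp
    finally show ?thesis .
  qed

  have "norm (energy_flux \<psi> q u - 0) < \<epsilon>" if q: "q \<ge> Suc m" for q
  proof -
    \<comment> \<open>\<open>P\<close> is fixed by the double truncation, so \<open>V\<close> is the
      doubly truncated error \<open>F - P\<close> and inherits its smallness in the Sobolev norm,
      uniformly in \<open>q\<close>.\<close>
    define V where "V = (\<lambda>i x. ?S q (?S q (F i)) x - P i x)"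
    have PSS: "P i = ?S q (?S q (P i))" for i
      unfolding P_def using q by (simp add: LP_trunc_LP_trunc[OF \<psi>])
    have Pint: "integrable torus (P i)" "integrable torus (Q i j)" for i j
      by (intro integrable_torus_continuous Pc Qc)+
    have V: "V i = ?S q (?S q (\<lambda>x. F i x - P i x))" for i
    proof
      fix x
      have "?S q (\<lambda>x. F i x - P i x) = (\<lambda>x. ?S q (F i) x - ?S q (P i) x)"
        by (rule ext) (rule LP_trunc_diff[OF \<psi> Fi Pint(1)])
      then have "?S q (?S q (\<lambda>x. F i x - P i x)) x = ?S q (?S q (F i)) x - ?S q (?S q (P i)) x"
        by (simp add: LP_trunc_diff[OF \<psi>] integrable_torus_continuous continuous_LP_trunc[OF \<psi>])
      then show "V i x = ?S q (?S q (\<lambda>x. F i x - P i x)) x"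
        unfolding V_def using PSS[of i] by simp
    qed
    \<comment> \<open>One factor \<open>M powr (3 / 2)\<close> for each of the two truncations; the
      power 2/3 of this product is the M^2 in \<open>c\<close>.\<close>
    define H where "H = M powr (3 / 2) * (M powr (3 / 2) * e)"
    have H: "H > 0" using M(1) e(1) by (simp add: H_def)
    have H3: "H = M ^ 3 * e" using M(1) by (simp add: H_def flip: powr_add mult.assoc)
    have SSH: "?N (?S q (?S q f)) \<le> H" if "Lp (3 / 2) f" "?N f \<le> e" for f
      unfolding H_def by (intro MN that LP_trunc_Lp[OF \<psi>]) auto
    have V6: "(LINT x|torus. norm (V i x) ^ 6) \<le> (4 * M\<^sup>2 * e powr (2 / 3)) ^ 6" for i
    proof -
      have der: "coeff_deriv j (?S q (\<lambda>x. F i x - P i x)) (?S q (\<lambda>x. G i j x - Q i j x))" for j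
        by (intro coeff_deriv_LP_trunc[OF \<psi>] coeff_deriv_diff FG Fi Gi Pint)
          (unfold P_def Q_def, intro coeff_deriv_LP_trunc[OF \<psi>] FG)
      have "(LINT x|torus. norm (V i x) ^ 6) \<le> 4096 * H ^ 4"
        unfolding V by (rule LP_trunc_L6[OF \<psi> der H]) (intro SSH dFLp dGLp dF dG)+
      also have "\<dots> = (4 * H powr (2 / 3)) ^ 6"
        by (rule sixth[OF H, symmetric])
      also have "H powr (2 / 3) = M\<^sup>2 * e powr (2 / 3)"
        unfolding H3 using M(1) e(1) by (simp add: powr_mult powr_powr flip: powr_numeral)
      finally show ?thesis by (simp add: mult.assoc)
    qed
    have Vc: "continuous_on UNIV (V i)" for i
      unfolding V by (rule continuous_LP_trunc[OF \<psi>])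
    have Vm [measurable]: "V i \<in> borel_measurable torus" for i
      by (intro borel_measurable_torus_continuous Vc)
    have V6i: "integrable torus (\<lambda>x. norm (V i x) ^ 6)" for i
      by (intro integrable_torus_continuous continuous_intros Vc)
    have Ve: "4 * M\<^sup>2 * e powr (2 / 3) > 0" using M(1) e(1) by simp
    have tri3: "integrable torus (\<lambda>x. V i x * F j x * G i j x)"
      "norm (LINT x|torus. V i x * F j x * G i j x) \<le> (4 * M\<^sup>2 * e powr (2 / 3)) * U * C" for i j
      by (rule trilinear_bound[OF _ _ _ V6i F6 Gp Ve U(1) C(1) V6 U(2)]; use C D in simp)+
    have SA: "integrable torus (\<lambda>x. ?S q (F i) x * ?S q (A i) x)" for i
      by (intro integrable_torus_continuous continuous_intros continuous_LP_trunc[OF \<psi>])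
    have split: "?S q (?S q (F i)) x * A i x = (\<Sum>j\<in>UNIV. V i x * F j x * G i j x + P i x * F j x * G i j x)" for i x
      by (simp add: Ai V_def sum_2 algebra_simps)
    have "energy_flux \<psi> q u = (LINT x|torus. (\<Sum>i\<in>UNIV. ?S q (F i) x * ?S q (A i) x))"
      by (simp add: energy_flux_def LP_trunc_vec_def F_def A_def)
    also have "\<dots> = (\<Sum>i\<in>UNIV. LINT x|torus. ?S q (?S q (F i)) x * A i x)"
      by (simp add: Bochner_Integration.integral_sum SA LP_trunc_self_adjoint[OF \<psi> AI])
    also have "\<dots> = (\<Sum>i\<in>UNIV. \<Sum>j\<in>UNIV. (LINT x|torus. V i x * F j x * G i j x) + (LINT x|torus. P i x * F j x * G i j x))"
      by (simp add: split Bochner_Integration.integral_sum tri1 tri3(1))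
    \<comment> \<open>Subtracting the vanishing sum replaces \<open>G\<close> by
      \<open>G - Q\<close> in the terms with \<open>P\<close>, which makes them small.\<close>
    also have "\<dots> = (\<Sum>i\<in>UNIV. \<Sum>j\<in>UNIV. (LINT x|torus. V i x * F j x * G i j x) + (LINT x|torus. P i x * F j x * G i j x)) -
        (\<Sum>i\<in>UNIV. \<Sum>j\<in>UNIV. LINT x|torus. P i x * F j x * Q i j x)"
      by (simp only: zero diff_0_right)
    also have "\<dots> = (\<Sum>i\<in>UNIV. \<Sum>j\<in>UNIV. (LINT x|torus. V i x * F j x * G i j x) +
        (LINT x|torus. P i x * F j x * (G i j x - Q i j x)))"
    proof -
      have PFQ: "integrable torus (\<lambda>x. P i x * F j x * Q i j x)" for i j
        using Bochner_Integration.integrable_diff[OF tri1 tri2(1), of i j i j] by (simp add: algebra_simps)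
      have "(LINT x|torus. P i x * F j x * (G i j x - Q i j x)) =
        (LINT x|torus. P i x * F j x * G i j x) - (LINT x|torus. P i x * F j x * Q i j x)" for i j
        unfolding right_diff_distrib by (rule Bochner_Integration.integral_diff[OF tri1 PFQ])
      then show ?thesis by (simp add: sum_2)
    qed
    finally have eq: "energy_flux \<psi> q u = (\<Sum>i\<in>UNIV. \<Sum>j\<in>UNIV. (LINT x|torus. V i x * F j x * G i j x) +
        (LINT x|torus. P i x * F j x * (G i j x - Q i j x)))" .
    have "norm (energy_flux \<psi> q u) \<le> (\<Sum>i\<in>(UNIV::2 set). \<Sum>j\<in>(UNIV::2 set).
        (4 * M\<^sup>2 * e powr (2 / 3)) * U * C + P6 * U * e powr (2 / 3))"
      unfolding eq
      by (intro order_trans[OF norm_sum] sum_mono order_trans[OF norm_triangle_ineq] add_mono tri2(2) tri3(2))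
    also have "\<dots> = c * e powr (2 / 3)"
      by (simp add: sum_2 c_def algebra_simps)
    also have "\<dots> = \<epsilon> / 2"
      using c by (simp add: e(2))
    also have "\<dots> < \<epsilon>" using \<epsilon> by simp
    finally show ?thesis by simp
  qed
  then show "\<exists>q0. \<forall>q\<ge>q0. norm (energy_flux \<psi> q u - 0) < \<epsilon>"
    by blast
qed

end
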